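(* Let $G$ be a basic CUH graph which omits $D$ or omits $\widetilde{D}$, and in which not both color classes are independent sets. Then every non-monochromatic graph in $O(G)$ is isomorphic to one of $T_r,\widetilde{T}_r,T_b,\widetilde{T}_b,D,\widetilde{D}$. Moreover, for each $H\in\{T_r,\widetilde{T}_r,T_b,\widetilde{T}_b,D,\widetilde{D}\}$ we have $H\in O(G)$ if and only if $\widetilde{H}\in O(G)$. In particular, $G$ and $\widetilde{G}$ are isomorphic.
   Context: All graphs are simple. A 2-colored graph is a graph with a map $\chi\colon V(G)\to\{\text{red},\text{blue}\}$; $R,B$ are the red and blue vertex sets; induced subgraphs inherit colors; isomorphisms are color-preserving. $G$ is ultrahomogeneous if every isomorphism between finite induced subgraphs extends to an automorphism. Cross edges join vertices of different colors; $\widetilde{G}$ is obtained from $G$ by complementing the set of cross edges (keeping edges inside color classes). A CUH graph is a countably infinite ultrahomogeneous 2-colored graph in which $G[R]$ and $G[B]$ are disjoint unions of cliques; $\alpha_R,\alpha_B$ are the independence numbers of $G[R],G[B]$. $G$ is a blow-up if for one color $c$ (other color $c'$) there are a 2-colored graph $H$ whose $c$-colored vertices are independent and $i\in\mathbb{N}_{\ge2}\cup\{\aleph_0\}$ such that $G$ arises from $H$ by replacing each $c$-colored vertex $u$ by a $c$-colored $i$-clique whose vertices are adjacent exactly to the other vertices of the clique and to the $c'$-colored neighbors of $u$ in $H$. A CUH graph is basic if it is not a blow-up and $\min\{\alpha_R,\alpha_B\}\ge2$. A finite 2-colored graph is realized in $G$ if it is isomorphic to an induced subgraph of $G$ and omitted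 otherwise; it is minimally omitted if it is omitted and all its proper induced subgraphs are realized. $O(G)$ is the set of minimally omitted graphs (up to isomorphism). A graph is monochromatic if it has only one color. $T_r$: triangle with two red and one blue vertex; $T_b$: triangle with one red and two blue vertices; $\widetilde{T}_r$: two adjacent red vertices and a blue vertex with no cross edges; $\widetilde{T}_b$: two adjacent blue vertices and a red vertex with no cross edges. $D$: red $r_1,r_2$, blue $b_1,b_2$, edges $r_1r_2,b_1b_2,r_1b_1,r_1b_2,r_2b_1$. $\widetilde{D}$: red $r_1,r_2$, blue $b_1,b_2$, edges $r_1r_2,b_1b_2,r_2b_2$. Note $\widetilde{\widetilde{H}}=H$. *)

theory Defs
  imports "HOL-Library.Countable_Set" "HOL-Library.Disjoint_Sets" "HOL-Library.Extended_Nat"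
begin

datatype color = Red | Blue

record 'a cgraph =
  verts :: "'a set"
  adj :: "'a \<Rightarrow> 'a \<Rightarrow> bool"
  col :: "'a \<Rightarrow> color"

text \<open>The colouring is a total function whose values outside the vertex set are irrelevant:
  every notion below only inspects colours of vertices.\<close>

definition two_colored_graph :: "'a cgraph \<Rightarrow> bool" where
  "two_colored_graph G \<longleftrightarrow>
     (\<forall>x y. adj G x y \<longrightarrow> x \<in> verts G \<and> y \<in> verts G \<and> x \<noteq> y \<and> adj G y x)"

definition color_class :: "'a cgraph \<Rightarrow> color \<Rightarrow> 'a set" where
  "color_class G c = {x \<in> verts G. col G x = c}"

definition induced :: "'a cgraph \<Rightarrow> 'a set \<Rightarrow> 'a cgraph" where
  "induced G S = \<lparr>verts = verts G \<inter> S,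
                  adj = (\<lambda>x y. x \<in> S \<and> y \<in> S \<and> adj G x y),
                  col = col G\<rparr>"

definition is_iso :: "('a \<Rightarrow> 'b) \<Rightarrow> 'a cgraph \<Rightarrow> 'b cgraph \<Rightarrow> bool" where
  "is_iso f G H \<longleftrightarrow> bij_betw f (verts G) (verts H) \<and>
     (\<forall>x\<in>verts G. col H (f x) = col G x) \<and>
     (\<forall>x\<in>verts G. \<forall>y\<in>verts G. adj H (f x) (f y) \<longleftrightarrow> adj G x y)"

definition isomorphic :: "'a cgraph \<Rightarrow> 'b cgraph \<Rightarrow> bool" where
  "isomorphic G H \<longleftrightarrow> (\<exists>f. is_iso f G H)"

definition ultrahomogeneous :: "'a cgraph \<Rightarrow> bool" where
  "ultrahomogeneous G \<longleftrightarrow>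
     (\<forall>A B f. A \<subseteq> verts G \<and> B \<subseteq> verts G \<and> finite A \<and> finite B \<and>
        is_iso f (induced G A) (induced G B) \<longrightarrow>
        (\<exists>g. is_iso g G G \<and> (\<forall>x\<in>A. g x = f x)))"

definition cross_complement :: "'a cgraph \<Rightarrow> 'a cgraph" where
  "cross_complement G = \<lparr>verts = verts G,
     adj = (\<lambda>x y. x \<in> verts G \<and> y \<in> verts G \<and>
              (if col G x = col G y then adj G x y else \<not> adj G x y)),
     col = col G\<rparr>"

definition disjoint_union_of_cliques :: "'a cgraph \<Rightarrow> bool" where
  "disjoint_union_of_cliques G \<longleftrightarrow>
     (\<exists>P. partition_on (verts G) P \<and>
        (\<forall>x\<in>verts G. \<forall>y\<in>verts G. adj G x y \<longleftrightarrow> x \<noteq> y \<and> (\<exists>C\<in>P. x \<in> C \<and> y \<in> C)))"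

definition CUH :: "'a cgraph \<Rightarrow> bool" where
  "CUH G \<longleftrightarrow> two_colored_graph G \<and> countable (verts G) \<and> infinite (verts G) \<and>
     ultrahomogeneous G \<and>
     disjoint_union_of_cliques (induced G (color_class G Red)) \<and>
     disjoint_union_of_cliques (induced G (color_class G Blue))"

definition independent_set :: "'a cgraph \<Rightarrow> 'a set \<Rightarrow> bool" where
  "independent_set G S \<longleftrightarrow> S \<subseteq> verts G \<and> (\<forall>x\<in>S. \<forall>y\<in>S. \<not> adj G x y)"

definition independence_number :: "'a cgraph \<Rightarrow> enat" where
  "independence_number G = Sup {enat (card S) | S. finite S \<and> independent_set G S}"

definition alpha :: "'a cgraph \<Rightarrow> color \<Rightarrow> enat" where
  "alpha G c = independence_number (induced G (color_class G c))"

text \<open>In \<open>blow_up H c i\<close> a vertex \<open>u\<close> of colour \<open>c\<close> becomes the clique of all \<open>(u, k)\<close> with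
  \<open>k < i\<close> (where \<open>i = \<infinity>\<close> stands for \<open>\<aleph>\<^sub>0\<close>), and any other vertex \<open>u\<close> becomes \<open>(u, 0)\<close>.\<close>

definition blow_up_verts :: "'a cgraph \<Rightarrow> color \<Rightarrow> enat \<Rightarrow> ('a \<times> nat) set" where
  "blow_up_verts H c i =
     {(u, k). u \<in> verts H \<and> (if col H u = c then enat k < i else k = 0)}"

definition blow_up :: "'a cgraph \<Rightarrow> color \<Rightarrow> enat \<Rightarrow> ('a \<times> nat) cgraph" where
  "blow_up H c i = \<lparr>verts = blow_up_verts H c i,
     adj = (\<lambda>x y. x \<in> blow_up_verts H c i \<and> y \<in> blow_up_verts H c i \<and>
              (adj H (fst x) (fst y) \<or> fst x = fst y \<and> snd x \<noteq> snd y)),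
     col = (\<lambda>x. col H (fst x))\<rparr>"

text \<open>Taking \<open>H\<close> on the same vertex type as \<open>G\<close> is no restriction, since \<open>H\<close> embeds into
  its blow-up.\<close>

definition is_blow_up :: "'a cgraph \<Rightarrow> bool" where
  "is_blow_up G \<longleftrightarrow>
     (\<exists>c (H :: 'a cgraph) i. two_colored_graph H \<and> independent_set H (color_class H c) \<and>
        2 \<le> i \<and> isomorphic G (blow_up H c i))"

definition basic :: "'a cgraph \<Rightarrow> bool" where
  "basic G \<longleftrightarrow> \<not> is_blow_up G \<and> min (alpha G Red) (alpha G Blue) \<ge> 2"

definition realized :: "'a cgraph \<Rightarrow> 'b cgraph \<Rightarrow> bool" where
  "realized G H \<longleftrightarrow> (\<exists>S\<subseteq>verts G. isomorphic H (induced G S))"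

abbreviation omits :: "'a cgraph \<Rightarrow> 'b cgraph \<Rightarrow> bool" where
  "omits G H \<equiv> \<not> realized G H"

text \<open>The set of minimally omitted graphs is closed under isomorphism; its members may live
  on any vertex type.\<close>

definition min_omitted :: "'a cgraph \<Rightarrow> 'b cgraph set" where
  "min_omitted G = {H. two_colored_graph H \<and> finite (verts H) \<and> omits G H \<and>
                       (\<forall>S. S \<subset> verts H \<longrightarrow> realized G (induced H S))}"

definition monochromatic :: "'a cgraph \<Rightarrow> bool" where
  "monochromatic G \<longleftrightarrow> (\<exists>c. \<forall>x\<in>verts G. col G x = c)"

definition mk_cgraph :: "nat set \<Rightarrow> nat set \<Rightarrow> (nat \<times> nat) set \<Rightarrow> nat cgraph" where
  "mk_cgraph R B E = \<lparr>verts = R \<union> B,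
     adj = (\<lambda>x y. (x, y) \<in> E \<or> (y, x) \<in> E),
     col = (\<lambda>x. if x \<in> R then Red else Blue)\<rparr>"

text \<open>\<open>r\<^sub>1 = 0\<close>, \<open>r\<^sub>2 = 1\<close>, \<open>b\<^sub>1 = 2\<close>, \<open>b\<^sub>2 = 3\<close>; the suffix \<open>t\<close> stands for the tilde.\<close>

definition T_r :: "nat cgraph" where
  "T_r = mk_cgraph {0, 1} {2} {(0, 1), (0, 2), (1, 2)}"

definition T_b :: "nat cgraph" where
  "T_b = mk_cgraph {0} {2, 3} {(2, 3), (0, 2), (0, 3)}"

definition Tt_r :: "nat cgraph" where
  "Tt_r = mk_cgraph {0, 1} {2} {(0, 1)}"

definition Tt_b :: "nat cgraph" where
  "Tt_b = mk_cgraph {0} {2, 3} {(2, 3)}"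

definition D :: "nat cgraph" where
  "D = mk_cgraph {0, 1} {2, 3} {(0, 1), (2, 3), (0, 2), (0, 3), (1, 2)}"

definition Dt :: "nat cgraph" where
  "Dt = mk_cgraph {0, 1} {2, 3} {(0, 1), (2, 3), (1, 3)}"

lemma cross_complement_simps:
  "cross_complement T_r = Tt_r" "cross_complement Tt_r = T_r"
  "cross_complement T_b = Tt_b" "cross_complement Tt_b = T_b"
  "cross_complement D = Dt" "cross_complement Dt = D"
  by (auto simp: cross_complement_def mk_cgraph_def T_r_def Tt_r_def T_b_def Tt_b_def
      D_def Dt_def fun_eq_iff)

lemma two_colored_graph_cross_complement:
  "two_colored_graph G \<Longrightarrow> two_colored_graph (cross_complement G)"
  by (auto simp: two_colored_graph_def cross_complement_def split: if_splits)

lemma two_colored_graph_blow_up: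
  "two_colored_graph H \<Longrightarrow> two_colored_graph (blow_up H c i)"
  by (auto simp: two_colored_graph_def blow_up_def)

lemma two_colored_graph_small:
  "two_colored_graph T_r" "two_colored_graph Tt_r" "two_colored_graph T_b"
  "two_colored_graph Tt_b" "two_colored_graph D" "two_colored_graph Dt"
  by (auto simp: two_colored_graph_def mk_cgraph_def T_r_def Tt_r_def T_b_def Tt_b_def
      D_def Dt_def)

end

theory Submission
  imports Defs
begin

text \<open>
  Since \<open>G\<close> is not a blow-up, ultrahomogeneity forces every vertex to split every nontrivial clique
  of the other colour. If \<open>D\<close> is omitted, the cross edges between two cliques form disjoint
  complete bipartite graphs; three or more of them would contradict ultrahomogeneity, so there are
  two, and every \<open>2 \<times> 2\<close> pattern between a red and a blue edge has an even number of cross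
  edges. Now compare two adjacent vertices \<open>b\<close>, \<open>b'\<close> of a clique with at least three vertices:
  moving them by automorphisms shows that all sets of vertices of the other colour (or
  of cliques, if that colour has edges) on which \<open>b\<close> and \<open>b'\<close> show a prescribed behaviour
  are infinite. Hence large cliques contain all types over independent sets of the other colour,
  whereas in a clique with two vertices the second one is determined by the first.
  This realizes every finite graph that avoids the omitted ones among the six and whose colour
  classes are realized. The triangles \<open>T\<close> and \<open>Tt\<close> of a colour are realized exactly if its cliques
  have at least three vertices, and \<open>D\<close>, \<open>Dt\<close> never are, so the age is invariant under complementing
  the cross edges, and a back-and-forth argument yields the isomorphism.
\<close>

section \<open>Partial isomorphisms\<close>

text \<open>Ultrahomogeneity creates no configuration; it only moves existing ones. To give
  \<open>b0'\<close> a neighbour with prescribed adjacencies to a finite set \<open>X\<close>, one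
  therefore looks for a copy of \<open>X\<close> on which a known edge \<open>b0 b\<close> already
  shows the wanted behaviour, and moves it. Such a copy exists as soon as each prescribed behaviour
  occurs often enough, so the real obstacle is counting. Finiteness is mostly refuted by the same
  moving argument: it produces an edge whose cell is too large, or a vertex that breaks an inclusion
  which automorphisms must respect. If the other colour has edges, parity makes the disagreement of
  \<open>b0\<close> and \<open>b\<close> constant on its cliques, so cliques are counted; otherwise
  vertices are. This is why there are two parallel chains of lemmas. Types are prescribed over
  independent sets only, because one representative per clique determines the rest: by parity
  between large cliques, by reversal in a clique of two. The assumptions collected in the locale
  survive complementing the cross edges. Interpreting the locale in the complement settles the case
  of omitting \<open>Dt\<close> and gives the dual counting statements.\<close>

definition partial_iso :: "'a cgraph \<Rightarrow> 'b cgraph \<Rightarrow> ('a \<times> 'b) set \<Rightarrow> bool" where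
  "partial_iso G H p \<longleftrightarrow> finite p \<and> p \<subseteq> verts G \<times> verts H \<and>
     (\<forall>(x, y) \<in> p. col G x = col H y \<and>
       (\<forall>(x', y') \<in> p. (x = x' \<longleftrightarrow> y = y') \<and> (adj G x x' \<longleftrightarrow> adj H y y')))"

definition embedding :: "('a \<Rightarrow> 'b) \<Rightarrow> 'a cgraph \<Rightarrow> 'b cgraph \<Rightarrow> bool" where
  "embedding f H G \<longleftrightarrow> inj_on f (verts H) \<and>
     (\<forall>x \<in> verts H. f x \<in> verts G \<and> col G (f x) = col H x \<and>
       (\<forall>y \<in> verts H. adj G (f x) (f y) \<longleftrightarrow> adj H x y))"

lemma partial_isoD:
  assumes "partial_iso G H p"
  shows "finite p" "p \<subseteq> verts G \<times> verts H"
    "(x, y) \<in> p \<Longrightarrow> (x', y') \<in> p \<Longrightarrow>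
       col G x = col H y \<and> (x = x' \<longleftrightarrow> y = y') \<and> (adj G x x' \<longleftrightarrow> adj H y y')"
  using assms by (auto simp: partial_iso_def)

lemma induced_simps [simp]:
  "verts (induced G S) = verts G \<inter> S"
  "adj (induced G S) x y \<longleftrightarrow> x \<in> S \<and> y \<in> S \<and> adj G x y"
  "col (induced G S) = col G"
  by (simp_all add: induced_def)

lemma cross_complement_fields [simp]:
  "verts (cross_complement G) = verts G"
  "adj (cross_complement G) x y \<longleftrightarrow> x \<in> verts G \<and> y \<in> verts G \<and>
     (if col G x = col G y then adj G x y else \<not> adj G x y)"
  "col (cross_complement G) = col G"
  by (simp_all add: cross_complement_def)

text \<open>Embeddings compose, so with maps into \<open>G\<close> itself no vertex sets of induced
  subgraphs have to be tracked later.\<close>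

lemma realized_iff_embedding: "realized G H \<longleftrightarrow> (\<exists>f. embedding f H G)"
proof
  assume "realized G H"
  then obtain S f where S: "S \<subseteq> verts G" and f: "is_iso f H (induced G S)"
    by (auto simp: realized_def isomorphic_def)
  then have "bij_betw f (verts H) S"
    by (simp add: is_iso_def Int_absorb1)
  then have "\<And>x. x \<in> verts H \<Longrightarrow> f x \<in> S" and "inj_on f (verts H)"
    by (auto simp: bij_betw_def)
  with S f have "embedding f H G"
    by (auto simp: embedding_def is_iso_def)
  then show "\<exists>f. embedding f H G" by blast
next
  assume "\<exists>f. embedding f H G"
  then obtain f where f: "embedding f H G" by blast
  let ?S = "f ` verts H"
  have S: "?S \<subseteq> verts G" using f by (auto simp: embedding_def)
  then have "is_iso f H (induced G ?S)"
    using f by (auto simp: is_iso_def embedding_def bij_betw_def Int_absorb1)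
  with S show "realized G H" by (auto simp: realized_def isomorphic_def)
qed

lemma embedding_comp:
  "embedding f H K \<Longrightarrow> embedding g K G \<Longrightarrow> embedding (g \<circ> f) H G"
  by (auto simp: embedding_def inj_on_def)

lemma realized_trans: "realized K H \<Longrightarrow> realized G K \<Longrightarrow> realized G H"
  using embedding_comp unfolding realized_iff_embedding by blast

lemma embedding_induced: "embedding id (induced G S) G"
  by (auto simp: embedding_def)

lemma realized_induced: "realized G (induced G S)"
  using embedding_induced realized_iff_embedding by blast

lemma isomorphic_sym: "isomorphic G H \<Longrightarrow> isomorphic H G"
proof -
  assume "isomorphic G H"
  then obtain f where f: "is_iso f G H" by (auto simp: isomorphic_def)
  let ?g = "inv_into (verts G) f"
  have bij: "bij_betw f (verts G) (verts H)" using f by (simp add: is_iso_def)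
  have g: "?g y \<in> verts G" "f (?g y) = y" if "y \<in> verts H" for y
    using that bij bij_betw_inv_into_right bij_betwE bij_betw_inv_into by metis+
  have "is_iso ?g H G"
    unfolding is_iso_def using bij_betw_inv_into [OF bij] f g
    by (simp add: is_iso_def) metis
  then show ?thesis by (auto simp: isomorphic_def)
qed

lemma embedding_cross_complement:
  "embedding f H G \<Longrightarrow> embedding f (cross_complement H) (cross_complement G)"
  by (auto simp: embedding_def)

lemma cross_complement_cross_complement:
  assumes "two_colored_graph G"
  shows "cross_complement (cross_complement G) = G"
proof -
  have "adj (cross_complement (cross_complement G)) = adj G"
    using assms by (auto simp: fun_eq_iff two_colored_graph_def)
  then show ?thesis by (simp add: cross_complement_def)
qed

lemma realized_cross_complement:
  "realized G H \<Longrightarrow> realized (cross_complement G) (cross_complement H)"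
  using embedding_cross_complement unfolding realized_iff_embedding by blast

lemma realized_cross_complement_iff:
  assumes "two_colored_graph G" "two_colored_graph H"
  shows "realized (cross_complement G) H \<longleftrightarrow> realized G (cross_complement H)"
  by (metis assms cross_complement_cross_complement realized_cross_complement)

lemma ultrahomogeneous_partial_iso:
  assumes "ultrahomogeneous G" "partial_iso G G p"
  obtains g where "is_iso g G G" "\<And>x y. (x, y) \<in> p \<Longrightarrow> g x = y"
proof -
  define f where "f x = (THE y. (x, y) \<in> p)" for x
  have p: "finite p" "p \<subseteq> verts G \<times> verts G"
    "\<And>x y x' y'. (x, y) \<in> p \<Longrightarrow> (x', y') \<in> p \<Longrightarrow>
       col G x = col G y \<and> (x = x' \<longleftrightarrow> y = y') \<and> (adj G x x' \<longleftrightarrow> adj G y y')"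
    using partial_isoD [OF assms(2)] by simp_all
  have f: "f x = y" if "(x, y) \<in> p" for x y
    unfolding f_def using that p(3) [OF that] by (intro the_equality) auto
  have sub: "Domain p \<subseteq> verts G" "Range p \<subseteq> verts G" using p(2) by auto
  have "inj_on f (Domain p)" using f p(3) by (fastforce simp: inj_on_def)
  moreover have "f ` Domain p = Range p" using f by force
  ultimately have "is_iso f (induced G (Domain p)) (induced G (Range p))"
    using f p(3) sub
    by (auto simp: is_iso_def bij_betw_def Int_absorb1)
  then obtain g where "is_iso g G G" "\<forall>x \<in> Domain p. g x = f x"
    using assms(1) sub p(1) unfolding ultrahomogeneous_def
    by (metis finite_Domain finite_Range)
  then show ?thesis using that f by blast
qed

text \<open>Copy the domain of \<open>p\<close> together with \<open>x\<close> into \<open>H\<close>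
  by some embedding \<open>f\<close>. The copy need not lie where \<open>p\<close> puts the domain,
  but the two positions differ by a partial isomorphism of \<open>H\<close>. An automorphism
  \<open>g\<close> extending it corrects the copy, and \<open>g (f x)\<close> is the new
  partner.\<close>

lemma partial_iso_extend:
  assumes uh: "ultrahomogeneous H" and p: "partial_iso G H p"
    and age: "\<And>A. finite A \<Longrightarrow> A \<subseteq> verts G \<Longrightarrow> realized H (induced G A)"
    and x: "x \<in> verts G"
  obtains y where "partial_iso G H (insert (x, y) p)"
proof -
  have fin: "finite p" and sub: "p \<subseteq> verts G \<times> verts H"
    and pp: "\<And>x y x' y'. (x, y) \<in> p \<Longrightarrow> (x', y') \<in> p \<Longrightarrow>
       col G x = col H y \<and> (x = x' \<longleftrightarrow> y = y') \<and> (adj G x x' \<longleftrightarrow> adj H y y')"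
    using partial_isoD [OF p] by simp_all
  define A where "A = insert x (Domain p)"
  have A: "finite A" "A \<subseteq> verts G"
    using fin sub x by (auto simp: finite_Domain A_def)
  then obtain f where "embedding f (induced G A) H"
    using age realized_iff_embedding by blast
  then have "inj_on f A" and "\<forall>a \<in> A. f a \<in> verts H \<and> col H (f a) = col G a \<and>
      (\<forall>b \<in> A. adj H (f a) (f b) \<longleftrightarrow> adj G a b)"
    unfolding embedding_def induced_simps Int_absorb1 [OF A(2)] by blast+
  then have f: "f a \<in> verts H" "col H (f a) = col G a" "f a = f b \<longleftrightarrow> a = b"
    "adj H (f a) (f b) \<longleftrightarrow> adj G a b" if "a \<in> A" "b \<in> A" for a b
    using that by (simp_all add: inj_on_eq_iff)
  have "partial_iso H H ((\<lambda>(a, b). (f a, b)) ` p)"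
    unfolding partial_iso_def
  proof (intro conjI)
    show "(\<lambda>(a, b). (f a, b)) ` p \<subseteq> verts H \<times> verts H"
    proof clarify
      fix a b assume ab: "(a, b) \<in> p"
      then have "a \<in> A" by (auto simp: A_def)
      then show "f a \<in> verts H \<and> b \<in> verts H" using ab f(1) sub by auto
    qed
  next
    have "col H (f a) = col H b \<and> (f a = f a' \<longleftrightarrow> b = b') \<and> (adj H (f a) (f a') \<longleftrightarrow> adj H b b')"
      if "(a, b) \<in> p" "(a', b') \<in> p" for a b a' b'
    proof -
      have "a \<in> A" "a' \<in> A" using that by (auto simp: A_def)
      then show ?thesis using pp [OF that] f [of a a'] by simp
    qed
    then show "\<forall>(x, y)\<in>(\<lambda>(a, b). (f a, b)) ` p. col H x = col H y \<and>
      (\<forall>(x', y')\<in>(\<lambda>(a, b). (f a, b)) ` p. (x = x') = (y = y') \<and> adj H x x' = adj H y y')"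
      by fastforce
  qed (use fin in auto)
  then obtain g where g: "is_iso g H H" and "\<And>u v. (u, v) \<in> (\<lambda>(a, b). (f a, b)) ` p \<Longrightarrow> g u = v"
    using ultrahomogeneous_partial_iso [OF uh] by metis
  then have gf: "g (f a) = b" if "(a, b) \<in> p" for a b
    using that by force
  define y where "y = g (f x)"
  have h: "g (f a) \<in> verts H" "col H (g (f a)) = col G a" "g (f a) = g (f b) \<longleftrightarrow> a = b"
    "adj H (g (f a)) (g (f b)) \<longleftrightarrow> adj G a b" if "a \<in> A" "b \<in> A" for a b
    using f [OF that] f(1) [OF that(2,1)] g that
    by (auto simp: is_iso_def bij_betw_def inj_on_def)
  have q: "b = g (f a) \<and> a \<in> A" if "(a, b) \<in> insert (x, y) p" for a b
    using that gf y_def by (auto simp: A_def)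
  have "partial_iso G H (insert (x, y) p)"
    unfolding partial_iso_def
  proof (intro conjI)
    show "insert (x, y) p \<subseteq> verts G \<times> verts H"
    proof clarify
      fix a b assume "(a, b) \<in> insert (x, y) p"
      then have "a \<in> A" "b = g (f a)" using q by simp_all
      then show "a \<in> verts G \<and> b \<in> verts H" using h(1) A(2) by auto
    qed
    show "\<forall>(u, v)\<in>insert (x, y) p. col G u = col H v \<and>
      (\<forall>(u', v')\<in>insert (x, y) p. (u = u') = (v = v') \<and> adj G u u' = adj H v v')"
    proof (intro ballI, clarify, intro conjI ballI, goal_cases)
      case (1 u v)
      then show ?case using q [OF 1] h(2) [of u u] by simp
    next
      case (2 u v w)
      obtain u' v' where w: "w = (u', v')" by force
      then show ?case using q [OF 2(1)] q [of u' v'] 2(2) h(3,4) [of u u'] by simp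
    qed
  qed (use fin in simp)
  then show ?thesis by (rule that)
qed

text \<open>This symmetry is the benefit of encoding partial isomorphisms as finite relations, with
  single-valuedness and injectivity in one equivalence: the "back" step is the "forth" step for the
  converse.\<close>

lemma partial_iso_converse:
  "partial_iso G H p \<Longrightarrow> partial_iso H G (p\<inverse>)"
  unfolding partial_iso_def by (auto simp: finite_converse)

lemma insert_converse: "(insert (x, y) p)\<inverse> = insert (y, x) (p\<inverse>)"
  by auto

text \<open>Uniqueness of Fraisse limits: countable ultrahomogeneous structures with the same finite
  induced substructures are isomorphic.\<close>

lemma back_and_forth:
  assumes cG: "countable (verts G)" and cH: "countable (verts H)"
    and uG: "ultrahomogeneous G" and uH: "ultrahomogeneous H"
    and neG: "verts G \<noteq> {}" and neH: "verts H \<noteq> {}"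
    and GH: "\<And>A. finite A \<Longrightarrow> A \<subseteq> verts G \<Longrightarrow> realized H (induced G A)"
    and HG: "\<And>A. finite A \<Longrightarrow> A \<subseteq> verts H \<Longrightarrow> realized G (induced H A)"
  shows "isomorphic G H"
proof -
  let ?x = "from_nat_into (verts G)" and ?y = "from_nat_into (verts H)"
  have "\<exists>f. \<forall>n. partial_iso G H (f n) \<and>
      (f n \<subseteq> f (Suc n) \<and> ?x n \<in> Domain (f (Suc n)) \<and> ?y n \<in> Range (f (Suc n)))"
  proof (rule dependent_nat_choice)
    show "\<exists>p. partial_iso G H p"
      by (rule exI [of _ "{}"]) (simp add: partial_iso_def)
  next
    \<comment> \<open>Stage \<open>n\<close> first puts the \<open>n\<close>-th vertex of
      \<open>G\<close> into the domain, then the \<open>n\<close>-th vertex of \<open>H\<close> into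
      the range.\<close>
    fix p n assume p: "partial_iso G H p"
    obtain v where v: "partial_iso G H (insert (?x n, v) p)"
      using partial_iso_extend [OF uH p GH] from_nat_into [OF neG] by blast
    obtain u where "partial_iso H G (insert (?y n, u) ((insert (?x n, v) p)\<inverse>))"
      using partial_iso_extend [OF uG partial_iso_converse [OF v] HG] from_nat_into [OF neH] by blast
    then have "partial_iso G H (insert (u, ?y n) (insert (?x n, v) p))"
      using partial_iso_converse by (metis insert_converse converse_converse)
    then show "\<exists>q. partial_iso G H q \<and> p \<subseteq> q \<and> ?x n \<in> Domain q \<and> ?y n \<in> Range q"
      by blast
  qed
  then obtain f where f: "\<And>n. partial_iso G H (f n)" and mono: "\<And>n. f n \<subseteq> f (Suc n)"
    and dom: "\<And>n. ?x n \<in> Domain (f (Suc n))" and ran: "\<And>n. ?y n \<in> Range (f (Suc n))"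
    by blast
  define q where "q = (\<Union>n. f n)"
  have qq: "col G x = col H y \<and> (x = x' \<longleftrightarrow> y = y') \<and> (adj G x x' \<longleftrightarrow> adj H y y')"
    if "(x, y) \<in> q" "(x', y') \<in> q" for x y x' y'
  proof -
    obtain m n where "(x, y) \<in> f m" "(x', y') \<in> f n" using \<open>(x, y) \<in> q\<close> \<open>(x', y') \<in> q\<close> q_def by auto
    then have "(x, y) \<in> f (max m n)" "(x', y') \<in> f (max m n)"
      using lift_Suc_mono_le [of f, OF mono] by (meson max.cobounded1 max.cobounded2 subsetD)+
    then show ?thesis using partial_isoD(3) [OF f] by blast
  qed
  have qsub: "q \<subseteq> verts G \<times> verts H" using partial_isoD(2) [OF f] unfolding q_def by blast
  have "x \<in> Domain q" if "x \<in> verts G" for x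
    using dom [of "to_nat_on (verts G) x"] that cG unfolding q_def by auto
  then have dq: "Domain q = verts G" using qsub by auto
  have "y \<in> Range q" if "y \<in> verts H" for y
    using ran [of "to_nat_on (verts H) y"] that cH unfolding q_def by auto
  then have rq: "Range q = verts H" using qsub by auto
  define g where "g x = (SOME y. (x, y) \<in> q)" for x
  have g: "(x, g x) \<in> q" if "x \<in> verts G" for x
    using that dq unfolding g_def by (metis DomainE someI)
  have "inj_on g (verts G)" using g qq by (metis inj_onI)
  moreover have "g ` verts G = verts H"
  proof
    show "g ` verts G \<subseteq> verts H" using g qsub by auto
    show "verts H \<subseteq> g ` verts G"
    proof
      fix y assume "y \<in> verts H"
      then obtain x where "(x, y) \<in> q" using rq by auto
      moreover then have "x \<in> verts G" using qsub by auto
      ultimately show "y \<in> g ` verts G" using g qq by blast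
    qed
  qed
  ultimately have "is_iso g G H"
    unfolding is_iso_def bij_betw_def using g qq by metis
  then show ?thesis by (auto simp: isomorphic_def)
qed

section \<open>Finite choices\<close>

lemma inj_on_into:
  assumes "finite A" "infinite S \<or> card A \<le> card S"
  obtains h where "inj_on h A" "h ` A \<subseteq> S"
proof (cases "finite S")
  case True
  then show ?thesis using card_le_inj [of A S] assms that by auto
next
  case False
  then obtain B where "B \<subseteq> S" "finite B" "card B = card A"
    using infinite_arbitrarily_large by blast
  then show ?thesis using card_le_inj [of A B] assms(1) that by fastforce
qed

text \<open>The label \<open>\<tau> x\<close> prescribes the target set of \<open>x\<close>. As the
  targets are disjoint, injections chosen separately on the fibres of \<open>\<tau>\<close> glue to
  one injection.\<close>

lemma inj_on_into_disjoint:
  assumes "finite X" and "\<And>t. infinite (R t) \<or> card {x \<in> X. \<tau> x = t} \<le> card (R t)"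
    and "\<And>t t'. t \<noteq> t' \<Longrightarrow> R t \<inter> R t' = {}"
  obtains h where "inj_on h X" "\<And>x. x \<in> X \<Longrightarrow> h x \<in> R (\<tau> x)"
proof -
  have "\<exists>h. inj_on h {x \<in> X. \<tau> x = t} \<and> h ` {x \<in> X. \<tau> x = t} \<subseteq> R t" for t
  proof -
    have "finite {x \<in> X. \<tau> x = t}" using assms(1) by simp
    from inj_on_into [OF this assms(2)] show ?thesis by blast
  qed
  then obtain k where k: "\<And>t. inj_on (k t) {x \<in> X. \<tau> x = t}"
    "\<And>t. k t ` {x \<in> X. \<tau> x = t} \<subseteq> R t" by metis
  define h where "h x = k (\<tau> x) x" for x
  have h: "h x \<in> R (\<tau> x)" if "x \<in> X" for x
    using that k(2) [of "\<tau> x"] by (auto simp: h_def)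
  moreover have "inj_on h X"
  proof (rule inj_onI)
    fix x y assume xy: "x \<in> X" "y \<in> X" "h x = h y"
    then have "\<tau> x = \<tau> y" using h assms(3) by (metis IntI empty_iff)
    then show "x = y" using xy k(1) [of "\<tau> x"] by (auto simp: h_def inj_on_def)
  qed
  ultimately show ?thesis using that by blast
qed

text \<open>Greedy choice: a new element avoids \<open>Z\<close> and the finite conflict sets of the
  earlier ones; symmetry of conflicts makes the order irrelevant. With \<open>C a = {a}\<close> this
  yields injectivity, with \<open>C = Cl\<close> it yields vertices in distinct cliques.\<close>

lemma choose_from_infinite_sets:
  assumes "finite Y" "\<And>y. y \<in> Y \<Longrightarrow> infinite (A y)" "finite Z"
    and "\<And>a. finite (C a)" and "\<And>a b. b \<in> C a \<longleftrightarrow> a \<in> C b"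
  obtains g where "\<And>y. y \<in> Y \<Longrightarrow> g y \<in> A y - Z"
    "\<And>y y'. y \<in> Y \<Longrightarrow> y' \<in> Y \<Longrightarrow> y \<noteq> y' \<Longrightarrow> g y' \<notin> C (g y)"
proof -
  have "\<exists>g. (\<forall>y \<in> Y. g y \<in> A y - Z) \<and> (\<forall>y \<in> Y. \<forall>y' \<in> Y. y \<noteq> y' \<longrightarrow> g y' \<notin> C (g y))"
    using assms(1,2)
  proof (induction Y)
    case empty
    then show ?case by simp
  next
    case (insert u Y)
    then obtain g where g: "\<forall>y \<in> Y. g y \<in> A y - Z"
      "\<forall>y \<in> Y. \<forall>y' \<in> Y. y \<noteq> y' \<longrightarrow> g y' \<notin> C (g y)" by auto
    have "finite (Z \<union> (\<Union>y \<in> Y. C (g y)))" using insert.hyps assms(3,4) by auto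
    then have "infinite (A u - (Z \<union> (\<Union>y \<in> Y. C (g y))))" using insert.prems by auto
    then obtain a where a: "a \<in> A u" "a \<notin> Z" "\<forall>y \<in> Y. a \<notin> C (g y)"
      using infinite_imp_nonempty by blast
    then have "\<forall>y \<in> Y. g y \<notin> C a" using assms(5) by blast
    then show ?case
      using g a insert.hyps by (intro exI [of _ "g(u := a)"]) auto
  qed
  then show ?thesis using that by blast
qed

text \<open>Applied to adjacency inside a colour class, this selects one representative per clique;
  the last conclusion compares every other vertex with a representative.\<close>

lemma maximal_independent_subset:
  assumes "finite A" and "\<And>x. \<not> P x x" and "\<And>x y. P x y \<Longrightarrow> P y x"
  obtains I where "I \<subseteq> A" "\<And>x y. x \<in> I \<Longrightarrow> y \<in> I \<Longrightarrow> \<not> P x y"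
    "\<And>x. x \<in> A \<Longrightarrow> x \<notin> I \<Longrightarrow> \<exists>u \<in> I. P u x"
proof -
  have "\<exists>I \<subseteq> A. (\<forall>x \<in> I. \<forall>y \<in> I. \<not> P x y) \<and> (\<forall>x \<in> A. x \<notin> I \<longrightarrow> (\<exists>u \<in> I. P u x))"
    using assms(1)
  proof (induction A)
    case empty
    then show ?case by simp
  next
    case (insert a A)
    then obtain I where I: "I \<subseteq> A" "\<forall>x \<in> I. \<forall>y \<in> I. \<not> P x y"
      "\<forall>x \<in> A. x \<notin> I \<longrightarrow> (\<exists>u \<in> I. P u x)" by blast
    show ?case
    proof (cases "\<exists>u \<in> I. P u a")
      case True
      then show ?thesis using I by (intro exI [of _ I]) auto
    next
      case False
      then show ?thesis
        using I assms(2,3) by (intro exI [of _ "insert a I"]) auto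
    qed
  qed
  then show ?thesis using that by blast
qed

section \<open>Basic graphs\<close>

text \<open>\<open>separated\<close> is the trace of not being a blow-up: if colour \<open>c\<close>
  has an edge, then some edge of colour \<open>c\<close> is split by a vertex of the other colour.
  All assumptions are stable under complementing the cross edges.\<close>

locale basic_graph =
  fixes G :: "'a cgraph"
  assumes graph: "two_colored_graph G"
    and infinite_verts: "infinite (verts G)"
    and uh: "ultrahomogeneous G"
    and clique: "adj G x y \<Longrightarrow> adj G y z \<Longrightarrow> x \<noteq> z \<Longrightarrow>
      col G x = col G y \<Longrightarrow> col G y = col G z \<Longrightarrow> adj G x z"
    and two_cliques: "\<exists>x \<in> color_class G c. \<exists>y \<in> color_class G c. x \<noteq> y \<and> \<not> adj G x y"
    and separated: "adj G x y \<Longrightarrow> col G x = c \<Longrightarrow> col G y = c \<Longrightarrow>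
      \<exists>x' y' z. adj G x' y' \<and> col G x' = c \<and> col G y' = c \<and> z \<in> verts G \<and> col G z \<noteq> c \<and>
        adj G z x' \<and> \<not> adj G z y'"
begin

abbreviation "V \<equiv> color_class G"
abbreviation "E \<equiv> adj G"

definition same :: "'a \<Rightarrow> 'a \<Rightarrow> bool" where
  "same x y \<longleftrightarrow> x \<in> verts G \<and> y \<in> verts G \<and> col G x = col G y \<and> (x = y \<or> E x y)"

definition nontriv :: "color \<Rightarrow> bool" where
  "nontriv c \<longleftrightarrow> (\<exists>x y. E x y \<and> col G x = c \<and> col G y = c)"

text \<open>Ultrahomogeneity makes all cliques of a colour equally large, so a single triangle says
  that every clique has at least three vertices. Likewise \<open>nontriv\<close> means at least
  two.\<close>

definition big :: "color \<Rightarrow> bool" where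
  "big c \<longleftrightarrow> (\<exists>x y z. E x y \<and> E y z \<and> E x z \<and> col G x = c \<and> col G y = c \<and> col G z = c)"

lemma V_iff: "x \<in> V c \<longleftrightarrow> x \<in> verts G \<and> col G x = c"
  by (simp add: color_class_def)

lemma E_sym: "E x y \<Longrightarrow> E y x" and E_irrefl: "\<not> E x x"
  and E_verts: "E x y \<Longrightarrow> x \<in> verts G" "E x y \<Longrightarrow> y \<in> verts G"
  using graph by (auto simp: two_colored_graph_def)

lemma E_commute: "E x y \<longleftrightarrow> E y x"
  using E_sym by blast

lemma color_other: "c \<noteq> d \<Longrightarrow> col G z \<noteq> c \<longleftrightarrow> col G z = d"
  by (cases c; cases d; cases "col G z") auto

lemma same_sym: "same x y \<Longrightarrow> same y x"
  by (auto simp: same_def E_sym)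

lemma same_trans: "same x y \<Longrightarrow> same y z \<Longrightarrow> same x z"
  using clique by (auto simp: same_def)

lemma same_V: "same x y \<Longrightarrow> x \<in> V c \<longleftrightarrow> y \<in> V c"
  by (auto simp: same_def V_iff)

lemma same_E: "E x y \<Longrightarrow> x \<in> V c \<Longrightarrow> y \<in> V c \<Longrightarrow> same x y"
  by (auto simp: same_def V_iff)

lemma same_refl: "x \<in> V c \<Longrightarrow> same x x"
  by (auto simp: same_def V_iff)

lemma same_imp_E: "same x y \<Longrightarrow> x \<noteq> y \<Longrightarrow> E x y"
  by (auto simp: same_def)

lemma aut_verts: "is_iso g G G \<Longrightarrow> x \<in> verts G \<Longrightarrow> g x \<in> verts G"
  and aut_col: "is_iso g G G \<Longrightarrow> x \<in> verts G \<Longrightarrow> col G (g x) = col G x"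
  and aut_E: "is_iso g G G \<Longrightarrow> x \<in> verts G \<Longrightarrow> y \<in> verts G \<Longrightarrow> E (g x) (g y) \<longleftrightarrow> E x y"
  and aut_eq: "is_iso g G G \<Longrightarrow> x \<in> verts G \<Longrightarrow> y \<in> verts G \<Longrightarrow> g x = g y \<longleftrightarrow> x = y"
  by (auto simp: is_iso_def bij_betw_def inj_on_def)

lemma aut_V: "is_iso g G G \<Longrightarrow> x \<in> V c \<Longrightarrow> g x \<in> V c"
  by (simp add: V_iff aut_verts aut_col)

lemma aut_V_E: "is_iso g G G \<Longrightarrow> x \<in> V c \<Longrightarrow> y \<in> V d \<Longrightarrow> E (g x) (g y) \<longleftrightarrow> E x y"
  by (simp add: V_iff aut_E)

lemma aut_surj:
  assumes "is_iso g G G" "y \<in> V c"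
  obtains x where "x \<in> V c" "g x = y"
proof -
  have "y \<in> g ` verts G" using assms by (auto simp: is_iso_def bij_betw_def V_iff)
  then show ?thesis using that assms aut_col by (auto simp: V_iff)
qed

lemma aut_same: "is_iso g G G \<Longrightarrow> same x y \<Longrightarrow> same (g x) (g y)"
  using aut_E by (auto simp: same_def aut_verts aut_col)

lemma extend:
  assumes "partial_iso G G p"
  obtains g where "is_iso g G G" "\<And>x y. (x, y) \<in> p \<Longrightarrow> g x = y"
  using ultrahomogeneous_partial_iso [OF uh assms] that by blast

lemma move1:
  assumes "x \<in> V c" "x' \<in> V c"
  obtains g where "is_iso g G G" "g x = x'"
proof -
  have "partial_iso G G {(x, x')}"
    using assms by (simp add: partial_iso_def V_iff E_irrefl)
  then show ?thesis using extend that by (metis insertI1)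
qed

lemma move2:
  assumes "x \<in> V c" "x' \<in> V c" "y \<in> V d" "y' \<in> V d" "x = y \<longleftrightarrow> x' = y'" "E x y \<longleftrightarrow> E x' y'"
  obtains g where "is_iso g G G" "g x = x'" "g y = y'"
proof -
  have "E y x \<longleftrightarrow> E y' x'" "y = x \<longleftrightarrow> y' = x'" using assms E_commute by blast+
  then have "partial_iso G G {(x, x'), (y, y')}"
    using assms by (simp add: partial_iso_def V_iff E_irrefl)
  then obtain g where g: "is_iso g G G" "\<And>a b. (a, b) \<in> {(x, x'), (y, y')} \<Longrightarrow> g a = b"
    by (rule extend) blast
  show ?thesis by (rule that [of g]) (use g in blast)+
qed

lemma move3:
  assumes "x \<in> V c" "x' \<in> V c" "y \<in> V d" "y' \<in> V d" "z \<in> V e" "z' \<in> V e"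
    and "x = y \<longleftrightarrow> x' = y'" "x = z \<longleftrightarrow> x' = z'" "y = z \<longleftrightarrow> y' = z'"
    and "E x y \<longleftrightarrow> E x' y'" "E x z \<longleftrightarrow> E x' z'" "E y z \<longleftrightarrow> E y' z'"
  obtains g where "is_iso g G G" "g x = x'" "g y = y'" "g z = z'"
proof -
  have "E y x \<longleftrightarrow> E y' x'" "y = x \<longleftrightarrow> y' = x'" "E z x \<longleftrightarrow> E z' x'" "z = x \<longleftrightarrow> z' = x'"
    "E z y \<longleftrightarrow> E z' y'" "z = y \<longleftrightarrow> z' = y'" using assms E_commute by blast+
  then have "partial_iso G G {(x, x'), (y, y'), (z, z')}"
    using assms by (simp add: partial_iso_def V_iff E_irrefl)
  then obtain g where g: "is_iso g G G" "\<And>a b. (a, b) \<in> {(x, x'), (y, y'), (z, z')} \<Longrightarrow> g a = b"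
    by (rule extend) blast
  show ?thesis by (rule that [of g]) (use g in blast)+
qed

lemma nontriv_nbr:
  assumes "nontriv c" "x \<in> V c"
  obtains y where "y \<in> V c" "E x y"
proof -
  obtain u v where uv: "E u v" "u \<in> V c" "v \<in> V c"
    using assms(1) E_verts by (auto simp: nontriv_def V_iff)
  obtain g where g: "is_iso g G G" "g u = x" using move1 [OF uv(2) assms(2)] .
  then show ?thesis using that [of "g v"] aut_V [OF g(1) uv(3)] aut_V_E [OF g(1) uv(2,3)] uv(1) by simp
qed

lemma big_nbr:
  assumes "big c" "x \<in> V c" "y \<in> V c" "E x y"
  obtains z where "z \<in> V c" "E x z" "E y z"
proof -
  obtain u v w where uv: "E u v" "E u w" "E v w" and V: "u \<in> V c" "v \<in> V c" "w \<in> V c"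
    using assms(1) E_verts by (auto simp: big_def V_iff)
  obtain g where g: "is_iso g G G" "g u = x" "g v = y"
    using move2 [OF V(1) assms(2) V(2) assms(3)] assms(4) uv(1) E_irrefl by metis
  then show ?thesis
    using that [of "g w"] aut_V [OF g(1) V(3)] aut_V_E [OF g(1) V(1,3)] aut_V_E [OF g(1) V(2,3)] uv by simp
qed

lemma big_imp_nontriv: "big c \<Longrightarrow> nontriv c"
  by (auto simp: big_def nontriv_def)

lemma not_big_unique:
  assumes "\<not> big c" "x \<in> V c" "y \<in> V c" "z \<in> V c" "E x y" "E x z"
  shows "y = z"
proof (rule ccontr)
  assume "y \<noteq> z"
  then have "E y z" using clique [of y x z] assms E_sym by (auto simp: V_iff)
  then show False using assms E_sym unfolding big_def V_iff by blast
qed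

lemma other_clique:
  assumes "x \<in> V c"
  obtains y where "y \<in> V c" "\<not> same x y"
proof -
  obtain u v where uv: "u \<in> V c" "v \<in> V c" "u \<noteq> v" "\<not> E u v"
    using two_cliques by blast
  then have "\<not> same u v" by (simp add: same_def)
  then have "\<not> same x u \<or> \<not> same x v" using same_sym same_trans by blast
  then show ?thesis using that uv by blast
qed

lemma not_same: "\<not> same x y \<Longrightarrow> x \<in> V c \<Longrightarrow> y \<in> V c \<Longrightarrow> x \<noteq> y \<and> \<not> E x y"
  by (auto simp: same_def V_iff)

text \<open>One split edge can be moved everywhere. If \<open>z\<close> and \<open>x\<close> are
  adjacent, send \<open>z'\<close>, \<open>x'\<close> to \<open>z\<close>, \<open>x\<close>;
  otherwise send \<open>z'\<close>, \<open>y'\<close> to \<open>z\<close>, \<open>x\<close>. The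
  image of the remaining vertex lies in the clique of \<open>x\<close> and behaves towards
  \<open>z\<close> oppositely to \<open>x\<close>.\<close>

lemma split:
  assumes "c \<noteq> d" "nontriv c" "z \<in> V d" "x \<in> V c"
  obtains y y' where "same x y" "same x y'" "E z y" "\<not> E z y'" "y \<in> V c" "y' \<in> V c" "E y y'"
proof -
  obtain u v where "E u v" "col G u = c" "col G v = c"
    using assms(2) by (auto simp: nontriv_def)
  then obtain x' y' z' where "E x' y'" "col G x' = c" "col G y' = c" "z' \<in> verts G" "col G z' \<noteq> c"
    "E z' x'" "\<not> E z' y'"
    using separated by blast
  then have V: "x' \<in> V c" "y' \<in> V c" "z' \<in> V d" and e: "E x' y'" "E z' x'" "\<not> E z' y'"
    using color_other [OF assms(1)] E_verts by (auto simp: V_iff)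
  have neq: "z' \<noteq> x'" "z' \<noteq> y'" "z \<noteq> x" using V assms by (auto simp: V_iff)
  show ?thesis
  proof (cases "E z x")
    case True
    then obtain g where g: "is_iso g G G" "g z' = z" "g x' = x"
      using move2 [OF V(3) assms(3) V(1) assms(4)] e neq by metis
    then have "\<not> E z (g y')" "E x (g y')" "g y' \<in> V c"
      using aut_V_E [OF g(1) V(3,2)] aut_V_E [OF g(1) V(1,2)] aut_V [OF g(1) V(2)] e by simp_all
    then show ?thesis using that [of x "g y'"] same_E same_refl assms(4) True by blast
  next
    case False
    then obtain g where g: "is_iso g G G" "g z' = z" "g y' = x"
      using move2 [OF V(3) assms(3) V(2) assms(4)] e neq by metis
    then have "E z (g x')" "E (g x') x" "g x' \<in> V c"
      using aut_V_E [OF g(1) V(3,1)] aut_V_E [OF g(1) V(1,2)] aut_V [OF g(1) V(1)] e by simp_all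
    then show ?thesis using that [of "g x'" x] same_E same_refl assms(4) False E_sym by blast
  qed
qed

definition twins :: "color \<Rightarrow> 'a \<Rightarrow> 'a \<Rightarrow> bool" where
  "twins c b b' \<longleftrightarrow> (\<forall>x \<in> V c. E b x \<longleftrightarrow> E b' x)"

lemma aut_twins:
  assumes "is_iso g G G" "b \<in> V d" "b' \<in> V d" "twins c b b'"
  shows "twins c (g b) (g b')"
  unfolding twins_def
proof
  fix x assume "x \<in> V c"
  then obtain u where "u \<in> V c" "g u = x" using aut_surj assms(1) by metis
  then show "E (g b) x \<longleftrightarrow> E (g b') x"
    using aut_V_E [OF assms(1)] assms(2-4) by (auto simp: twins_def)
qed

text \<open>Adjacent twins could be moved onto an edge that some vertex of colour \<open>c\<close>
  splits.\<close>

lemma no_adjacent_twins: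
  assumes cd: "c \<noteq> d" and b: "b \<in> V d" "b' \<in> V d" "E b b'"
  shows "\<not> twins c b b'"
proof
  assume tw: "twins c b b'"
  obtain x where x: "x \<in> V c" using two_cliques by blast
  have "nontriv d" using b by (auto simp: nontriv_def V_iff)
  then obtain y y' where y: "E x y" "\<not> E x y'" "y \<in> V d" "y' \<in> V d" "E y y'"
    using split [OF cd [symmetric]] x b(1) by metis
  obtain g where "is_iso g G G" "g b = y" "g b' = y'"
    using move2 [OF b(1) y(3) b(2) y(4)] b(3) y(5) E_irrefl by metis
  then have "twins c y y'" using aut_twins b tw by blast
  then show False using x y E_sym unfolding twins_def by blast
qed

text \<open>If \<open>V c\<close> were finite, \<open>V d\<close> would be infinite with only
  finitely many neighbourhoods in \<open>V c\<close>, hence would contain distinct twins. These are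
  nonadjacent, and moving them makes all nonadjacent pairs of colour \<open>d\<close> twins.\<close>

lemma infinite_V:
  assumes cd: "c \<noteq> d" and nt: "nontriv c \<or> nontriv d"
  shows "infinite (V c)"
proof
  assume fin: "finite (V c)"
  have "verts G = V c \<union> V d" using color_other [OF cd] by (fastforce simp: V_iff)
  then have "infinite (V d)" using fin infinite_verts by auto
  moreover have "(\<lambda>b. {x \<in> V c. E b x}) ` V d \<subseteq> Pow (V c)" by auto
  then have "finite ((\<lambda>b. {x \<in> V c. E b x}) ` V d)" using fin by (simp add: finite_subset)
  ultimately have "\<not> inj_on (\<lambda>b. {x \<in> V c. E b x}) (V d)" using finite_imageD by blast
  then obtain b b' where b: "b \<in> V d" "b' \<in> V d" "b \<noteq> b'" "twins c b b'"
    unfolding inj_on_def twins_def by blast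
  then have nb: "\<not> E b b'" using no_adjacent_twins [OF cd] by blast
  have tw: "twins c y y'" if y: "y \<in> V d" "y' \<in> V d" "y \<noteq> y'" "\<not> E y y'" for y y'
  proof -
    obtain g where "is_iso g G G" "g b = y" "g b' = y'"
      using move2 [OF b(1) y(1) b(2) y(2)] b(3) nb y by blast
    then show ?thesis using aut_twins b by blast
  qed
  show False
  proof (cases "nontriv d")
    case True
    obtain y where y: "y \<in> V d" "E b y" using nontriv_nbr [OF True b(1)] .
    \<comment> \<open>From another clique, \<open>z\<close> is nonadjacent to both \<open>b\<close>
      and \<open>y\<close>, hence a twin of both, which makes the adjacent \<open>b\<close> and
      \<open>y\<close> twins.\<close>
    obtain z where z: "z \<in> V d" "\<not> same b z" using other_clique [OF b(1)] .
    then have "\<not> same y z" using y b(1) same_E same_trans by blast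
    then have "twins c b z" "twins c y z" using tw not_same b(1) y z by blast+
    then have "twins c b y" by (simp add: twins_def)
    then show False using no_adjacent_twins [OF cd b(1) y] by blast
  next
    case False
    have all: "twins c y y'" if y: "y \<in> V d" "y' \<in> V d" for y y'
    proof (cases "y = y'")
      case ne: False
      have "\<not> E y y'" using False y unfolding nontriv_def V_iff by blast
      then show ?thesis using tw [OF y ne] by blast
    qed (simp add: twins_def)
    \<comment> \<open>Now all of \<open>V d\<close> are twins of each other, while colour
      \<open>c\<close> must have edges. So \<open>split\<close> gives \<open>b\<close> a neighbour
      \<open>y\<close> and a nonneighbour \<open>y'\<close>; moving \<open>y\<close> to
      \<open>y'\<close> produces a vertex of colour \<open>d\<close> that is not a twin of
      \<open>b\<close>.\<close>
    obtain r where "r \<in> V c" using two_cliques by blast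
    then obtain y y' where y: "E b y" "\<not> E b y'" "y \<in> V c" "y' \<in> V c"
      using split [OF cd _ b(1)] nt False by metis
    obtain g where g: "is_iso g G G" "g y = y'" using move1 [OF y(3,4)] .
    then have "E (g b) y'" using aut_V_E [OF g(1) b(1) y(3)] y(1) by simp
    then show False using all [of b "g b"] b(1) aut_V [OF g(1) b(1)] y by (auto simp: twins_def)
  qed
qed

end

text \<open>Isomorphisms preserve colours, so \<open>G\<close> and its cross complement have the
  same partial isomorphisms and automorphisms. Lemmas of the locale thereby also yield their duals,
  with neighbours and nonneighbours across the colours exchanged.\<close>

lemma basic_graph_cross_complement:
  assumes "basic_graph G"
  shows "basic_graph (cross_complement G)"
proof -
  interpret basic_graph G by fact
  let ?K = "cross_complement G"
  have iso: "is_iso f ?K ?K" if "is_iso f G G" for f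
    using that aut_verts [OF that] by (auto simp: is_iso_def)
  have GK: "cross_complement ?K = G" by (rule cross_complement_cross_complement [OF graph])
  show ?thesis
  proof
    show "two_colored_graph ?K" by (rule two_colored_graph_cross_complement [OF graph])
    show "infinite (verts ?K)" using infinite_verts by simp
    show "ultrahomogeneous ?K"
      unfolding ultrahomogeneous_def
    proof (intro allI impI, elim conjE)
      fix A B f assume A: "A \<subseteq> verts ?K" "B \<subseteq> verts ?K" "finite A" "finite B"
        and f: "is_iso f (induced ?K A) (induced ?K B)"
      have fA: "f x \<in> B" "col G (f x) = col G x" if "x \<in> A" for x
        using f that A by (auto simp: is_iso_def bij_betw_def)
      have "E (f x) (f y) \<longleftrightarrow> E x y" if "x \<in> A" "y \<in> A" for x y
      proof -
        have "adj ?K (f x) (f y) \<longleftrightarrow> adj ?K x y"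
          using f that A(1) fA by (simp add: is_iso_def subset_iff del: cross_complement_fields(2))
        then show ?thesis using that A fA by (auto split: if_splits)
      qed
      then have "is_iso f (induced G A) (induced G B)"
        using f A fA by (auto simp: is_iso_def)
      then obtain g where "is_iso g G G" "\<forall>x \<in> A. g x = f x"
        using uh A unfolding ultrahomogeneous_def cross_complement_fields by blast
      then show "\<exists>g. is_iso g ?K ?K \<and> (\<forall>x \<in> A. g x = f x)" using iso by blast
    qed
    show "adj ?K x z" if "adj ?K x y" "adj ?K y z" "x \<noteq> z" "col ?K x = col ?K y" "col ?K y = col ?K z"
      for x y z using that clique by auto
    show "\<exists>x \<in> color_class ?K c. \<exists>y \<in> color_class ?K c. x \<noteq> y \<and> \<not> adj ?K x y" for c
      using two_cliques [of c] by (auto simp: color_class_def)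
    show "\<exists>x' y' z. adj ?K x' y' \<and> col ?K x' = c \<and> col ?K y' = c \<and> z \<in> verts ?K \<and> col ?K z \<noteq> c \<and>
        adj ?K z x' \<and> \<not> adj ?K z y'" if xy: "adj ?K x y" "col ?K x = c" "col ?K y = c" for x y c
    proof -
      have "E x y" using xy by auto
      then obtain x' y' z where e: "E x' y'" "col G x' = c" "col G y' = c" "z \<in> verts G" "col G z \<noteq> c"
        "E z x'" "\<not> E z y'" using separated [of x y c] xy(2,3) unfolding cross_complement_fields(3) by blast
      \<comment> \<open>A vertex that splits an edge still splits it in the complement, with the two
        ends exchanged.\<close>
      have "adj ?K y' x'" "adj ?K z y'" "\<not> adj ?K z x'"
        using e E_sym [OF e(1)] E_verts [OF e(1)] by simp_all
      then show ?thesis using e by (intro exI [of _ y'] exI [of _ x'] exI [of _ z]) simp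
    qed
  qed
qed

context basic_graph
begin

section \<open>Parity between cliques\<close>

text \<open>With \<open>c\<close> red and \<open>d\<close> blue this is the omission of
  \<open>D\<close>: three cross edges of a two-by-two pattern force the fourth.\<close>

definition no_D :: "color \<Rightarrow> color \<Rightarrow> bool" where
  "no_D c d \<longleftrightarrow> (\<forall>x \<in> V c. \<forall>x' \<in> V c. \<forall>y \<in> V d. \<forall>y' \<in> V d.
     E x x' \<longrightarrow> E y y' \<longrightarrow> E x y \<longrightarrow> E x y' \<longrightarrow> E x' y \<longrightarrow> E x' y')"

text \<open>An iterated equivalence of four propositions holds iff an even number of them is true.
  So this counts cross edges modulo two.\<close>

definition parity :: "color \<Rightarrow> color \<Rightarrow> bool" where
  "parity c d \<longleftrightarrow> (\<forall>x \<in> V c. \<forall>x' \<in> V c. \<forall>y \<in> V d. \<forall>y' \<in> V d.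
     E x x' \<longrightarrow> E y y' \<longrightarrow> ((E x y \<longleftrightarrow> E x' y) \<longleftrightarrow> (E x y' \<longleftrightarrow> E x' y')))"

lemma no_D_D: "no_D c d \<Longrightarrow> x \<in> V c \<Longrightarrow> x' \<in> V c \<Longrightarrow> y \<in> V d \<Longrightarrow> y' \<in> V d \<Longrightarrow>
    E x x' \<Longrightarrow> E y y' \<Longrightarrow> E x y \<Longrightarrow> E x y' \<Longrightarrow> E x' y \<Longrightarrow> E x' y'"
  unfolding no_D_def by blast

lemma parity_sym: "parity c d \<Longrightarrow> parity d c"
  unfolding parity_def
proof (intro ballI impI, goal_cases)
  case (1 y y' x x')
  then have "(E x y \<longleftrightarrow> E x' y) \<longleftrightarrow> (E x y' \<longleftrightarrow> E x' y')" by blast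
  then show ?case
    using E_commute [of x y] E_commute [of x y'] E_commute [of x' y] E_commute [of x' y'] by blast
qed

text \<open>Suppose \<open>x\<close> sees both \<open>y\<close> and \<open>y'\<close>, and place the
  one-edge pattern on \<open>y y'\<close> with upper vertices \<open>u1\<close>, \<open>u2\<close>.
  The clique of \<open>x\<close> contains a vertex \<open>x0\<close> that sees neither
  \<open>y\<close> nor \<open>y'\<close>, just like \<open>u1\<close>. Moving \<open>x0\<close> to
  \<open>u1\<close> brings a common neighbour \<open>w\<close> of \<open>y\<close>,
  \<open>y'\<close> into the clique of \<open>u1\<close> and \<open>u2\<close>, and
  \<open>w\<close>, \<open>u2\<close> then show exactly three cross edges.\<close>

lemma single_edge_imp_no_common_neighbour:
  assumes cd: "c \<noteq> d" and nt: "nontriv c" and D: "no_D c d"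
    and V: "x1 \<in> V c" "x2 \<in> V c" "y1 \<in> V d" "y2 \<in> V d"
    and e: "E x1 x2" "E y1 y2" "\<not> E x1 y1" "\<not> E x1 y2" "\<not> E x2 y1" "E x2 y2"
    and x: "x \<in> V c" and y: "y \<in> V d" "y' \<in> V d" "E y y'" "E x y"
  shows "\<not> E x y'"
proof
  assume xy': "E x y'"
  obtain g where g: "is_iso g G G" "g y1 = y" "g y2 = y'"
    using move2 [OF V(3) y(1) V(4) y(2)] y(3) e(2) E_irrefl by metis
  define u1 u2 where "u1 = g x1" and "u2 = g x2"
  have u: "u1 \<in> V c" "u2 \<in> V c" "E u1 u2" "\<not> E u1 y" "\<not> E u1 y'" "\<not> E u2 y" "E u2 y'"
    using aut_V [OF g(1)] aut_V_E [OF g(1) V(1,2)] aut_V_E [OF g(1) V(1,3)] aut_V_E [OF g(1) V(1,4)]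
      aut_V_E [OF g(1) V(2,3)] aut_V_E [OF g(1) V(2,4)] V e g(2,3)
    by (auto simp: u1_def u2_def)
  obtain x0 where x0: "same x x0" "\<not> E y x0" "x0 \<in> V c"
    using split [OF cd nt y(1) x] .
  then have xx0: "E x x0" "\<not> E x0 y" using same_imp_E y(4) E_sym by blast+
  then have x0': "\<not> E x0 y'"
    using no_D_D [OF D x x0(3) y(2,1)] xy' y E_sym by blast
  have ne: "y \<noteq> x0" "y' \<noteq> x0" "y \<noteq> u1" "y' \<noteq> u1" using cd y x0 u by (auto simp: V_iff)
  obtain h where h: "is_iso h G G" "h y = y" "h y' = y'" "h x0 = u1"
    using move3 [OF y(1,1) y(2,2) x0(3) u(1)] ne xx0 x0' u E_commute by metis
  define w where "w = h x"
  have w: "w \<in> V c" "same u1 w" "E w y" "E w y'"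
    using aut_V [OF h(1) x] aut_same [OF h(1) x0(1)] aut_V_E [OF h(1) x y(1)]
      aut_V_E [OF h(1) x y(2)] h y xy' same_sym by (auto simp: w_def)
  then have "same w u2" "w \<noteq> u2" using u same_E same_sym same_trans by blast+
  then have "E w u2" by (rule same_imp_E)
  then show False using no_D_D [OF D w(1) u(2) y(2,1)] w u y(3) E_sym by blast
qed

text \<open>By the preceding lemma and \<open>split\<close>, a one-edge pattern would make every
  vertex of colour \<open>c\<close> see exactly one vertex in each clique of colour
  \<open>d\<close>. In the clique of \<open>y2\<close>, the vertices \<open>x2\<close> and
  \<open>r''\<close> see different vertices; the contradiction is that automorphisms carry a common
  neighbour of \<open>x2\<close> and \<open>r''\<close> into this very clique.\<close>

lemma no_D_imp_no_single_edge:
  assumes cd: "c \<noteq> d" and nt: "nontriv c" "nontriv d" and D: "no_D c d"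
    and V: "x1 \<in> V c" "x2 \<in> V c" "y1 \<in> V d" "y2 \<in> V d"
    and e: "E x1 x2" "E y1 y2" "\<not> E x1 y1" "\<not> E x1 y2" "\<not> E x2 y1"
  shows "\<not> E x2 y2"
proof
  assume e2: "E x2 y2"
  have nd: False if "x \<in> V c" "y \<in> V d" "y' \<in> V d" "E y y'" "E x y" "E x y'" for x y y'
    using single_edge_imp_no_common_neighbour [OF cd nt(1) D V e e2] that by blast
  \<comment> \<open>\<open>x1\<close> sees some vertex of the clique of \<open>y1\<close> and
    \<open>y2\<close>, but neither of these two.\<close>
  have "big d"
  proof -
    obtain y3 where "same y1 y3" "E x1 y3" "y3 \<in> V d"
      using split [OF cd [symmetric] nt(2) V(1,3)] .
    moreover then have "y3 \<noteq> y1" "y3 \<noteq> y2" using e by auto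
    moreover then have "E y1 y3" "E y2 y3"
      using \<open>same y1 y3\<close> e(2) V same_E same_imp_E same_sym same_trans by blast+
    ultimately show ?thesis using e(2) V unfolding big_def V_iff by blast
  qed
  obtain r where r: "r \<in> V c" "\<not> same x2 r" using other_clique [OF V(2)] .
  obtain r' r'' where r': "same r r'" "E y2 r'" "r' \<in> V c"
    and r'': "same r r''" "\<not> E y2 r''" "r'' \<in> V c"
    using split [OF cd nt(1) V(4) r(1)] by metis
  have n: "\<not> same x2 r'" "\<not> same x2 r''" using r r' r'' same_sym same_trans by blast+
  obtain b where b: "same y2 b" "E r'' b" "b \<in> V d"
    using split [OF cd [symmetric] nt(2) r''(3) V(4)] by metis
  then have "E y2 b" using r'' E_sym same_imp_E by blast
  then obtain z where z: "z \<in> V d" "E y2 z" "E b z"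
    using big_nbr [OF \<open>big d\<close> V(4) b(3)] by blast
  have nz: "\<not> E x2 z" "\<not> E r' z" "\<not> E r'' z"
    using nd [OF V(2,4) z(1)] nd [OF r'(3) V(4) z(1)] nd [OF r''(3) b(3) z(1)] z e2 r' b E_sym by blast+
  \<comment> \<open>Both pairs are nonadjacent and of one colour. Since \<open>x2\<close> and
    \<open>r'\<close> share the neighbour \<open>y2\<close>, the vertices \<open>x2\<close> and
    \<open>r''\<close> share the neighbour \<open>g y2\<close>, whose clique contains
    \<open>g z\<close>, seen by neither.\<close>
  obtain g where g: "is_iso g G G" "g x2 = x2" "g r' = r''"
    using move2 [OF V(2,2) r'(3) r''(3)] n not_same V r' r'' by metis
  have gz: "g z \<in> V d" "\<not> E x2 (g z)" "\<not> E r'' (g z)"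
    using aut_V [OF g(1) z(1)] aut_V_E [OF g(1) V(2) z(1)] aut_V_E [OF g(1) r'(3) z(1)] g nz by auto
  have gy: "g y2 \<in> V d" "E x2 (g y2)" "E r'' (g y2)" "same (g y2) (g z)"
    using aut_V [OF g(1) V(4)] aut_V_E [OF g(1) V(2,4)] aut_V_E [OF g(1) r'(3) V(4)] g e2 r' E_sym
      aut_same [OF g(1) same_E [OF z(2) V(4) z(1)]] by auto
  have ne: "x2 \<noteq> z" "r'' \<noteq> z" "x2 \<noteq> g z" "r'' \<noteq> g z"
    using cd V z r'' gz by (auto simp: V_iff)
  \<comment> \<open>\<open>g z\<close> and \<open>z\<close> have the same type over
    \<open>x2\<close> and \<open>r''\<close>, so \<open>h\<close> carries the clique with the common
    neighbour onto the clique of \<open>y2\<close>.\<close>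
  obtain h where h: "is_iso h G G" "h x2 = x2" "h r'' = r''" "h (g z) = z"
    using move3 [OF V(2,2) r''(3,3) gz(1) z(1)] ne gz nz by metis
  define w where "w = h (g y2)"
  have w: "w \<in> V d" "E x2 w" "E r'' w" "same w z"
    using aut_V [OF h(1) gy(1)] aut_V_E [OF h(1) V(2) gy(1)] aut_V_E [OF h(1) r''(3) gy(1)]
      aut_same [OF h(1) gy(4)] gy h by (auto simp: w_def)
  then have "same y2 w" using z V same_E same_sym same_trans by blast
  moreover have "y2 \<noteq> w" using w r'' E_sym by blast
  ultimately have "E y2 w" by (rule same_imp_E)
  then show False using nd [OF V(2,4) w(1)] e2 w by blast
qed

lemma no_D_imp_parity:
  assumes "c \<noteq> d" "nontriv c" "nontriv d" "no_D c d"
  shows "parity c d"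
  unfolding parity_def
proof (intro ballI impI)
  fix x x' y y' assume V: "x \<in> V c" "x' \<in> V c" "y \<in> V d" "y' \<in> V d" and e: "E x x'" "E y y'"
  note e' = E_sym [OF e(1)] E_sym [OF e(2)]
  show "(E x y \<longleftrightarrow> E x' y) \<longleftrightarrow> (E x y' \<longleftrightarrow> E x' y')"
    using no_D_D [OF assms(4) V e] no_D_D [OF assms(4) V(1,2,4,3) e(1) e'(2)]
      no_D_D [OF assms(4) V(2,1,3,4) e'(1) e(2)] no_D_D [OF assms(4) V(2,1,4,3) e']
      no_D_imp_no_single_edge [OF assms V e]
      no_D_imp_no_single_edge [OF assms V(1,2,4,3) e(1) e'(2)]
      no_D_imp_no_single_edge [OF assms V(2,1,3,4) e'(1) e(2)]
      no_D_imp_no_single_edge [OF assms V(2,1,4,3) e']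
    by blast
qed

section \<open>Moving finite sets\<close>

text \<open>Apply the automorphism to a further neighbour of \<open>b\<close>: the result is a
  neighbour of \<open>b'\<close> whose adjacencies to \<open>X\<close> can be read off on the image
  of \<open>X\<close> under \<open>k\<close>.\<close>

lemma transport:
  assumes cd: "c \<noteq> d" and X: "finite X" "X \<subseteq> V c" and k: "inj_on k X" "k ` X \<subseteq> V c"
    and kE: "\<And>x x'. x \<in> X \<Longrightarrow> x' \<in> X \<Longrightarrow> E (k x) (k x') \<longleftrightarrow> E x x'"
    and b: "b \<in> V d" "b' \<in> V d" "\<And>x. x \<in> X \<Longrightarrow> E b (k x) \<longleftrightarrow> E b' x"
  obtains g where "is_iso g G G" "g b = b'" "\<And>x. x \<in> X \<Longrightarrow> g (k x) = x"
proof -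
  let ?p = "insert (b, b') ((\<lambda>x. (k x, x)) ` X)"
  have V: "x \<in> verts G" "k x \<in> verts G" "col G (k x) = col G x" if "x \<in> X" for x
    using that X k by (auto simp: V_iff subset_iff)
  have ne: "b \<noteq> k x" "k x \<noteq> b" "b' \<noteq> x" "x \<noteq> b'" if "x \<in> X" for x
    using that cd b X k by (auto simp: V_iff)
  have e: "E (k x) b \<longleftrightarrow> E x b'" if "x \<in> X" for x using b(3) [OF that] E_commute by blast
  have b': "b \<in> verts G" "b' \<in> verts G" "col G b = col G b'" using b by (simp_all add: V_iff)
  have "partial_iso G G ?p"
    unfolding partial_iso_def using X(1)
    by (simp add: V b' b(3) e kE ne E_irrefl inj_on_eq_iff [OF k(1)] image_subset_iff)
  then obtain g where g: "is_iso g G G" "\<And>x y. (x, y) \<in> ?p \<Longrightarrow> g x = y"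
    by (rule extend) blast
  show ?thesis by (rule that [of g]) (use g in blast)+
qed

lemma transport0:
  assumes X: "finite X" "X \<subseteq> V c" and k: "inj_on k X" "k ` X \<subseteq> V c"
    and kE: "\<And>x x'. x \<in> X \<Longrightarrow> x' \<in> X \<Longrightarrow> E (k x) (k x') \<longleftrightarrow> E x x'"
  obtains g where "is_iso g G G" "\<And>x. x \<in> X \<Longrightarrow> g (k x) = x"
proof -
  let ?p = "(\<lambda>x. (k x, x)) ` X"
  have V: "x \<in> verts G" "k x \<in> verts G" "col G (k x) = col G x" if "x \<in> X" for x
    using that X k by (auto simp: V_iff subset_iff)
  have "partial_iso G G ?p"
    unfolding partial_iso_def using X k kE V inj_on_eq_iff [OF k(1)] by auto
  then obtain g where g: "is_iso g G G" "\<And>x y. (x, y) \<in> ?p \<Longrightarrow> g x = y"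
    by (rule extend) blast
  show ?thesis by (rule that [of g]) (use g in blast)+
qed

definition Cl :: "'a \<Rightarrow> 'a set" where "Cl x = {y. same x y}"

lemma Cl_eq_iff: "x \<in> V c \<Longrightarrow> Cl x = Cl y \<longleftrightarrow> same x y"
  unfolding Cl_def using same_sym same_trans same_refl by blast

definition sep :: "color \<Rightarrow> 'a \<Rightarrow> 'a \<Rightarrow> 'a set" where
  "sep c b b' = {x \<in> V c. E b x \<noteq> E b' x}"

definition agr :: "color \<Rightarrow> 'a \<Rightarrow> 'a \<Rightarrow> 'a set" where
  "agr c b b' = {x \<in> V c. E b x = E b' x}"

text \<open>The Boolean predicate \<open>P\<close> is left open to cover \<open>sep\<close>,
  \<open>agr\<close> and the cells \<open>ntype\<close> introduced later.\<close>

lemma aut_Collect: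
  assumes g: "is_iso g G G" and b: "b \<in> V d" "b' \<in> V d"
  shows "{x \<in> V c. P (E (g b) x) (E (g b') x)} = g ` {x \<in> V c. P (E b x) (E b' x)}"
proof (intro subset_antisym subsetI)
  fix x assume x: "x \<in> {x \<in> V c. P (E (g b) x) (E (g b') x)}"
  then obtain u where "u \<in> V c" "g u = x" using aut_surj [OF g] by blast
  then show "x \<in> g ` {x \<in> V c. P (E b x) (E b' x)}"
    using x aut_V_E [OF g b(1)] aut_V_E [OF g b(2)] by auto
qed (use aut_V [OF g] aut_V_E [OF g b(1)] aut_V_E [OF g b(2)] in auto)

lemma aut_sep: "is_iso g G G \<Longrightarrow> b \<in> V d \<Longrightarrow> b' \<in> V d \<Longrightarrow> sep c (g b) (g b') = g ` sep c b b'"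
  unfolding sep_def by (rule aut_Collect)

lemma aut_agr: "is_iso g G G \<Longrightarrow> b \<in> V d \<Longrightarrow> b' \<in> V d \<Longrightarrow> agr c (g b) (g b') = g ` agr c b b'"
  unfolding agr_def by (rule aut_Collect)

lemma aut_Cl: "is_iso g G G \<Longrightarrow> x \<in> V c \<Longrightarrow> y \<in> V c \<Longrightarrow> Cl x = Cl y \<Longrightarrow> Cl (g x) = Cl (g y)"
  by (meson Cl_eq_iff aut_V aut_same)

lemma finite_Cl_aut:
  assumes "is_iso g G G" "A \<subseteq> V c" "finite (Cl ` A)"
  shows "finite (Cl ` g ` A)"
proof -
  obtain U where U: "U \<subseteq> A" "inj_on Cl U" "Cl ` A = Cl ` U"
    using subset_image_inj [of "Cl ` A" Cl A] by auto
  then have "finite U" using assms(3) finite_imageD by metis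
  moreover have "Cl ` g ` A \<subseteq> Cl ` g ` U"
  proof clarify
    fix x assume x: "x \<in> A"
    then obtain u where "u \<in> U" "Cl x = Cl u" using U(3) by (metis imageE imageI)
    then show "Cl (g x) \<in> Cl ` g ` U" using aut_Cl [OF assms(1)] x U(1) assms(2) by blast
  qed
  ultimately show ?thesis by (meson finite_imageI finite_subset)
qed

section \<open>Large cliques against nontrivial cliques\<close>

text \<open>Disagreement of \<open>b\<close> and \<open>b'\<close> is constant on cliques; hence
  whole cliques can be counted instead of vertices.\<close>

lemma parityD:
  assumes "parity c d" "b \<in> V d" "b' \<in> V d" "E b b'" "same x x'" "x \<in> V c"
  shows "x \<in> sep c b b' \<longleftrightarrow> x' \<in> sep c b b'"
proof (cases "x = x'")
  case False
  then have "E x x'" using assms(5) same_imp_E by blast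
  moreover have x': "x' \<in> V c" using assms(5,6) same_V by blast
  ultimately have "(E x b \<longleftrightarrow> E x' b) \<longleftrightarrow> (E x b' \<longleftrightarrow> E x' b')"
    using assms unfolding parity_def by blast
  then show ?thesis
    using x' assms(6) E_commute [of x b] E_commute [of x b'] E_commute [of x' b] E_commute [of x' b']
    unfolding sep_def by blast
qed simp

lemma sep_Cl:
  assumes "parity c d" "b \<in> V d" "b' \<in> V d" "E b b'"
  shows "Cl ` sep c b b' \<inter> Cl ` agr c b b' = {}"
proof -
  have False if "x \<in> sep c b b'" "y \<in> agr c b b'" "Cl x = Cl y" for x y
  proof -
    have "x \<in> V c" using that by (simp add: sep_def)
    then have "y \<in> sep c b b'" using that parityD [OF assms, of x y] Cl_eq_iff by blast
    then show False using that by (simp add: sep_def agr_def)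
  qed
  then show ?thesis by blast
qed

text \<open>Give each element of \<open>T\<close> its own clique separating \<open>b0\<close> and
  \<open>b\<close>, and each other element of \<open>X\<close> its own agreeing clique. Inside an
  assigned clique \<open>split\<close> offers a neighbour and a nonneighbour of \<open>b0\<close>,
  so \<open>k x\<close> can relate to \<open>b0\<close> as \<open>x\<close> does to
  \<open>b0'\<close>, and parity preserves the (dis)agreement. Moving \<open>k x\<close> to
  \<open>x\<close> and \<open>b0\<close> to \<open>b0'\<close> turns \<open>b\<close> into the
  required vertex.\<close>

lemma transport_parity:
  assumes cd: "c \<noteq> d" and nt: "nontriv c" and par: "parity c d"
    and b: "b0 \<in> V d" "b \<in> V d" "E b0 b" "b0' \<in> V d"
    and X: "finite X" "X \<subseteq> V c" "\<And>x y. x \<in> X \<Longrightarrow> y \<in> X \<Longrightarrow> \<not> E x y" and T: "T \<subseteq> X"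
    and cs: "infinite (Cl ` sep c b0 b) \<or> card T \<le> card (Cl ` sep c b0 b)"
    and ca: "infinite (Cl ` agr c b0 b) \<or> card (X - T) \<le> card (Cl ` agr c b0 b)"
  obtains b' where "b' \<in> V d" "E b0' b'" "\<And>x. x \<in> X \<Longrightarrow> (E b' x \<noteq> E b0' x) \<longleftrightarrow> x \<in> T"
proof -
  define R where "R t = (if t then Cl ` sep c b0 b else Cl ` agr c b0 b)" for t
  have "{x \<in> X. (x \<in> T) = True} = T" "{x \<in> X. (x \<in> T) = False} = X - T" using T by auto
  then have "infinite (R t) \<or> card {x \<in> X. (x \<in> T) = t} \<le> card (R t)" for t
    using cs ca by (cases t) (simp_all add: R_def)
  moreover have "R t \<inter> R t' = {}" if "t \<noteq> t'" for t t'
    using that sep_Cl [OF par b(1-3)] by (cases t; cases t') (auto simp: R_def)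
  ultimately obtain h where h: "inj_on h X" "\<And>x. x \<in> X \<Longrightarrow> h x \<in> R (x \<in> T)"
    using inj_on_into_disjoint [OF X(1), of R "\<lambda>x. x \<in> T"] by blast
  have "\<exists>y. y \<in> V c \<and> Cl y = h x \<and> (E b0 y \<longleftrightarrow> E b0' x) \<and> (E b y \<noteq> E b0 y \<longleftrightarrow> x \<in> T)"
    if x: "x \<in> X" for x
  proof -
    obtain u where u: "u \<in> V c" "h x = Cl u" "u \<in> sep c b0 b \<longleftrightarrow> x \<in> T"
      using h(2) [OF x] by (cases "x \<in> T") (auto simp: R_def sep_def agr_def)
    obtain y y' where y: "same u y" "same u y'" "E b0 y" "\<not> E b0 y'" "y \<in> V c" "y' \<in> V c"
      using split [OF cd nt b(1) u(1)] by metis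
    define z where "z = (if E b0' x then y else y')"
    have z: "same u z" "E b0 z \<longleftrightarrow> E b0' x" "z \<in> V c" using y by (auto simp: z_def)
    moreover have "E b z \<noteq> E b0 z \<longleftrightarrow> x \<in> T"
      using parityD [OF par b(1-3) z(1) u(1)] u(3) z(3) by (auto simp: sep_def)
    moreover have "Cl z = h x" using u z(1) Cl_eq_iff by metis
    ultimately show ?thesis by blast
  qed
  then obtain k where k: "\<And>x. x \<in> X \<Longrightarrow> k x \<in> V c" "\<And>x. x \<in> X \<Longrightarrow> Cl (k x) = h x"
    "\<And>x. x \<in> X \<Longrightarrow> E b0 (k x) \<longleftrightarrow> E b0' x" "\<And>x. x \<in> X \<Longrightarrow> E b (k x) \<noteq> E b0 (k x) \<longleftrightarrow> x \<in> T"
    by metis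
  have ks: "x = x'" if "x \<in> X" "x' \<in> X" "same (k x) (k x')" for x x'
    using that k h(1) Cl_eq_iff by (metis inj_onD)
  have "inj_on k X" using ks k(1) same_refl by (metis inj_onI)
  moreover have "E (k x) (k x') \<longleftrightarrow> E x x'" if "x \<in> X" "x' \<in> X" for x x'
    using that X(3) ks same_E k(1) E_irrefl by metis
  moreover have "k ` X \<subseteq> V c" using k(1) by blast
  ultimately obtain g where g: "is_iso g G G" "g b0 = b0'" "\<And>x. x \<in> X \<Longrightarrow> g (k x) = x"
    using transport [OF cd X(1,2) _ _ _ b(1,4) k(3)] by metis
  show ?thesis
  proof (rule that [of "g b"])
    show "g b \<in> V d" using aut_V [OF g(1) b(2)] .
    show "E b0' (g b)" using aut_V_E [OF g(1) b(1,2)] b(3) g(2) by simp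
    fix x assume x: "x \<in> X"
    then have "E (g b) x \<longleftrightarrow> E b (k x)" using aut_V_E [OF g(1) b(2) k(1) [OF x]] g(3) by simp
    then show "E (g b) x \<noteq> E b0' x \<longleftrightarrow> x \<in> T" using k(3,4) x by blast
  qed
qed

text \<open>Otherwise any two adjacent vertices of colour \<open>d\<close> would be opposite at
  every vertex of colour \<open>c\<close>, which three pairwise adjacent vertices cannot be.\<close>

lemma agr_nonempty:
  assumes cd: "c \<noteq> d" and big: "big d" and b: "b0 \<in> V d" "b \<in> V d" "E b0 b"
  shows "agr c b0 b \<noteq> {}"
proof
  assume em: "agr c b0 b = {}"
  have em': "agr c y y' = {}" if y: "y \<in> V d" "y' \<in> V d" "E y y'" for y y'
  proof -
    obtain g where "is_iso g G G" "g b0 = y" "g b = y'"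
      using move2 [OF b(1) y(1) b(2) y(2)] b(3) y(3) E_irrefl by metis
    then show ?thesis using aut_agr b em by (metis image_empty)
  qed
  obtain z where z: "z \<in> V d" "E b0 z" "E b z" using big_nbr [OF big b] .
  obtain x where "x \<in> V c" using two_cliques by blast
  then show False
    using em em' [OF b(1) z(1,2)] em' [OF b(2) z(1,3)] unfolding agr_def by blast
qed

text \<open>If only finitely many cliques separate \<open>b0\<close> and \<open>b\<close>, then every set of as many cliques
  occurs as the set separating a vertex \<open>b1\<close> of another clique from some neighbour \<open>b2\<close>. So
  whether the former set lies in the latter depends on \<open>b2\<close>, although all these \<open>b2\<close> have the
  same type over \<open>{b0, b, b1}\<close>.\<close>

lemma infinite_sep_cliques:
  assumes cd: "c \<noteq> d" and nt: "nontriv c" and par: "parity c d" and big: "big d"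
    and b: "b0 \<in> V d" "b \<in> V d" "E b0 b"
  shows "infinite (Cl ` sep c b0 b)"
proof
  assume fin: "finite (Cl ` sep c b0 b)"
  \<comment> \<open>One vertex from each separating clique, so \<open>card X\<close> is the number
    of these cliques.\<close>
  obtain X where X: "X \<subseteq> sep c b0 b" "inj_on Cl X" "Cl ` sep c b0 b = Cl ` X"
    using subset_image_inj [of "Cl ` sep c b0 b" Cl "sep c b0 b"] by auto
  then have finX: "finite X" and cardX: "card X = card (Cl ` sep c b0 b)"
    using fin finite_imageD card_image by metis+
  have XV: "X \<subseteq> V c" using X(1) by (auto simp: sep_def)
  have "sep c b0 b \<noteq> {}"
    using no_adjacent_twins [OF cd b] by (auto simp: sep_def twins_def)
  then have "X \<noteq> {}" using X(3) by (metis image_is_empty)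
  then obtain x1 where x1: "x1 \<in> X" by blast
  obtain x0 where x0: "x0 \<in> agr c b0 b" using agr_nonempty [OF cd big b] by blast
  then have x0V: "x0 \<in> V c" and x0s: "x0 \<notin> sep c b0 b" by (auto simp: sep_def agr_def)
  have x0n: "\<not> same x0 x" if "x \<in> X" for x
    using that x0s X(1) parityD [OF par b _ x0V] by blast
  have x0X: "x0 \<notin> X" using x0s X(1) by blast
  define Y where "Y = insert x0 X"
  have "\<not> E x y" if "x \<in> Y" "y \<in> Y" for x y
  proof
    assume e: "E x y"
    have V: "x \<in> V c" "y \<in> V c" using that XV x0V by (auto simp: Y_def)
    then have s: "same x y" "same y x" using same_E e same_sym by blast+
    then have "x \<in> X" "y \<in> X" using that x0n e E_irrefl by (auto simp: Y_def)
    then have "x = y" using X(2) s(1) V Cl_eq_iff by (metis inj_onD)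
    then show False using e E_irrefl by blast
  qed
  then have Y: "finite Y" "Y \<subseteq> V c" "\<And>x y. x \<in> Y \<Longrightarrow> y \<in> Y \<Longrightarrow> \<not> E x y"
    using finX XV x0V by (auto simp: Y_def)
  obtain b1 where b1: "b1 \<in> V d" "\<not> same b0 b1" using other_clique [OF b(1)] .
  \<comment> \<open>Both sets used below leave exactly one element of \<open>Y\<close> outside, so
    one agreeing clique suffices.\<close>
  have ca: "infinite (Cl ` agr c b0 b) \<or> 1 \<le> card (Cl ` agr c b0 b)"
    using x0 by (auto simp: Suc_le_eq card_gt_0_iff)
  have "Y - X = {x0}" using x0X by (auto simp: Y_def)
  then obtain b2 where b2: "b2 \<in> V d" "E b1 b2" "\<And>x. x \<in> Y \<Longrightarrow> (E b2 x \<noteq> E b1 x) \<longleftrightarrow> x \<in> X"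
    using transport_parity [OF cd nt par b b1(1) Y, of X] cardX ca by (auto simp: Y_def)
  \<comment> \<open>\<open>T\<close> trades the separating vertex \<open>x1\<close> for the agreeing
    \<open>x0\<close>. It has the size of \<open>X\<close>, so the same transport applies, but the
    resulting \<open>b3\<close> agrees with \<open>b1\<close> at \<open>x1\<close>.\<close>
  define T where "T = insert x0 (X - {x1})"
  have "T \<subseteq> Y" "Y - T = {x1}" using x1 x0X by (auto simp: Y_def T_def)
  moreover have "card T = card X"
    using x0X finX by (simp add: T_def card_Suc_Diff1 [OF finX x1] del: card_Diff_insert)
  ultimately obtain b3 where b3: "b3 \<in> V d" "E b1 b3" "\<And>x. x \<in> Y \<Longrightarrow> (E b3 x \<noteq> E b1 x) \<longleftrightarrow> x \<in> T"
    using transport_parity [OF cd nt par b b1(1) Y, of T] cardX ca by auto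
  have sub: "sep c b0 b \<subseteq> sep c b1 b2"
  proof
    fix x assume x: "x \<in> sep c b0 b"
    then have xV: "x \<in> V c" by (simp add: sep_def)
    obtain u where u: "u \<in> X" "Cl u = Cl x" using x X(3) by (metis imageE imageI)
    have uV: "u \<in> V c" using u XV by blast
    have "u \<in> sep c b1 b2" using u b2(3) [of u] uV by (auto simp: sep_def Y_def)
    moreover have "same u x" using u uV Cl_eq_iff by blast
    ultimately show "x \<in> sep c b1 b2" using parityD [OF par b1(1) b2(1,2) _ uV] by blast
  qed
  have x1n: "x1 \<notin> sep c b1 b3" using b3(3) [of x1] x1 x0X by (auto simp: sep_def Y_def T_def)
  have s: "same b0 b" "same b1 b2" "same b1 b3" using same_E b b1 b2 b3 by blast+
  have ns: "\<not> same b0 b1" "\<not> same b0 b2" "\<not> same b0 b3" "\<not> same b b1" "\<not> same b b2" "\<not> same b b3"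
    using b1(2) s same_sym same_trans by blast+
  have n: "\<And>u v. \<not> same u v \<Longrightarrow> u \<in> V d \<Longrightarrow> v \<in> V d \<Longrightarrow> u \<noteq> v \<and> v \<noteq> u \<and> \<not> E u v \<and> \<not> E v u"
    using not_same E_sym by blast
  have "partial_iso G G {(b0, b0), (b, b), (b1, b1), (b2, b3)}"
    unfolding partial_iso_def
    using b b1(1) b2(1) b3(1) n [OF ns(1) b(1) b1(1)] n [OF ns(2) b(1) b2(1)] n [OF ns(3) b(1) b3(1)]
      n [OF ns(4) b(2) b1(1)] n [OF ns(5) b(2) b2(1)] n [OF ns(6) b(2) b3(1)] b2(2) b3(2)
      E_sym [OF b2(2)] E_sym [OF b3(2)] E_irrefl
    by (auto simp: V_iff)
  then obtain g where g: "is_iso g G G"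
    "\<And>x y. (x, y) \<in> {(b0, b0), (b, b), (b1, b1), (b2, b3)} \<Longrightarrow> g x = y"
    by (rule extend) blast
  have gb: "g b0 = b0" "g b = b" "g b1 = b1" "g b2 = b3" using g(2) by blast+
  \<comment> \<open>\<open>g\<close> fixes \<open>b0\<close> and \<open>b\<close>, so it maps their
    separating set onto itself, while it maps the larger separating set of \<open>b1\<close>,
    \<open>b2\<close> onto that of \<open>b1\<close>, \<open>b3\<close>.\<close>
  have "x1 \<in> g ` sep c b0 b" using aut_sep [OF g(1) b(1,2)] gb x1 X(1) by auto
  then have "x1 \<in> g ` sep c b1 b2" using sub by blast
  then show False using x1n aut_sep [OF g(1) b1(1) b2(1)] gb by simp
qed

text \<open>Where two neighbours \<open>b\<close>, \<open>z\<close> of \<open>b0\<close> disagree,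
  \<open>b0\<close> agrees with one of them. So finitely many agreeing cliques for
  \<open>b0 b\<close>, and by moving also for \<open>b0 z\<close>, would leave finitely many
  separating cliques for \<open>b z\<close>.\<close>

lemma infinite_agr_cliques:
  assumes cd: "c \<noteq> d" and nt: "nontriv c" and par: "parity c d" and big: "big d"
    and b: "b0 \<in> V d" "b \<in> V d" "E b0 b"
  shows "infinite (Cl ` agr c b0 b)"
proof
  assume fin: "finite (Cl ` agr c b0 b)"
  obtain z where z: "z \<in> V d" "E b0 z" "E b z" using big_nbr [OF big b] .
  obtain g where g: "is_iso g G G" "g b0 = b0" "g b = z"
    using move2 [OF b(1,1,2) z(1)] b(3) z E_irrefl by metis
  have "agr c b0 z = g ` agr c b0 b" using aut_agr [OF g(1) b(1,2)] g by simp
  then have "finite (Cl ` agr c b0 z)"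
    using finite_Cl_aut [OF g(1) _ fin] by (auto simp: agr_def)
  moreover have "sep c b z \<subseteq> agr c b0 b \<union> agr c b0 z" by (auto simp: sep_def agr_def)
  then have "Cl ` sep c b z \<subseteq> Cl ` agr c b0 b \<union> Cl ` agr c b0 z" by blast
  ultimately have "finite (Cl ` sep c b z)" using fin by (meson finite_UnI finite_subset)
  then show False using infinite_sep_cliques [OF cd nt par big b(2) z(1,3)] by blast
qed

lemma large_vs_nontrivial:
  assumes cd: "c \<noteq> d" and nt: "nontriv c" and par: "parity c d" and big: "big d"
    and b0: "b0 \<in> V d" and X: "finite X" "X \<subseteq> V c" "\<And>x y. x \<in> X \<Longrightarrow> y \<in> X \<Longrightarrow> \<not> E x y"
  obtains b where "b \<in> V d" "E b0 b" "\<And>x. x \<in> X \<Longrightarrow> E b x \<longleftrightarrow> x \<in> W"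
proof -
  obtain b where b: "b \<in> V d" "E b0 b" using nontriv_nbr [OF big_imp_nontriv [OF big] b0] .
  \<comment> \<open>Following \<open>W\<close> on \<open>X\<close> amounts to disagreeing with
    \<open>b0\<close> exactly on \<open>T\<close>.\<close>
  define T where "T = {x \<in> X. E b0 x \<noteq> (x \<in> W)}"
  have "T \<subseteq> X" by (auto simp: T_def)
  then obtain b' where "b' \<in> V d" "E b0 b'" "\<And>x. x \<in> X \<Longrightarrow> (E b' x \<noteq> E b0 x) \<longleftrightarrow> x \<in> T"
    using transport_parity [OF cd nt par b0 b b0 X]
      infinite_sep_cliques [OF cd nt par big b0 b] infinite_agr_cliques [OF cd nt par big b0 b] by blast
  then show ?thesis using that [of b'] by (auto simp: T_def)
qed

section \<open>Large cliques against an independent set\<close>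

lemma clique_E:
  "E x y \<Longrightarrow> E x z \<Longrightarrow> y \<noteq> z \<Longrightarrow> x \<in> V c \<Longrightarrow> y \<in> V c \<Longrightarrow> z \<in> V c \<Longrightarrow> E y z"
  using clique [of y x z] E_sym [of x y] by (simp add: V_iff)

text \<open>The cells that a pair cuts out of the other colour. If that colour has no edges, their
  sizes are the only constraint on moving finite sets, and they take over the role of
  \<open>sep\<close> and \<open>agr\<close>.\<close>

definition ntype :: "color \<Rightarrow> 'a \<Rightarrow> 'a \<Rightarrow> bool \<Rightarrow> bool \<Rightarrow> 'a set" where
  "ntype c b b' i j = {x \<in> V c. E b x = i \<and> E b' x = j}"

lemma ntype_swap: "ntype c b b' i j = ntype c b' b j i"
  by (auto simp: ntype_def)

lemma ntype_bij:
  assumes "b1 \<in> V d" "b2 \<in> V d" "y1 \<in> V d" "y2 \<in> V d" "b1 = b2 \<longleftrightarrow> y1 = y2" "E b1 b2 \<longleftrightarrow> E y1 y2"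
  shows "\<exists>f. bij_betw f (ntype c b1 b2 i j) (ntype c y1 y2 i j)"
proof -
  obtain g where g: "is_iso g G G" "g b1 = y1" "g b2 = y2"
    using move2 [OF assms(1,3,2,4)] assms by blast
  have "ntype c y1 y2 i j = g ` ntype c b1 b2 i j"
    using aut_Collect [OF g(1) assms(1,2), of c "\<lambda>p q. p = i \<and> q = j"] g by (simp add: ntype_def)
  moreover have "inj_on g (ntype c b1 b2 i j)"
    using aut_eq [OF g(1)] by (auto simp: inj_on_def ntype_def V_iff)
  ultimately show ?thesis unfolding bij_betw_def by blast
qed

lemma
  assumes "b1 \<in> V d" "b2 \<in> V d" "y1 \<in> V d" "y2 \<in> V d" "b1 = b2 \<longleftrightarrow> y1 = y2" "E b1 b2 \<longleftrightarrow> E y1 y2"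
  shows ntype_finite: "finite (ntype c b1 b2 i j) \<longleftrightarrow> finite (ntype c y1 y2 i j)"
    and ntype_card: "card (ntype c b1 b2 i j) = card (ntype c y1 y2 i j)"
  using ntype_bij [OF assms] bij_betw_finite bij_betw_same_card by metis+

text \<open>Without edges in colour \<open>c\<close> every injection of \<open>X\<close> is
  admissible. It suffices to put each \<open>x\<close> into the cell recording its adjacency to
  \<open>b0'\<close> and its membership in \<open>W\<close>, so each cell must hold as many elements
  as are assigned to it.\<close>

lemma transport_independent:
  assumes cd: "c \<noteq> d" and ind: "\<not> nontriv c"
    and b: "b0 \<in> V d" "b \<in> V d" "E b0 b" "b0' \<in> V d"
    and X: "finite X" "X \<subseteq> V c"
    and cs: "\<And>i j. infinite (ntype c b0 b i j) \<or>
      card {x \<in> X. E b0' x = i \<and> (x \<in> W) = j} \<le> card (ntype c b0 b i j)"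
  obtains b' where "b' \<in> V d" "E b0' b'" "\<And>x. x \<in> X \<Longrightarrow> E b' x \<longleftrightarrow> x \<in> W"
proof -
  define R where "R = (\<lambda>(i, j). ntype c b0 b i j)"
  have "infinite (R t) \<or> card {x \<in> X. (E b0' x, x \<in> W) = t} \<le> card (R t)" for t
    using cs by (cases t) (auto simp: R_def)
  moreover have "R t \<inter> R t' = {}" if "t \<noteq> t'" for t t'
    using that by (cases t; cases t') (auto simp: R_def ntype_def)
  ultimately obtain k where k: "inj_on k X" "\<And>x. x \<in> X \<Longrightarrow> k x \<in> R (E b0' x, x \<in> W)"
    using inj_on_into_disjoint [OF X(1), of R "\<lambda>x. (E b0' x, x \<in> W)"] by blast
  then have k': "k x \<in> V c" "E b0 (k x) \<longleftrightarrow> E b0' x" "E b (k x) \<longleftrightarrow> x \<in> W" if "x \<in> X" for x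
    using that by (auto simp: R_def ntype_def)
  have ni: "\<not> E x y" if "x \<in> V c" "y \<in> V c" for x y
    using that ind unfolding nontriv_def V_iff by blast
  have "E (k x) (k x') \<longleftrightarrow> E x x'" if "x \<in> X" "x' \<in> X" for x x'
    using that ni X(2) k'(1) by blast
  moreover have "k ` X \<subseteq> V c" using k'(1) by blast
  ultimately obtain g where g: "is_iso g G G" "g b0 = b0'" "\<And>x. x \<in> X \<Longrightarrow> g (k x) = x"
    using transport [OF cd X k(1) _ _ b(1,4) k'(2)] by metis
  show ?thesis
  proof (rule that [of "g b"])
    show "g b \<in> V d" using aut_V [OF g(1) b(2)] .
    show "E b0' (g b)" using aut_V_E [OF g(1) b(1,2)] b(3) g(2) by simp
    fix x assume x: "x \<in> X"
    then show "E (g b) x \<longleftrightarrow> x \<in> W" using aut_V_E [OF g(1) b(2) k'(1) [OF x]] g(3) k'(3) by simp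
  qed
qed

definition N :: "color \<Rightarrow> 'a \<Rightarrow> 'a set" where "N c b = {x \<in> V c. E b x}"
definition M :: "color \<Rightarrow> 'a \<Rightarrow> 'a set" where "M c b = {x \<in> V c. \<not> E b x}"

lemma N_ntype: "N c b = ntype c b b' True True \<union> ntype c b b' True False"
  and M_ntype: "M c b = ntype c b b' False True \<union> ntype c b b' False False"
  by (auto simp: N_def M_def ntype_def)

lemma N_bij:
  assumes "b \<in> V d" "b' \<in> V d"
  shows "\<exists>f. bij_betw f (N c b) (N c b')"
proof -
  have "N c b = ntype c b b True True" "N c b' = ntype c b' b' True True" by (auto simp: N_def ntype_def)
  then show ?thesis using ntype_bij [OF assms(1,1,2,2)] E_irrefl by metis
qed

lemma
  assumes "b \<in> V d" "b' \<in> V d"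
  shows N_finite: "finite (N c b) \<longleftrightarrow> finite (N c b')" and N_card: "card (N c b) = card (N c b')"
  using N_bij [OF assms] bij_betw_finite bij_betw_same_card by metis+

text \<open>An automorphism exchanging \<open>b\<close> and \<open>b'\<close> would empty the
  opposite cell as well and make them adjacent twins.\<close>

lemma ntype_TF_nonempty:
  assumes "c \<noteq> d" and b: "b \<in> V d" "b' \<in> V d" "E b b'"
  shows "ntype c b b' True False \<noteq> {}"
proof
  assume em: "ntype c b b' True False = {}"
  have "ntype c b' b True False = {}"
  proof -
    have "E b b' \<longleftrightarrow> E b' b" by (rule E_commute)
    then obtain f where "bij_betw f (ntype c b b' True False) (ntype c b' b True False)"
      using ntype_bij [OF b(1,2) b(2,1)] by blast
    then show ?thesis using em by (simp add: bij_betw_def)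
  qed
  then have "twins c b b'" using em unfolding twins_def ntype_def by blast
  then show False using no_adjacent_twins [OF assms] by blast
qed

text \<open>Otherwise one could trade an element of \<open>N c y1 \<inter> N c y2\<close> for one outside \<open>N c y1\<close> by
  passing to a neighbour of \<open>y2\<close>, but the size of this intersection is constant on nonadjacent
  pairs.\<close>

lemma infinite_N:
  assumes cd: "c \<noteq> d" and ind: "\<not> nontriv c" and nt: "nontriv d" and b: "b \<in> V d"
  shows "infinite (N c b)"
proof
  assume "finite (N c b)"
  then have finN: "finite (N c y)" if "y \<in> V d" for y using that N_finite b by blast
  have "V c = N c y \<union> M c y" for y by (auto simp: N_def M_def)
  then have infM: "infinite (M c y)" if "y \<in> V d" for y
    using that finN infinite_V [OF cd] nt by (metis finite_UnI)
  obtain v where v: "v \<in> V c" using two_cliques by blast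
  obtain b2 where b2: "b2 \<in> V d" "\<not> same b b2" using other_clique [OF b] .
  obtain y1 where y1: "same b y1" "E v y1" "y1 \<in> V d" using split [OF cd [symmetric] nt v b] .
  obtain y2 where y2: "same b2 y2" "E v y2" "y2 \<in> V d" using split [OF cd [symmetric] nt v b2(1)] .
  have n12: "\<not> same y1 y2" using y1 y2 b2 same_sym same_trans by blast
  obtain z where z: "z \<in> V d" "E y2 z" using nontriv_nbr [OF nt y2(3)] .
  \<comment> \<open>The number of neighbours that are lost, and by symmetry also gained, in passing
    from a vertex to an adjacent one.\<close>
  let ?c = "card (ntype c y2 z True False)"
  have fTF: "finite (ntype c y2 z True False)" using finN [OF y2(3)] N_ntype [of c y2 z] by simp
  have c0: "?c \<noteq> 0" using ntype_TF_nonempty [OF cd y2(3) z] fTF by simp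
  have cN: "card (N c y2) = card (ntype c y2 z True True) + ?c"
  proof -
    have "ntype c y2 z True True \<inter> ntype c y2 z True False = {}" by (auto simp: ntype_def)
    moreover have "finite (ntype c y2 z True True)" using finN [OF y2(3)] N_ntype [of c y2 z] by simp
    ultimately show ?thesis using fTF N_ntype [of c y2 z] by (simp add: card_Un_disjoint)
  qed
  have cFT: "card (ntype c y2 z False True) = ?c"
    using ntype_card [OF z(1) y2(3) y2(3) z(1)] ntype_swap z E_commute by metis
  have vN: "v \<in> N c y2" using v y2 E_sym by (auto simp: N_def)
  have "?c - 1 \<le> card (N c y2 - {v})" using cN vN finN [OF y2(3)] by simp
  then obtain A' where A': "A' \<subseteq> N c y2 - {v}" "card A' = ?c - 1" "finite A'"
    by (metis obtain_subset_with_card_n)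
  \<comment> \<open>\<open>A\<close> is to be lost and contains the common neighbour
    \<open>v\<close> of \<open>y1\<close> and \<open>y2\<close>; \<open>B\<close> below is to be
    gained and avoids the neighbours of \<open>y1\<close>.\<close>
  define A where "A = insert v A'"
  have "v \<notin> A'" using A'(1) by blast
  then have A: "A \<subseteq> N c y2" "v \<in> A" "card A = ?c" using A' vN c0 by (auto simp: A_def)
  have "infinite (M c y2 - N c y1)" using infM [OF y2(3)] finN [OF y1(3)] by auto
  then obtain B where B: "B \<subseteq> M c y2 - N c y1" "finite B" "card B = ?c"
    using infinite_arbitrarily_large by blast
  define X where "X = N c y2 \<union> B"
  define W where "W = (N c y2 - A) \<union> B"
  have X: "finite X" "X \<subseteq> V c" using B finN [OF y2(3)] by (auto simp: X_def N_def M_def)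
  have disj: "N c y2 \<inter> M c y2 = {}" by (auto simp: N_def M_def)
  have "{x \<in> X. E y2 x = True \<and> (x \<in> W) = True} = N c y2 - A"
    "{x \<in> X. E y2 x = True \<and> (x \<in> W) = False} = A"
    "{x \<in> X. E y2 x = False \<and> (x \<in> W) = True} = B"
    "{x \<in> X. E y2 x = False \<and> (x \<in> W) = False} = {}"
    using A(1) B(1) by (auto simp: X_def W_def N_def M_def)
  moreover have cNA: "card (N c y2 - A) = card (ntype c y2 z True True)"
    using A cN finN [OF y2(3)] by (simp add: card_Diff_subset finite_subset)
  ultimately have "infinite (ntype c y2 z i j) \<or>
      card {x \<in> X. E y2 x = i \<and> (x \<in> W) = j} \<le> card (ntype c y2 z i j)" for i j
    using A B cFT by (cases i; cases j) (simp_all del: Collect_empty_eq)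
  from transport_independent [OF cd ind y2(3) z y2(3) X this] obtain b' where b': "b' \<in> V d" "E y2 b'" "\<And>x. x \<in> X \<Longrightarrow> E b' x \<longleftrightarrow> x \<in> W" by blast
  have "W \<subseteq> X" by (auto simp: W_def X_def)
  then have "W \<subseteq> N c b'" using b'(3) X(2) by (auto simp: N_def)
  \<comment> \<open>\<open>b'\<close> was prescribed on \<open>X\<close> only; equal finite
    cardinalities exclude neighbours outside \<open>W\<close>.\<close>
  moreover have "card W = card (N c b')"
  proof -
    have "card W = card (N c y2 - A) + card B"
      unfolding W_def using finN [OF y2(3)] B disj by (intro card_Un_disjoint) auto
    then show ?thesis using cNA B cN N_card [OF y2(3) b'(1)] by simp
  qed
  ultimately have NW: "N c b' = W" using finN [OF b'(1)] by (metis card_subset_eq)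
  have nb: "\<not> same y1 b'" using n12 b' y2 same_E same_sym same_trans by blast
  have "card (ntype c y1 y2 True True) = card (ntype c y1 b' True True)"
    using ntype_card [OF y1(3) y2(3) y1(3) b'(1)] not_same n12 nb y1 y2 b' by metis
  moreover have "ntype c y1 b' True True \<subset> ntype c y1 y2 True True"
  proof
    have "x \<in> N c y2" if "x \<in> W" "E y1 x" for x using that B(1) by (auto simp: W_def N_def M_def)
    then show "ntype c y1 b' True True \<subseteq> ntype c y1 y2 True True"
      unfolding ntype_def using NW N_def [of c b'] N_def [of c y2] by blast
    have "v \<in> ntype c y1 y2 True True" using v y1 y2 E_sym by (auto simp: ntype_def)
    moreover have "v \<notin> ntype c y1 b' True True" using NW A(2) B(1) v disj vN by (auto simp: ntype_def W_def N_def)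
    ultimately show "ntype c y1 b' True True \<noteq> ntype c y1 y2 True True" by blast
  qed
  moreover have "finite (ntype c y1 y2 True True)"
    using finN [OF y1(3)] by (rule finite_subset [rotated]) (auto simp: ntype_def N_def)
  ultimately show False using psubset_card_mono by (metis less_irrefl)
qed

lemma complement_E_same:
  "col G x = col G y \<Longrightarrow> adj (cross_complement G) x y \<longleftrightarrow> E x y"
  using E_verts [of x y] by auto

lemma complement_sets:
  assumes "c \<noteq> d" "b \<in> V d"
  shows "{x \<in> color_class (cross_complement G) c. adj (cross_complement G) b x} = M c b"
  using assms by (auto simp: M_def color_class_def)

lemma infinite_M:
  assumes cd: "c \<noteq> d" and ind: "\<not> nontriv c" and nt: "nontriv d" and b: "b \<in> V d"
  shows "infinite (M c b)"
proof -
  interpret K: basic_graph "cross_complement G"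
    by (rule basic_graph_cross_complement) (rule basic_graph_axioms)
  have nK: "K.nontriv e \<longleftrightarrow> nontriv e" for e
    unfolding K.nontriv_def nontriv_def cross_complement_fields(3) by (metis complement_E_same)
  have "infinite (K.N c b)"
    using K.infinite_N [OF cd] ind nt b nK by (simp add: color_class_def)
  then show ?thesis using complement_sets [OF cd b] by (simp add: K.N_def)
qed

text \<open>Otherwise each step to an adjacent vertex loses and gains exactly \<open>?c\<close>
  neighbours. Let \<open>b1\<close> lose \<open>A\<close> and gain \<open>B\<close>, and let
  \<open>b2\<close> lose \<open>A'\<close> and gain \<open>B'\<close>, all four sets disjoint. Then
  \<open>b1\<close> has the \<open>2 * ?c\<close> neighbours in \<open>A' \<union> B\<close> that
  the adjacent vertex \<open>b2\<close> lacks.\<close>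

lemma infinite_ntype_TF:
  assumes cd: "c \<noteq> d" and ind: "\<not> nontriv c" and b: "b0 \<in> V d" "b \<in> V d" "E b0 b"
  shows "infinite (ntype c b0 b True False)"
proof
  assume fin: "finite (ntype c b0 b True False)"
  have nt: "nontriv d" using b by (auto simp: nontriv_def V_iff)
  note infN = infinite_N [OF cd ind nt b(1)] and infM = infinite_M [OF cd ind nt b(1)]
  let ?c = "card (ntype c b0 b True False)"
  have c0: "?c \<noteq> 0" using ntype_TF_nonempty [OF cd b] fin by simp
  have e': "E b b0" using b(3) by (rule E_sym)
  have FT: "finite (ntype c b0 b False True)" "card (ntype c b0 b False True) = ?c"
    using ntype_card [OF b(2,1) b(1,2)] ntype_finite [OF b(2,1) b(1,2)] ntype_swap b e' fin by metis+
  have TT: "infinite (ntype c b0 b True True)" using infN N_ntype [of c b0 b] fin by simp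
  have FF: "infinite (ntype c b0 b False False)" using infM M_ntype [of c b0 b] FT(1) by simp
  obtain A where A: "A \<subseteq> N c b0" "finite A" "card A = ?c" using infN infinite_arbitrarily_large by blast
  have "infinite (N c b0 - A)" using infN A by simp
  then obtain A' where A': "A' \<subseteq> N c b0 - A" "finite A'" "card A' = ?c"
    using infinite_arbitrarily_large by blast
  obtain B where B: "B \<subseteq> M c b0" "finite B" "card B = ?c" using infM infinite_arbitrarily_large by blast
  have "infinite (M c b0 - B)" using infM B by simp
  then obtain B' where B': "B' \<subseteq> M c b0 - B" "finite B'" "card B' = ?c"
    using infinite_arbitrarily_large by blast
  define X where "X = A \<union> A' \<union> B \<union> B'"
  have X: "finite X" "X \<subseteq> V c" using A A' B B' by (auto simp: X_def N_def M_def)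
  have "{x \<in> X. E b0 x = True \<and> (x \<in> A' \<union> B) = False} = A"
    "{x \<in> X. E b0 x = False \<and> (x \<in> A' \<union> B) = True} = B"
    "{x \<in> X. E b0 x = True \<and> (x \<in> A \<union> B') = False} = A'"
    "{x \<in> X. E b0 x = False \<and> (x \<in> A \<union> B') = True} = B'"
    using A(1) A'(1) B(1) B'(1) by (auto simp: X_def N_def M_def)
  note sets = this
  have "infinite (ntype c b0 b i j) \<or>
      card {x \<in> X. E b0 x = i \<and> (x \<in> A' \<union> B) = j} \<le> card (ntype c b0 b i j)" for i j
    using sets A B FT TT FF by (cases i; cases j) simp_all
  from transport_independent [OF cd ind b b(1) X this]
  obtain b1 where b1: "b1 \<in> V d" "E b0 b1"
      "\<And>x. x \<in> X \<Longrightarrow> E b1 x \<longleftrightarrow> x \<in> A' \<union> B" by blast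
  have "infinite (ntype c b0 b i j) \<or>
      card {x \<in> X. E b0 x = i \<and> (x \<in> A \<union> B') = j} \<le> card (ntype c b0 b i j)" for i j
    using sets A' B' FT TT FF by (cases i; cases j) simp_all
  from transport_independent [OF cd ind b b(1) X this]
  obtain b2 where b2: "b2 \<in> V d" "E b0 b2"
      "\<And>x. x \<in> X \<Longrightarrow> E b2 x \<longleftrightarrow> x \<in> A \<union> B'" by blast
  have dis: "A \<inter> A' = {}" "A \<inter> B = {}" "A' \<inter> B = {}" "A' \<inter> B' = {}" "B \<inter> B' = {}"
    using A(1) A'(1) B(1) B'(1) by (auto simp: N_def M_def)
  have sub: "A' \<union> B \<subseteq> ntype c b1 b2 True False"
  proof
    fix x assume x: "x \<in> A' \<union> B"
    then have "x \<in> X" "x \<notin> A \<union> B'" using dis by (auto simp: X_def)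
    then show "x \<in> ntype c b1 b2 True False"
      using b1(3) [of x] b2(3) [of x] x X(2) by (auto simp: ntype_def)
  qed
  then have "b1 \<noteq> b2" using A' c0 by (auto simp: ntype_def)
  then have e12: "E b1 b2" using clique_E b1(1,2) b2(1,2) b(1) by blast
  then have "finite (ntype c b1 b2 True False)" "card (ntype c b1 b2 True False) = ?c"
    using ntype_card [OF b1(1) b2(1) b(1,2)] ntype_finite [OF b1(1) b2(1) b(1,2)] fin b(3) E_irrefl by metis+
  then have "card (A' \<union> B) \<le> ?c" using sub card_mono by metis
  moreover have "card (A' \<union> B) = 2 * ?c" using A' B dis by (simp add: card_Un_disjoint)
  ultimately show False using c0 by simp
qed

text \<open>A third clique vertex \<open>z\<close> has infinitely many neighbours, but would have
  only finitely many in common with \<open>b0\<close> or \<open>b\<close>; so infinitely many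
  vertices miss both \<open>b0\<close> and \<open>b\<close>. Hence neighbours of \<open>b0\<close>
  can be prescribed freely on nonneighbours of \<open>b0\<close>, and two of them can be given more
  than \<open>?c\<close> common neighbours there.\<close>

lemma infinite_ntype_TT:
  assumes cd: "c \<noteq> d" and ind: "\<not> nontriv c" and big: "big d"
    and b: "b0 \<in> V d" "b \<in> V d" "E b0 b"
  shows "infinite (ntype c b0 b True True)"
proof
  assume fin: "finite (ntype c b0 b True True)"
  note nt = big_imp_nontriv [OF big]
  have fin': "finite (ntype c y y' True True)" "card (ntype c y y' True True) = card (ntype c b0 b True True)"
    if "y \<in> V d" "y' \<in> V d" "E y y'" for y y'
    using that ntype_card [OF that(1,2) b(1,2)] ntype_finite [OF that(1,2) b(1,2)] fin b(3) E_irrefl by metis+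
  obtain z where z: "z \<in> V d" "E b0 z" "E b z" using big_nbr [OF big b] .
  have "N c z \<subseteq> ntype c b0 z True True \<union> ntype c b z True True \<union> ntype c b0 b False False"
    by (auto simp: N_def ntype_def)
  then have FF: "infinite (ntype c b0 b False False)"
    using infinite_N [OF cd ind nt z(1)] fin' [OF b(1) z(1,2)] fin' [OF b(2) z(1,3)]
    by (meson finite_UnI finite_subset)
  have "E b b0" using b(3) by (rule E_sym)
  then have FT: "infinite (ntype c b0 b False True)"
    using infinite_ntype_TF [OF cd ind b(2,1)] ntype_swap by metis
  let ?c = "card (ntype c b0 b True True)"
  have infM: "infinite (M c b0)" using infinite_M [OF cd ind nt b(1)] .
  then obtain Y where Y: "Y \<subseteq> M c b0" "finite Y" "card Y = ?c + 1"
    using infinite_arbitrarily_large by blast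
  have "infinite (M c b0 - Y)" using infM Y by simp
  \<comment> \<open>The extra vertex \<open>w\<close> keeps \<open>b1\<close> and \<open>b2\<close>
    distinct.\<close>
  then obtain w where w: "w \<in> M c b0" "w \<notin> Y" using infinite_imp_nonempty by blast
  define X where "X = insert w Y"
  have X: "finite X" "X \<subseteq> V c" using Y w by (auto simp: X_def M_def)
  have "\<not> E b0 x" if "x \<in> X" for x using that Y(1) w(1) by (auto simp: X_def M_def)
  then have em: "{x \<in> X. E b0 x = True \<and> (x \<in> W) = j} = {}" for W j by auto
  have cs: "infinite (ntype c b0 b i j) \<or>
      card {x \<in> X. E b0 x = i \<and> (x \<in> W) = j} \<le> card (ntype c b0 b i j)" for i j W
  proof (cases i)
    case True
    then have "{x \<in> X. E b0 x = i \<and> (x \<in> W) = j} = {}" using em by simp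
    then show ?thesis by (simp only: card.empty) simp
  next
    case False
    then show ?thesis using FF FT by (cases j) simp_all
  qed
  obtain b1 where b1: "b1 \<in> V d" "E b0 b1" "\<And>x. x \<in> X \<Longrightarrow> E b1 x \<longleftrightarrow> x \<in> X"
    using transport_independent [OF cd ind b b(1) X cs] by blast
  obtain b2 where b2: "b2 \<in> V d" "E b0 b2" "\<And>x. x \<in> X \<Longrightarrow> E b2 x \<longleftrightarrow> x \<in> Y"
    using transport_independent [OF cd ind b b(1) X cs] by blast
  have "b1 \<noteq> b2" using b1(3) b2(3) w by (auto simp: X_def)
  then have e12: "E b1 b2" using clique_E b1(1,2) b2(1,2) b(1) by blast
  have "Y \<subseteq> ntype c b1 b2 True True" using b1(3) b2(3) X(2) by (auto simp: ntype_def X_def)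
  then have "card Y \<le> ?c" using fin' [OF b1(1) b2(1) e12] card_mono by metis
  then show False using Y(3) by simp
qed

lemma infinite_ntype_FF:
  assumes cd: "c \<noteq> d" and ind: "\<not> nontriv c" and big: "big d"
    and b: "b0 \<in> V d" "b \<in> V d" "E b0 b"
  shows "infinite (ntype c b0 b False False)"
proof -
  interpret K: basic_graph "cross_complement G"
    by (rule basic_graph_cross_complement) (rule basic_graph_axioms)
  have nK: "K.nontriv e \<longleftrightarrow> nontriv e" and bK: "K.big e \<longleftrightarrow> big e" for e
    unfolding K.nontriv_def nontriv_def K.big_def big_def cross_complement_fields(3)
    by (metis complement_E_same)+
  have "infinite (K.ntype c b0 b True True)"
    using K.infinite_ntype_TT [OF cd] ind big b nK bK by (simp add: color_class_def)
  moreover have "K.ntype c b0 b True True = ntype c b0 b False False"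
    using cd b by (auto simp: K.ntype_def ntype_def color_class_def)
  ultimately show ?thesis by simp
qed

lemma large_vs_independent:
  assumes cd: "c \<noteq> d" and ind: "\<not> nontriv c" and big: "big d"
    and b0: "b0 \<in> V d" and X: "finite X" "X \<subseteq> V c"
  obtains b where "b \<in> V d" "E b0 b" "\<And>x. x \<in> X \<Longrightarrow> E b x \<longleftrightarrow> x \<in> W"
proof -
  obtain b where b: "b \<in> V d" "E b0 b" using nontriv_nbr [OF big_imp_nontriv [OF big] b0] .
  have "infinite (ntype c b0 b False True)"
    using infinite_ntype_TF [OF cd ind b(1) b0] b(2) E_sym ntype_swap by metis
  then have "infinite (ntype c b0 b i j)" for i j
    using infinite_ntype_TF [OF cd ind b0 b] infinite_ntype_TT [OF cd ind big b0 b]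
      infinite_ntype_FF [OF cd ind big b0 b] by (cases i; cases j) simp_all
  then have cs: "infinite (ntype c b0 b i j) \<or>
      card {x \<in> X. E b0 x = i \<and> (x \<in> W) = j} \<le> card (ntype c b0 b i j)" for i j by blast
  show ?thesis using transport_independent [OF cd ind b0 b b0 X cs] that by blast
qed

section \<open>Infinitely many vertices of each type\<close>

text \<open>\<open>B\<close> will be a single clique of the other colour if those cliques are large,
  and the whole other class if they have two vertices: a two-clique offers no choice, so there the
  clique itself has to vary.\<close>

definition extends :: "color \<Rightarrow> 'a set \<Rightarrow> bool" where
  "extends c B \<longleftrightarrow> (\<forall>X W. finite X \<longrightarrow> X \<subseteq> V c \<longrightarrow> (\<forall>x \<in> X. \<forall>y \<in> X. \<not> E x y) \<longrightarrow>
     infinite {b \<in> B. \<forall>x \<in> X. E b x \<longleftrightarrow> x \<in> W})"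

text \<open>Take one vertex from each of \<open>n\<close> cliques that \<open>X\<close> does not
  meet.\<close>

lemma enlarge_independent:
  assumes inf: "infinite (Cl ` V c)" and X: "finite X" "X \<subseteq> V c" "\<And>x y. x \<in> X \<Longrightarrow> y \<in> X \<Longrightarrow> \<not> E x y"
  obtains Y where "finite Y" "card Y = n" "Y \<subseteq> V c" "X \<inter> Y = {}"
    "\<And>x y. x \<in> X \<union> Y \<Longrightarrow> y \<in> X \<union> Y \<Longrightarrow> \<not> E x y"
proof -
  have "infinite (Cl ` V c - Cl ` X)" using inf X(1) by simp
  then obtain T where T: "T \<subseteq> Cl ` V c - Cl ` X" "finite T" "card T = n"
    using infinite_arbitrarily_large by metis
  then have "T \<subseteq> Cl ` V c" by blast
  then obtain Y where Y: "Y \<subseteq> V c" "inj_on Cl Y" "T = Cl ` Y"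
    by (auto simp: subset_image_inj)
  have fin: "finite Y" "card Y = n" using Y T finite_imageD card_image by metis+
  have xy: "\<not> same x y" if "x \<in> X" "y \<in> Y" for x y
  proof
    assume "same x y"
    then have "Cl y = Cl x" using that X(2) Cl_eq_iff by (metis subsetD)
    moreover have "Cl y \<notin> Cl ` X" using T(1) Y(3) that(2) by blast
    ultimately show False using that(1) by blast
  qed
  have disj: "X \<inter> Y = {}" using xy Y(1) same_refl by blast
  have "\<not> E x y" if "x \<in> X \<union> Y" "y \<in> X \<union> Y" for x y
  proof
    assume e: "E x y"
    have V: "x \<in> V c" "y \<in> V c" using that X(2) Y(1) by auto
    then have s: "same x y" "same y x" using same_E e same_sym by blast+
    then have "x \<in> X \<and> y \<in> X \<or> x \<in> Y \<and> y \<in> Y" using that xy by blast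
    moreover have "x = y" if "x \<in> Y" "y \<in> Y" using that s Cl_eq_iff V Y(2) by (metis inj_onD)
    ultimately show False using e X(3) E_irrefl by blast
  qed
  then show ?thesis using that fin Y(1) disj by blast
qed

text \<open>Existence over all finite independent sets already gives infinitely many solutions. If
  there were finitely many over \<open>X\<close>, add a set \<open>Y\<close> with one element more
  than there are solutions and ask for a solution adjacent to exactly one \<open>y\<close> of
  \<open>Y\<close>; different \<open>y\<close> give different solutions.\<close>

lemma extendsI:
  assumes inf: "infinite (Cl ` V c)"
    and ex: "\<And>X W. finite X \<Longrightarrow> X \<subseteq> V c \<Longrightarrow> (\<And>x y. x \<in> X \<Longrightarrow> y \<in> X \<Longrightarrow> \<not> E x y) \<Longrightarrow>
      \<exists>b \<in> B. \<forall>x \<in> X. E b x \<longleftrightarrow> x \<in> W"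
  shows "extends c B"
  unfolding extends_def
proof (intro allI impI)
  fix X W assume X: "finite X" "X \<subseteq> V c" "\<forall>x \<in> X. \<forall>y \<in> X. \<not> E x y"
  let ?S = "{b \<in> B. \<forall>x \<in> X. E b x \<longleftrightarrow> x \<in> W}"
  show "infinite ?S"
  proof
    assume fin: "finite ?S"
    obtain Y where Y: "finite Y" "card Y = card ?S + 1" "Y \<subseteq> V c" "X \<inter> Y = {}"
      "\<And>x y. x \<in> X \<union> Y \<Longrightarrow> y \<in> X \<union> Y \<Longrightarrow> \<not> E x y"
      by (rule enlarge_independent [OF inf X(1,2)]) (use X(3) in auto)
    have "\<exists>b \<in> B. \<forall>x \<in> X \<union> Y. E b x \<longleftrightarrow> x \<in> (W - Y) \<union> {y}" if "y \<in> Y" for y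
      using ex [of "X \<union> Y" "(W - Y) \<union> {y}"] X(1,2) Y by simp
    then obtain f where f: "\<And>y. y \<in> Y \<Longrightarrow> f y \<in> B \<and> (\<forall>x \<in> X \<union> Y. E (f y) x \<longleftrightarrow> x \<in> (W - Y) \<union> {y})"
      by metis
    have inj: "inj_on f Y"
    proof (rule inj_onI)
      fix y y' assume y: "y \<in> Y" "y' \<in> Y" "f y = f y'"
      then have "E (f y) y \<longleftrightarrow> y \<in> (W - Y) \<union> {y'}" using f [of y'] by simp
      moreover have "E (f y) y" using f [of y] y by simp
      ultimately show "y = y'" using y by simp
    qed
    have "f ` Y \<subseteq> ?S"
    proof clarify
      fix y assume y: "y \<in> Y"
      have "E (f y) x \<longleftrightarrow> x \<in> W" if "x \<in> X" for x
        using f [OF y] that Y(4) y by auto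
      then show "f y \<in> B \<and> (\<forall>x \<in> X. E (f y) x \<longleftrightarrow> x \<in> W)" using f [OF y] by blast
    qed
    then have "card Y \<le> card ?S" by (rule card_inj_on_le [OF inj _ fin])
    then show False using Y(2) by simp
  qed
qed

lemma finite_Cl:
  assumes "\<not> big c" "x \<in> V c"
  shows "finite (Cl x)"
proof (cases "\<exists>y \<in> V c. E x y")
  case True
  then obtain y where y: "y \<in> V c" "E x y" by blast
  have "Cl x \<subseteq> {x, y}"
  proof
    fix z assume "z \<in> Cl x"
    then have "same x z" by (simp add: Cl_def)
    then have "z \<in> V c" "z \<noteq> x \<Longrightarrow> E x z" using assms(2) same_V same_imp_E by blast+
    then show "z \<in> {x, y}" using not_big_unique [OF assms y(1)] y(2) by blast
  qed
  then show ?thesis using finite_subset by blast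
next
  case False
  then have "Cl x \<subseteq> {x}" using assms(2) by (auto simp: Cl_def same_def V_iff)
  then show ?thesis using finite_subset by blast
qed

lemma infinite_cliques:
  assumes "c \<noteq> d" "nontriv c \<or> nontriv d" "\<not> big c"
  shows "infinite (Cl ` V c)"
proof
  assume "finite (Cl ` V c)"
  then have "finite (\<Union> (Cl ` V c))" using finite_Cl [OF assms(3)] by blast
  moreover have "V c \<subseteq> \<Union> (Cl ` V c)" using same_refl by (auto simp: Cl_def)
  ultimately show False using infinite_V [OF assms(1,2)] finite_subset by blast
qed

lemma extends_large_clique:
  assumes cd: "c \<noteq> d" and big: "big d" and par: "nontriv c \<Longrightarrow> parity c d" and b0: "b0 \<in> V d"
  shows "extends c (Cl b0)"
proof (rule extendsI)
  show "infinite (Cl ` V c)"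
  proof (cases "nontriv c")
    case True
    obtain b where b: "b \<in> V d" "E b0 b" using nontriv_nbr [OF big_imp_nontriv [OF big] b0] .
    have "infinite (Cl ` sep c b0 b)" using infinite_sep_cliques [OF cd True par [OF True] big b0 b] .
    moreover have "sep c b0 b \<subseteq> V c" by (auto simp: sep_def)
    ultimately show ?thesis by (meson finite_subset image_mono)
  next
    case False
    then have "\<not> big c" using big_imp_nontriv by blast
    then show ?thesis using infinite_cliques [OF cd] big_imp_nontriv [OF big] by blast
  qed
next
  fix X W assume X: "finite X" "X \<subseteq> V c" "\<And>x y. x \<in> X \<Longrightarrow> y \<in> X \<Longrightarrow> \<not> E x y"
  obtain b where "b \<in> V d" "E b0 b" "\<And>x. x \<in> X \<Longrightarrow> E b x \<longleftrightarrow> x \<in> W"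
  proof (cases "nontriv c")
    case True
    then show ?thesis using large_vs_nontrivial [OF cd True par [OF True] big b0 X] that by metis
  next
    case False
    then show ?thesis using large_vs_independent [OF cd False big b0 X(1,2)] that by metis
  qed
  then show "\<exists>b \<in> Cl b0. \<forall>x \<in> X. E b x \<longleftrightarrow> x \<in> W"
    using same_E b0 unfolding Cl_def by blast
qed

text \<open>\<open>split\<close> demands a neighbour and a nonneighbour of \<open>x\<close> in the
  clique of \<open>b\<close>, which consists of \<open>b\<close> and \<open>b'\<close> only.\<close>

lemma paired:
  assumes cd: "c \<noteq> d" and nb: "\<not> big d" and b: "b \<in> V d" "b' \<in> V d" "E b b'" and x: "x \<in> V c"
  shows "E b x \<longleftrightarrow> \<not> E b' x"
proof -
  have "nontriv d" using b by (auto simp: nontriv_def V_iff)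
  then obtain y y' where y: "same b y" "same b y'" "E x y" "\<not> E x y'" "y \<in> V d" "y' \<in> V d"
    using split [OF cd [symmetric] _ x b(1)] by metis
  have "z = b \<or> z = b'" if "same b z" "z \<in> V d" for z
    using that not_big_unique [OF nb b(1,2)] b(3) same_imp_E by blast
  then have "y = b \<and> y' = b' \<or> y = b' \<and> y' = b" using y by blast
  then show ?thesis using y E_commute [of x] by blast
qed

text \<open>Fix any \<open>b\<close> and find a copy of \<open>X\<close> on which it already follows
  \<open>W\<close>: inside the clique of each \<open>x\<close> if colour \<open>c\<close> has edges,
  otherwise among the infinitely many neighbours and nonneighbours of \<open>b\<close>. Moving the
  copy to \<open>X\<close> moves \<open>b\<close> to a solution.\<close>

lemma extends_paired:
  assumes cd: "c \<noteq> d" and nt: "nontriv d" and nb: "\<not> big d" "\<not> big c"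
  shows "extends c (V d)"
proof (rule extendsI)
  show "infinite (Cl ` V c)" using infinite_cliques [OF cd] nt nb by blast
next
  fix X W assume X: "finite X" "X \<subseteq> V c" "\<And>x y. x \<in> X \<Longrightarrow> y \<in> X \<Longrightarrow> \<not> E x y"
  obtain b where b: "b \<in> V d" using two_cliques by blast
  have "\<exists>k. inj_on k X \<and> (\<forall>x \<in> X. k x \<in> V c \<and> (E b (k x) \<longleftrightarrow> x \<in> W)) \<and>
      (\<forall>x \<in> X. \<forall>x' \<in> X. \<not> E (k x) (k x'))"
  proof (cases "nontriv c")
    case True
    have "\<exists>z. same x z \<and> z \<in> V c \<and> (E b z \<longleftrightarrow> x \<in> W)" if "x \<in> X" for x
    proof -
      have "x \<in> V c" using X(2) \<open>x \<in> X\<close> by blast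
      then obtain y y' where "same x y" "same x y'" "E b y" "\<not> E b y'" "y \<in> V c" "y' \<in> V c"
        by (rule split [OF cd True b])
      then show ?thesis by (cases "x \<in> W") blast+
    qed
    then obtain k where k: "\<And>x. x \<in> X \<Longrightarrow> same x (k x) \<and> k x \<in> V c \<and> (E b (k x) \<longleftrightarrow> x \<in> W)" by metis
    have ks: "x = x'" if "x \<in> X" "x' \<in> X" "same (k x) (k x')" for x x'
    proof -
      have "same x x'" using that k same_sym same_trans by meson
      then show ?thesis using X(3) that same_imp_E by blast
    qed
    have "inj_on k X" using ks k same_refl by (metis inj_onI)
    moreover have "\<not> E (k x) (k x')" if "x \<in> X" "x' \<in> X" for x x'
      using that ks k same_E E_irrefl by metis
    ultimately show ?thesis using k by blast
  next
    case False
    have "infinite {x \<in> V c. E b x = t}" for t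
      using infinite_N [OF cd False nt b] infinite_M [OF cd False nt b]
      by (cases t) (simp_all add: N_def M_def)
    then obtain k where k: "inj_on k X" "\<And>x. x \<in> X \<Longrightarrow> k x \<in> {y \<in> V c. E b y = (x \<in> W)}"
      by (rule_tac inj_on_into_disjoint [OF X(1), of "\<lambda>t. {x \<in> V c. E b x = t}" "\<lambda>x. x \<in> W"]) auto
    moreover have "\<not> E y y'" if "y \<in> V c" "y' \<in> V c" for y y'
      using that False unfolding nontriv_def V_iff by blast
    ultimately show ?thesis by (intro exI [of _ k]) simp
  qed
  then obtain k where k: "inj_on k X" "\<And>x. x \<in> X \<Longrightarrow> k x \<in> V c \<and> (E b (k x) \<longleftrightarrow> x \<in> W)"
    "\<And>x x'. x \<in> X \<Longrightarrow> x' \<in> X \<Longrightarrow> \<not> E (k x) (k x')" by blast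
  have "k ` X \<subseteq> V c" using k(2) by blast
  moreover have "E (k x) (k x') \<longleftrightarrow> E x x'" if "x \<in> X" "x' \<in> X" for x x' using that k(3) X(3) by blast
  ultimately obtain g where g: "is_iso g G G" "\<And>x. x \<in> X \<Longrightarrow> g (k x) = x"
    using transport0 [OF X(1,2) k(1)] by metis
  have "E (g b) x \<longleftrightarrow> x \<in> W" if "x \<in> X" for x
    using aut_V_E [OF g(1) b, of "k x" c] k(2) [OF that] g(2) [OF that] by simp
  then show "\<exists>b \<in> V d. \<forall>x \<in> X. E b x \<longleftrightarrow> x \<in> W" using aut_V [OF g(1) b] by blast
qed

end

text \<open>\<open>s = True\<close> describes \<open>T_r\<close> and \<open>T_b\<close>,
  \<open>s = False\<close> describes \<open>Tt_r\<close> and \<open>Tt_b\<close>; the parameter lets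
  one argument treat a graph and its complement.\<close>

definition tri :: "'a cgraph \<Rightarrow> color \<Rightarrow> bool \<Rightarrow> bool" where
  "tri G c s \<longleftrightarrow> (\<exists>x \<in> color_class G c. \<exists>y \<in> color_class G c. \<exists>z \<in> verts G.
     col G z \<noteq> c \<and> adj G x y \<and> adj G z x = s \<and> adj G z y = s)"

text \<open>Three cross pairs have value \<open>s\<close> and the fourth the opposite value:
  \<open>D\<close> for \<open>s = True\<close>, \<open>Dt\<close> for
  \<open>s = False\<close>.\<close>

definition quad :: "'a cgraph \<Rightarrow> bool \<Rightarrow> bool" where
  "quad G s \<longleftrightarrow> (\<exists>x \<in> color_class G Red. \<exists>x' \<in> color_class G Red.
     \<exists>y \<in> color_class G Blue. \<exists>y' \<in> color_class G Blue. adj G x x' \<and> adj G y y' \<and>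
     adj G x y = s \<and> adj G x y' = s \<and> adj G x' y = s \<and> adj G x' y' = (\<not> s))"

context basic_graph
begin

section \<open>Embedding finite graphs\<close>

lemma extendsD:
  "extends c B \<Longrightarrow> finite X \<Longrightarrow> X \<subseteq> V c \<Longrightarrow> (\<And>x y. x \<in> X \<Longrightarrow> y \<in> X \<Longrightarrow> \<not> E x y) \<Longrightarrow>
    infinite {b \<in> B. \<forall>x \<in> X. E b x \<longleftrightarrow> x \<in> W}"
  unfolding extends_def by simp

lemma choose_in_cliques:
  assumes ext: "\<forall>y \<in> Y. extends c (Cl (f y))" and "finite Y" "finite Z"
    and J: "finite J" "inj_on k J" "k ` J \<subseteq> V c" "\<forall>x \<in> J. \<forall>x' \<in> J. \<not> E (k x) (k x')"
  shows "\<exists>g. inj_on g Y \<and> (\<forall>y \<in> Y. same (f y) (g y) \<and> g y \<notin> Z \<and>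
    (\<forall>x \<in> J. E (g y) (k x) \<longleftrightarrow> P y x))"
proof -
  define A where "A y = {b \<in> Cl (f y). \<forall>x \<in> k ` J. E b x \<longleftrightarrow> x \<in> k ` {x \<in> J. P y x}}" for y
  have "infinite (A y)" if "y \<in> Y" for y
    unfolding A_def by (rule extendsD) (use ext that J(1,3,4) in auto)
  then obtain g where g: "\<And>y. y \<in> Y \<Longrightarrow> g y \<in> A y - Z"
    "\<And>y y'. y \<in> Y \<Longrightarrow> y' \<in> Y \<Longrightarrow> y \<noteq> y' \<Longrightarrow> g y' \<notin> {g y}"
    using choose_from_infinite_sets [OF assms(2) _ assms(3), of A "\<lambda>a. {a}"] by blast
  have "E (g y) (k x) \<longleftrightarrow> P y x" if "y \<in> Y" "x \<in> J" for y x
  proof -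
    have "E (g y) (k x) \<longleftrightarrow> k x \<in> k ` {x \<in> J. P y x}" using g(1) that by (auto simp: A_def)
    also have "\<dots> \<longleftrightarrow> P y x" using that J(2) by (auto simp: inj_on_def)
    finally show ?thesis .
  qed
  moreover have "inj_on g Y" using g(2) by (metis inj_onI singletonI)
  ultimately show ?thesis using g(1) by (intro exI [of _ g]) (auto simp: A_def Cl_def)
qed

text \<open>Adjacency of distinct vertices of one colour depends only on their cliques, so images
  may be changed inside their cliques as long as they stay distinct.\<close>

lemma move_in_cliques:
  assumes H: "two_colored_graph H" and f: "inj_on f Y" "f ` Y \<subseteq> V c"
    "\<forall>y \<in> Y. \<forall>y' \<in> Y. E (f y) (f y') \<longleftrightarrow> adj H y y'"
    and g: "inj_on g Y" "\<forall>y \<in> Y. same (f y) (g y)"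
  shows "g ` Y \<subseteq> V c" "\<And>y y'. y \<in> Y \<Longrightarrow> y' \<in> Y \<Longrightarrow> E (g y) (g y') \<longleftrightarrow> adj H y y'"
proof -
  show gV: "g ` Y \<subseteq> V c" using g(2) f(2) same_V by blast
  fix y y' assume y: "y \<in> Y" "y' \<in> Y"
  show "E (g y) (g y') \<longleftrightarrow> adj H y y'"
  proof (cases "y = y'")
    case True
    then show ?thesis using H E_irrefl by (auto simp: two_colored_graph_def)
  next
    case False
    then have ne: "f y \<noteq> f y'" "g y \<noteq> g y'" using y f(1) g(1) by (auto simp: inj_on_def)
    have V: "f y \<in> V c" "f y' \<in> V c" "g y \<in> V c" "g y' \<in> V c" using y f(2) gV by auto
    have "E (g y) (g y') \<longleftrightarrow> same (g y) (g y')" using ne V same_E same_imp_E by blast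
    also have "\<dots> \<longleftrightarrow> same (f y) (f y')" using g(2) y same_sym same_trans by meson
    also have "\<dots> \<longleftrightarrow> E (f y) (f y')" using ne V same_E same_imp_E by blast
    finally show ?thesis using f(3) y by blast
  qed
qed

lemma realized_by_parts:
  assumes H: "two_colored_graph H" and cd: "c \<noteq> d"
    and f: "inj_on f (color_class H c)" "f ` color_class H c \<subseteq> V c"
    "\<And>x x'. x \<in> color_class H c \<Longrightarrow> x' \<in> color_class H c \<Longrightarrow> E (f x) (f x') \<longleftrightarrow> adj H x x'"
    and g: "inj_on g (color_class H d)" "g ` color_class H d \<subseteq> V d"
    "\<And>y y'. y \<in> color_class H d \<Longrightarrow> y' \<in> color_class H d \<Longrightarrow> E (g y) (g y') \<longleftrightarrow> adj H y y'"
    and cross: "\<And>y x. y \<in> color_class H d \<Longrightarrow> x \<in> color_class H c \<Longrightarrow> E (g y) (f x) \<longleftrightarrow> adj H y x"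
  shows "realized G H"
proof -
  define h where "h x = (if col H x = c then f x else g x)" for x
  have dcol: "col H x = d" if "col H x \<noteq> c" for x using that cd by (cases c; cases d; cases "col H x") auto
  have part: "x \<in> color_class H c \<and> h x = f x \<and> f x \<in> V c \<or> x \<in> color_class H d \<and> h x = g x \<and> g x \<in> V d"
    if "x \<in> verts H" for x
    using that dcol f(2) g(2) by (auto simp: h_def color_class_def)
  have cross': "E (f x) (g y) \<longleftrightarrow> adj H x y" if "y \<in> color_class H d" "x \<in> color_class H c" for x y
    using cross [OF that] E_commute [of "f x" "g y"] H by (auto simp: two_colored_graph_def)
  have "embedding h H G"
    unfolding embedding_def
  proof (intro conjI ballI)
    show "inj_on h (verts H)"
    proof (rule inj_onI)
      fix x y assume xy: "x \<in> verts H" "y \<in> verts H" "h x = h y"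
      have "V c \<inter> V d = {}" using cd by (auto simp: V_iff)
      then consider "x \<in> color_class H c" "y \<in> color_class H c" "f x = f y"
        | "x \<in> color_class H d" "y \<in> color_class H d" "g x = g y"
        using part [OF xy(1)] part [OF xy(2)] xy(3) by (metis IntI empty_iff)
      then show "x = y" using inj_onD [OF f(1)] inj_onD [OF g(1)] by cases blast+
    qed
    fix x assume x: "x \<in> verts H"
    show "h x \<in> verts G" using part [OF x] by (auto simp: V_iff)
    show "col G (h x) = col H x" using part [OF x] by (auto simp: V_iff color_class_def)
    fix y assume y: "y \<in> verts H"
    show "E (h x) (h y) \<longleftrightarrow> adj H x y"
      using part [OF x] part [OF y] f(3) g(3) cross cross' by auto
  qed
  then show ?thesis using realized_iff_embedding by blast
qed

lemma finite_Cl_all: "\<not> big c \<Longrightarrow> \<not> big d \<Longrightarrow> c \<noteq> d \<Longrightarrow> finite (Cl a)"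
proof (cases "a \<in> verts G")
  case True
  assume "\<not> big c" "\<not> big d" "c \<noteq> d"
  then show ?thesis using finite_Cl [of "col G a" a] True color_other [of c d a] by (auto simp: V_iff)
next
  case False
  then have "Cl a = {}" by (auto simp: Cl_def same_def)
  then show ?thesis by simp
qed

section \<open>Joining embeddings of the two colour classes into one embedding\<close>

context
  fixes H :: "'b cgraph" and c d :: color and fc fd :: "'b \<Rightarrow> 'a"
  assumes H: "two_colored_graph H" "finite (verts H)" and cd: "c \<noteq> d"
    and fc: "inj_on fc (color_class H c)" "fc ` color_class H c \<subseteq> V c"
      "\<And>x x'. x \<in> color_class H c \<Longrightarrow> x' \<in> color_class H c \<Longrightarrow> E (fc x) (fc x') \<longleftrightarrow> adj H x x'"
    and fd: "inj_on fd (color_class H d)" "fd ` color_class H d \<subseteq> V d"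
      "\<And>y y'. y \<in> color_class H d \<Longrightarrow> y' \<in> color_class H d \<Longrightarrow> E (fd y) (fd y') \<longleftrightarrow> adj H y y'"
begin

lemma fc_ball: "\<forall>x \<in> color_class H c. \<forall>x' \<in> color_class H c. E (fc x) (fc x') \<longleftrightarrow> adj H x x'"
  and fd_ball: "\<forall>y \<in> color_class H d. \<forall>y' \<in> color_class H d. E (fd y) (fd y') \<longleftrightarrow> adj H y y'"
  using fc(3) fd(3) by blast+

lemma finH: "finite (color_class H e)"
  using H(2) by (simp add: color_class_def)

lemma H_sym: "adj H x y \<Longrightarrow> adj H y x" and H_irrefl: "\<not> adj H x x"
  using H(1) by (auto simp: two_colored_graph_def)

text \<open>Keep \<open>fc\<close>, and move the images of colour \<open>d\<close> inside their
  large cliques until they are correct over the representatives \<open>I\<close>. The other vertex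
  of a two-clique is then correct too, because adjacency is reversed along its edge in
  \<open>G\<close> (by \<open>paired\<close>) and in \<open>H\<close> (by
  \<open>Hp\<close>).\<close>

lemma realized_large_small:
  assumes big: "big d" and nb: "\<not> big c" and par: "nontriv c \<Longrightarrow> parity c d"
    and Hp: "\<And>x x' y. x \<in> color_class H c \<Longrightarrow> x' \<in> color_class H c \<Longrightarrow> y \<in> color_class H d \<Longrightarrow>
      adj H x x' \<Longrightarrow> adj H y x \<longleftrightarrow> \<not> adj H y x'"
  shows "realized G H"
proof -
  obtain I where I: "I \<subseteq> color_class H c" "\<And>x y. x \<in> I \<Longrightarrow> y \<in> I \<Longrightarrow> \<not> adj H x y"
    "\<And>x. x \<in> color_class H c \<Longrightarrow> x \<notin> I \<Longrightarrow> \<exists>u \<in> I. adj H u x"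
    using maximal_independent_subset [OF finH, of "adj H"] H_sym H_irrefl by metis
  have Ifin: "finite I" "inj_on fc I" "fc ` I \<subseteq> V c" "\<forall>x \<in> I. \<forall>x' \<in> I. \<not> E (fc x) (fc x')"
  proof -
    show "finite I" using I(1) finH finite_subset by blast
    show "inj_on fc I" using inj_on_subset [OF fc(1) I(1)] .
    show "fc ` I \<subseteq> V c" using I(1) fc(2) by blast
    show "\<forall>x \<in> I. \<forall>x' \<in> I. \<not> E (fc x) (fc x')" using I(1,2) fc(3) by (metis subsetD)
  qed
  have ext: "\<forall>y \<in> color_class H d. extends c (Cl (fd y))"
    using extends_large_clique [OF cd big par] fd(2) by blast
  obtain g where g: "inj_on g (color_class H d)" "\<forall>y \<in> color_class H d. same (fd y) (g y)"
    "\<And>y x. y \<in> color_class H d \<Longrightarrow> x \<in> I \<Longrightarrow> E (g y) (fc x) \<longleftrightarrow> adj H y x"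
    using choose_in_cliques [where P = "adj H", OF ext finH finite.emptyI Ifin] by blast
  note g' = move_in_cliques [OF H(1) fd(1,2) fd_ball g(1,2)]
  show ?thesis
  proof (rule realized_by_parts [OF H(1) cd fc g(1) g'])
    fix y x assume yx: "y \<in> color_class H d" "x \<in> color_class H c"
    show "E (g y) (fc x) \<longleftrightarrow> adj H y x"
    proof (cases "x \<in> I")
      case True
      then show ?thesis using g(3) yx by blast
    next
      case False
      then obtain u where u: "u \<in> I" "adj H u x" using I(3) yx by blast
      then have uc: "u \<in> color_class H c" using I(1) by blast
      have V: "fc u \<in> V c" "fc x \<in> V c" "g y \<in> V d" using uc yx fc(2) g'(1) by auto
      have "E (fc u) (g y) \<longleftrightarrow> \<not> E (fc x) (g y)"
        using paired [OF cd [symmetric] nb V(1,2) _ V(3)] fc(3) [OF uc yx(2)] u by blast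
      then show ?thesis
        using g(3) [OF yx(1) u(1)] Hp [OF uc yx(2,1) u(2)] E_commute by blast
    qed
  qed
qed

text \<open>Two rounds: move the images of colour \<open>d\<close> to be correct over
  \<open>I\<close>, then move the images of the remaining vertices of colour \<open>c\<close> to be
  correct over the representatives \<open>J\<close>. A pair outside both sets is determined by
  parity from three correct pairs.\<close>

lemma realized_large_large:
  assumes big: "big c" "big d" and par: "parity c d"
    and Hp: "\<And>x x' y y'. x \<in> color_class H c \<Longrightarrow> x' \<in> color_class H c \<Longrightarrow>
      y \<in> color_class H d \<Longrightarrow> y' \<in> color_class H d \<Longrightarrow> adj H x x' \<Longrightarrow> adj H y y' \<Longrightarrow>
      (adj H y x \<longleftrightarrow> adj H y x') \<longleftrightarrow> (adj H y' x \<longleftrightarrow> adj H y' x')"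
  shows "realized G H"
proof -
  obtain I where I: "I \<subseteq> color_class H c" "\<And>x y. x \<in> I \<Longrightarrow> y \<in> I \<Longrightarrow> \<not> adj H x y"
    "\<And>x. x \<in> color_class H c \<Longrightarrow> x \<notin> I \<Longrightarrow> \<exists>u \<in> I. adj H u x"
    using maximal_independent_subset [OF finH, of "adj H"] H_sym H_irrefl by metis
  obtain J where J: "J \<subseteq> color_class H d" "\<And>x y. x \<in> J \<Longrightarrow> y \<in> J \<Longrightarrow> \<not> adj H x y"
    "\<And>x. x \<in> color_class H d \<Longrightarrow> x \<notin> J \<Longrightarrow> \<exists>u \<in> J. adj H u x"
    using maximal_independent_subset [OF finH, of "adj H"] H_sym H_irrefl by metis
  have Ifin: "finite I" "inj_on fc I" "fc ` I \<subseteq> V c" "\<forall>x \<in> I. \<forall>x' \<in> I. \<not> E (fc x) (fc x')"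
  proof -
    show "finite I" using I(1) finH finite_subset by blast
    show "inj_on fc I" using inj_on_subset [OF fc(1) I(1)] .
    show "fc ` I \<subseteq> V c" using I(1) fc(2) by blast
    show "\<forall>x \<in> I. \<forall>x' \<in> I. \<not> E (fc x) (fc x')" using I(1,2) fc(3) by (metis subsetD)
  qed
  have ext: "\<forall>y \<in> color_class H d. extends c (Cl (fd y))"
    using extends_large_clique [OF cd big(2) par] fd(2) by blast
  obtain g where g: "inj_on g (color_class H d)" "\<forall>y \<in> color_class H d. same (fd y) (g y)"
    "\<And>y x. y \<in> color_class H d \<Longrightarrow> x \<in> I \<Longrightarrow> E (g y) (fc x) \<longleftrightarrow> adj H y x"
    using choose_in_cliques [where P = "adj H", OF ext finH finite.emptyI Ifin] by blast
  note g' = move_in_cliques [OF H(1) fd(1,2) fd_ball g(1,2)]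
  have Jfin: "finite J" "inj_on g J" "g ` J \<subseteq> V d" "\<forall>x \<in> J. \<forall>x' \<in> J. \<not> E (g x) (g x')"
  proof -
    show "finite J" using J(1) finH finite_subset by blast
    show "inj_on g J" using inj_on_subset [OF g(1) J(1)] .
    show "g ` J \<subseteq> V d" using J(1) g'(1) by blast
    show "\<forall>x \<in> J. \<forall>x' \<in> J. \<not> E (g x) (g x')" using J(1,2) g'(2) by (metis subsetD)
  qed
  define Y where "Y = color_class H c - I"
  have Y: "finite Y" "finite (fc ` I)" using finH Ifin by (auto simp: Y_def)
  have ext': "\<forall>x \<in> Y. extends d (Cl (fc x))"
    using extends_large_clique [OF cd [symmetric] big(1) parity_sym [OF par]] fc(2) by (auto simp: Y_def)
  \<comment> \<open>The images of \<open>I\<close> stay fixed, so the new ones must avoid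
    them.\<close>
  obtain h where h: "inj_on h Y" "\<And>x. x \<in> Y \<Longrightarrow> same (fc x) (h x)" "\<And>x. x \<in> Y \<Longrightarrow> h x \<notin> fc ` I"
    "\<And>x y. x \<in> Y \<Longrightarrow> y \<in> J \<Longrightarrow> E (h x) (g y) \<longleftrightarrow> adj H x y"
    using choose_in_cliques [where P = "adj H", OF ext' Y Jfin] by metis
  define k where "k x = (if x \<in> I then fc x else h x)" for x
  have k1: "inj_on k (color_class H c)"
  proof (rule inj_onI)
    fix x x' assume x: "x \<in> color_class H c" "x' \<in> color_class H c" "k x = k x'"
    have nI: "h z \<notin> fc ` I" "z \<in> Y" if "z \<in> color_class H c" "z \<notin> I" for z
      using h(3) [of z] that by (auto simp: Y_def)
    consider "x \<in> I" "x' \<in> I" "fc x = fc x'" | "x \<in> Y" "x' \<in> Y" "h x = h x'"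
      using x nI [OF x(1)] nI [OF x(2)] unfolding k_def by (metis imageI)
    then show "x = x'" using inj_onD [OF h(1)] inj_onD [OF Ifin(2)] by cases blast+
  qed
  have "same (fc x) (k x)" if "x \<in> color_class H c" for x
    using that h(2) [of x] fc(2) same_refl by (auto simp: k_def Y_def)
  then have k2: "\<forall>x \<in> color_class H c. same (fc x) (k x)" by blast
  note k' = move_in_cliques [OF H(1) fc(1,2) fc_ball k1 k2]
  have kI: "E (g y) (k x) \<longleftrightarrow> adj H y x" if "x \<in> I" "y \<in> color_class H d" for x y
    using that g(3) by (simp add: k_def)
  have kJ: "E (g y) (k x) \<longleftrightarrow> adj H y x" if "x \<in> color_class H c" "y \<in> J" for x y
  proof (cases "x \<in> I")
    case True
    then show ?thesis using kI that J(1) by blast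
  next
    case False
    then have "x \<in> Y" "k x = h x" using that by (auto simp: Y_def k_def)
    then show ?thesis using h(4) [OF _ that(2)] E_commute H_sym by metis
  qed
  show ?thesis
  proof (rule realized_by_parts [OF H(1) cd k1 k' g(1) g'])
    fix y x assume yx: "y \<in> color_class H d" "x \<in> color_class H c"
    show "E (g y) (k x) \<longleftrightarrow> adj H y x"
    proof (cases "x \<in> I \<or> y \<in> J")
      case True
      then show ?thesis using kI kJ yx by blast
    next
      case False
      then obtain u v where u: "u \<in> I" "adj H u x" and v: "v \<in> J" "adj H v y"
        using I(3) J(3) yx by blast
      then have uc: "u \<in> color_class H c" and vd: "v \<in> color_class H d" using I(1) J(1) by blast+
      have V: "k u \<in> V c" "k x \<in> V c" "g v \<in> V d" "g y \<in> V d" using uc vd yx k'(1) g'(1) by auto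
      have "E (k u) (k x)" "E (g v) (g y)" using k'(2) [OF uc yx(2)] g'(2) [OF vd yx(1)] u v by blast+
      then have "(E (g v) (k u) \<longleftrightarrow> E (g y) (k u)) \<longleftrightarrow> (E (g v) (k x) \<longleftrightarrow> E (g y) (k x))"
        using parity_sym [OF par] V unfolding parity_def by blast
      moreover have "(adj H v u \<longleftrightarrow> adj H v x) \<longleftrightarrow> (adj H y u \<longleftrightarrow> adj H y x)"
        using Hp [OF uc yx(2) vd yx(1) u(2) v(2)] .
      ultimately show ?thesis
        using kI [OF u(1) vd] kI [OF u(1) yx(1)] kJ [OF yx(2) v(1)] by blast
    qed
  qed
qed

text \<open>There is no freedom inside cliques, so \<open>fd\<close> serves only to show the shape
  of the class. The representatives \<open>J\<close> get new images, correct over \<open>I\<close>,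
  and every other vertex of colour \<open>d\<close> goes to the partner of its representative's
  image. The remaining pairs follow by reversal along two-cliques.\<close>

lemma realized_small_small:
  assumes nt: "nontriv d" and nb: "\<not> big c" "\<not> big d"
    and Hc: "\<And>x x' y. x \<in> color_class H c \<Longrightarrow> x' \<in> color_class H c \<Longrightarrow> y \<in> color_class H d \<Longrightarrow>
      adj H x x' \<Longrightarrow> adj H y x \<longleftrightarrow> \<not> adj H y x'"
    and Hd: "\<And>y y' x. y \<in> color_class H d \<Longrightarrow> y' \<in> color_class H d \<Longrightarrow> x \<in> color_class H c \<Longrightarrow>
      adj H y y' \<Longrightarrow> adj H x y \<longleftrightarrow> \<not> adj H x y'"
  shows "realized G H"
proof -
  obtain I where I: "I \<subseteq> color_class H c" "\<And>x y. x \<in> I \<Longrightarrow> y \<in> I \<Longrightarrow> \<not> adj H x y"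
    "\<And>x. x \<in> color_class H c \<Longrightarrow> x \<notin> I \<Longrightarrow> \<exists>u \<in> I. adj H u x"
    using maximal_independent_subset [OF finH, of "adj H"] H_sym H_irrefl by metis
  obtain J where J: "J \<subseteq> color_class H d" "\<And>x y. x \<in> J \<Longrightarrow> y \<in> J \<Longrightarrow> \<not> adj H x y"
    "\<And>x. x \<in> color_class H d \<Longrightarrow> x \<notin> J \<Longrightarrow> \<exists>u \<in> J. adj H u x"
    using maximal_independent_subset [OF finH, of "adj H"] H_sym H_irrefl by metis
  have Ifin: "finite I" "inj_on fc I" "fc ` I \<subseteq> V c" "\<forall>x \<in> I. \<forall>x' \<in> I. \<not> E (fc x) (fc x')"
  proof -
    show "finite I" using I(1) finH finite_subset by blast
    show "inj_on fc I" using inj_on_subset [OF fc(1) I(1)] .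
    show "fc ` I \<subseteq> V c" using I(1) fc(2) by blast
    show "\<forall>x \<in> I. \<forall>x' \<in> I. \<not> E (fc x) (fc x')" using I(1,2) fc(3) by (metis subsetD)
  qed
  have Jfin: "finite J" using J(1) finH finite_subset by blast
  define A where "A y = {b \<in> V d. \<forall>x \<in> fc ` I. E b x \<longleftrightarrow> x \<in> fc ` {x \<in> I. adj H y x}}" for y
  have "infinite (A y)" for y
    unfolding A_def by (rule extendsD [OF extends_paired [OF cd nt nb(2,1)]]) (use Ifin(1,3,4) in auto)
  moreover have "b \<in> Cl a \<longleftrightarrow> a \<in> Cl b" for a b using same_sym by (auto simp: Cl_def)
  \<comment> \<open>Cliques as conflict sets force the images of \<open>J\<close> into distinct
    cliques; they are finite because neither colour is big.\<close>
  ultimately obtain g where g: "\<And>y. y \<in> J \<Longrightarrow> g y \<in> A y - {}"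
    "\<And>y y'. y \<in> J \<Longrightarrow> y' \<in> J \<Longrightarrow> y \<noteq> y' \<Longrightarrow> g y' \<notin> Cl (g y)"
    using choose_from_infinite_sets [OF Jfin _ finite.emptyI, of A Cl] finite_Cl_all [OF nb cd] by blast
  have gV: "g y \<in> V d" if "y \<in> J" for y using g(1) [OF that] by (simp add: A_def)
  have gI: "E (g y) (fc x) \<longleftrightarrow> adj H y x" if "y \<in> J" "x \<in> I" for y x
  proof -
    have "E (g y) (fc x) \<longleftrightarrow> fc x \<in> fc ` {x \<in> I. adj H y x}" using g(1) [OF that(1)] that by (auto simp: A_def)
    also have "\<dots> \<longleftrightarrow> adj H y x" using that Ifin(2) by (auto simp: inj_on_def)
    finally show ?thesis .
  qed
  have "\<exists>u z. u \<in> J \<and> z \<in> V d \<and> (y \<in> J \<and> u = y \<and> z = g y \<or> y \<notin> J \<and> adj H u y \<and> E (g u) z)"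
    if y: "y \<in> color_class H d" for y
  proof (cases "y \<in> J")
    case True
    then show ?thesis using gV by blast
  next
    case False
    then obtain u where u: "u \<in> J" "adj H u y" using J(3) y by blast
    obtain z where "z \<in> V d" "E (g u) z" using nontriv_nbr [OF nt gV [OF u(1)]] .
    then show ?thesis using u False by blast
  qed
  \<comment> \<open>\<open>r y\<close> is the representative of \<open>y\<close>, and
    \<open>h y\<close> its new image: \<open>g y\<close> on \<open>J\<close>, the partner of
    \<open>g (r y)\<close> elsewhere.\<close>
  then obtain r h where r: "\<And>y. y \<in> color_class H d \<Longrightarrow> r y \<in> J \<and> h y \<in> V d \<and>
      (y \<in> J \<and> r y = y \<and> h y = g y \<or> y \<notin> J \<and> adj H (r y) y \<and> E (g (r y)) (h y))" by metis
  have rJ: "r y \<in> J" and hV: "h y \<in> V d" and rd: "r y \<in> color_class H d" if "y \<in> color_class H d" for y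
    using r [OF that] J(1) by blast+
  have hs: "same (g (r y)) (h y)" if "y \<in> color_class H d" for y
    using r [OF that] gV same_E same_refl by metis
  have fs: "same (fd (r y)) (fd y)" if "y \<in> color_class H d" for y
  proof -
    have "fd (r y) \<in> V d" "fd y \<in> V d" using that rd fd(2) by auto
    moreover have "r y = y \<or> E (fd (r y)) (fd y)" using r [OF that] fd(3) [OF rd [OF that] that] by blast
    ultimately show ?thesis using same_E same_refl by metis
  qed
  have req: "r y = r y'" if "y \<in> color_class H d" "y' \<in> color_class H d"
    "same (h y) (h y') \<or> same (fd y) (fd y')" for y y'
    using that(3)
  proof
    assume "same (h y) (h y')"
    then have "same (g (r y)) (g (r y'))" using hs that same_sym same_trans by meson
    then show ?thesis using g(2) rJ that by (metis Cl_def mem_Collect_eq)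
  next
    assume "same (fd y) (fd y')"
    then have s: "same (fd (r y)) (fd (r y'))" using fs that same_sym same_trans by meson
    have "\<not> E (fd (r y)) (fd (r y'))"
      using J(2) [of "r y" "r y'"] rJ that(1,2) fd(3) [OF rd [OF that(1)] rd [OF that(2)]] by blast
    then have "fd (r y) = fd (r y')" using s same_imp_E by blast
    then show ?thesis using fd(1) rd that by (metis inj_onD)
  qed
  have two: "y = y'" if y: "y \<in> color_class H d" "y' \<in> color_class H d" "r y = r y'" "y \<in> J \<longleftrightarrow> y' \<in> J" for y y'
  proof (cases "y \<in> J")
    case True
    then show ?thesis using r [OF y(1)] r [OF y(2)] y by simp
  next
    case False
    have V: "fd (r y) \<in> V d" "fd y \<in> V d" "fd y' \<in> V d" using y rd fd(2) by auto
    have "E (fd (r y)) (fd y)" "E (fd (r y)) (fd y')"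
      using False r [OF y(1)] r [OF y(2)] y fd(3) rd by metis+
    then have "fd y = fd y'" using not_big_unique [OF nb(2) V] by blast
    then show ?thesis using fd(1) y by (metis inj_onD)
  qed
  have h1: "inj_on h (color_class H d)"
  proof (rule inj_onI)
    fix y y' assume y: "y \<in> color_class H d" "y' \<in> color_class H d" "h y = h y'"
    then have req': "r y = r y'" using req [of y y'] same_refl hV by metis
    have "y \<in> J \<longleftrightarrow> y' \<in> J" using r [OF y(1)] r [OF y(2)] req' y(3) E_irrefl by metis
    then show "y = y'" using two y req' by blast
  qed
  have h2: "E (h y) (h y') \<longleftrightarrow> adj H y y'" if y: "y \<in> color_class H d" "y' \<in> color_class H d" for y y'
  proof (cases "y = y'")
    case True
    then show ?thesis using H_irrefl E_irrefl by simp
  next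
    case False
    then have ne: "h y \<noteq> h y'" "fd y \<noteq> fd y'" using y h1 fd(1) by (auto simp: inj_on_def)
    have V: "h y \<in> V d" "h y' \<in> V d" "fd y \<in> V d" "fd y' \<in> V d" using y hV fd(2) by auto
    have "E (h y) (h y') \<longleftrightarrow> same (h y) (h y')" using ne V same_E same_imp_E by blast
    also have "\<dots> \<longleftrightarrow> r y = r y'" using req [OF y] hs y same_sym same_trans by metis
    also have "\<dots> \<longleftrightarrow> same (fd y) (fd y')" using req [OF y] fs y same_sym same_trans by metis
    also have "\<dots> \<longleftrightarrow> E (fd y) (fd y')" using ne V same_E same_imp_E by blast
    finally show ?thesis using fd(3) y by blast
  qed
  have h3: "h ` color_class H d \<subseteq> V d" using hV by blast
  have hI: "E (h y) (fc x) \<longleftrightarrow> adj H y x" if "y \<in> color_class H d" "x \<in> I" for y x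
  proof (cases "y \<in> J")
    case True
    then show ?thesis using r [OF that(1)] gI that by metis
  next
    case False
    then have u: "r y \<in> J" "adj H (r y) y" "E (g (r y)) (h y)" using r [OF that(1)] by blast+
    have xc: "x \<in> color_class H c" using that I(1) by blast
    then have "fc x \<in> V c" using fc(2) by blast
    then have "E (g (r y)) (fc x) \<longleftrightarrow> \<not> E (h y) (fc x)"
      using paired [OF cd nb(2) gV [OF u(1)] hV [OF that(1)] u(3)] by blast
    moreover have "adj H x (r y) \<longleftrightarrow> \<not> adj H x y" using Hd [OF rd [OF that(1)] that(1) xc u(2)] .
    ultimately show ?thesis using gI [OF u(1) that(2)] H_sym by blast
  qed
  show ?thesis
  proof (rule realized_by_parts [OF H(1) cd fc h1 h3 h2])
    fix y x assume yx: "y \<in> color_class H d" "x \<in> color_class H c"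
    show "E (h y) (fc x) \<longleftrightarrow> adj H y x"
    proof (cases "x \<in> I")
      case True
      then show ?thesis using hI yx by blast
    next
      case False
      then obtain u where u: "u \<in> I" "adj H u x" using I(3) yx by blast
      then have uc: "u \<in> color_class H c" using I(1) by blast
      have V: "fc u \<in> V c" "fc x \<in> V c" "h y \<in> V d" using uc yx fc(2) hV by auto
      have "E (fc u) (h y) \<longleftrightarrow> \<not> E (fc x) (h y)"
        using paired [OF cd [symmetric] nb(1) V(1,2) _ V(3)] fc(3) [OF uc yx(2)] u by blast
      then show ?thesis
        using hI [OF yx(1) u(1)] Hc [OF uc yx(2,1) u(2)] E_commute by blast
    qed
  qed
qed

end

text \<open>In a two-clique the ends are opposite at every vertex of the other colour, which
  excludes both values of \<open>s\<close>. A large clique has infinitely many vertices of each type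
  over \<open>{z}\<close>, so in particular two. The answer being independent of \<open>s\<close> is
  the source of the invariance under complementation.\<close>

lemma tri_iff_big:
  assumes nt: "nontriv Red \<or> nontriv Blue"
    and par: "nontriv Red \<Longrightarrow> nontriv Blue \<Longrightarrow> parity Red Blue"
  shows "tri G c s \<longleftrightarrow> big c"
proof
  assume "tri G c s"
  then obtain x y z where V: "x \<in> V c" "y \<in> V c" "z \<in> verts G" "col G z \<noteq> c"
    and e: "E x y" "E z x = s" "E z y = s" unfolding tri_def by blast
  show "big c"
  proof (rule ccontr)
    assume nb: "\<not> big c"
    have "E x z \<longleftrightarrow> \<not> E y z"
      using paired [OF V(4) nb V(1,2) e(1), of z] V(3) by (simp add: V_iff)
    then show False using e E_commute by blast
  qed
next
  assume big: "big c"
  obtain d where cd: "d \<noteq> c" by (cases c) auto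
  obtain z where z: "z \<in> V d" using two_cliques by blast
  obtain b where b: "b \<in> V c" using two_cliques by blast
  have "nontriv d \<Longrightarrow> parity d c"
    using par parity_sym big_imp_nontriv [OF big] cd by (cases c; cases d) auto
  then have "extends d (Cl b)" by (rule extends_large_clique [OF cd big _ b])
  then have inf: "infinite {y \<in> Cl b. \<forall>x \<in> {z}. E y x \<longleftrightarrow> x \<in> (if s then {z} else {})}" (is "infinite ?S")
    using z E_irrefl unfolding extends_def by blast
  then obtain x where x: "x \<in> ?S" using infinite_imp_nonempty by blast
  have "infinite (?S - {x})" using inf by simp
  then obtain y where y: "y \<in> ?S" "y \<noteq> x" using infinite_imp_nonempty by blast
  have "same b x" "same b y" "E x z = s" "E y z = s"
    using x y by (auto simp: Cl_def split: if_splits)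
  note xy = this
  then have "E x y" "x \<in> V c" "y \<in> V c"
    using y(2) b same_sym same_trans same_V same_imp_E by metis+
  moreover have "z \<in> verts G" "col G z \<noteq> c" using z cd by (auto simp: V_iff)
  ultimately show "tri G c s"
    unfolding tri_def using xy(3,4) E_commute [of x z] E_commute [of y z] by blast
qed

lemma not_quad:
  assumes par: "nontriv Red \<Longrightarrow> nontriv Blue \<Longrightarrow> parity Red Blue"
  shows "\<not> quad G s"
proof
  assume "quad G s"
  then obtain x x' y y' where V: "x \<in> V Red" "x' \<in> V Red" "y \<in> V Blue" "y' \<in> V Blue"
    and e: "E x x'" "E y y'" "E x y = s" "E x y' = s" "E x' y = s" "E x' y' = (\<not> s)"
    unfolding quad_def by blast
  have "nontriv Red" "nontriv Blue" using V e by (auto simp: nontriv_def V_iff)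
  then have "parity Red Blue" by (rule par)
  then have "(E x y \<longleftrightarrow> E x' y) \<longleftrightarrow> (E x y' \<longleftrightarrow> E x' y')" using V e(1,2) unfolding parity_def by blast
  then show False using e by auto
qed

text \<open>The hypothesis on \<open>tri\<close> makes adjacency reverse along the edges of
  \<open>H\<close> in each colour that is not big, and the one on \<open>quad\<close> gives parity
  in \<open>H\<close>. The three embedding lemmas then cover all cases once the colours are named so
  that \<open>d\<close> has edges and is big whenever \<open>c\<close> is.\<close>

lemma realizedI:
  fixes H :: "'b cgraph"
  assumes nt: "nontriv Red \<or> nontriv Blue"
    and par: "nontriv Red \<Longrightarrow> nontriv Blue \<Longrightarrow> parity Red Blue"
    and H: "two_colored_graph H" "finite (verts H)"
    and mono: "\<And>c. realized G (induced H (color_class H c))"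
    and tri: "\<And>c s. tri H c s \<Longrightarrow> tri G c s" and quad: "\<And>s. quad H s \<Longrightarrow> quad G s"
  shows "realized G H"
proof -
  have "\<exists>f. embedding f (induced H (color_class H c)) G" for c
    using mono realized_iff_embedding by blast
  then obtain f where f: "\<And>c. embedding (f c) (induced H (color_class H c)) G" by metis
  have sub: "verts H \<inter> color_class H c = color_class H c" for c by (auto simp: color_class_def)
  have inj: "inj_on (f c) (color_class H c)" for c
    using f [of c] by (simp add: embedding_def sub)
  have img: "f c ` color_class H c \<subseteq> V c" for c
    using f [of c] by (auto simp: embedding_def sub V_iff) (simp add: color_class_def)
  have adj: "E (f c x) (f c x') \<longleftrightarrow> adj H x x'" if "x \<in> color_class H c" "x' \<in> color_class H c" for c x x'
    using f [of c] that by (auto simp: embedding_def sub)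
  have par': "parity c d" if "nontriv c" "c \<noteq> d" "nontriv d" for c d
    using that par parity_sym by (cases c; cases d) auto
  have Hsym: "adj H x y \<longleftrightarrow> adj H y x" for x y using H(1) by (auto simp: two_colored_graph_def)
  have Hp: "adj H y x \<longleftrightarrow> \<not> adj H y x'" if "\<not> big c" "c \<noteq> d" "x \<in> color_class H c"
    "x' \<in> color_class H c" "y \<in> color_class H d" "adj H x x'" for c d x x' y
  proof (rule ccontr)
    assume "\<not> ?thesis"
    then have "adj H y x' = adj H y x" by blast
    moreover have "y \<in> verts H" "col H y \<noteq> c" using that(2,5) by (auto simp: color_class_def)
    ultimately have "tri H c (adj H y x)" unfolding tri_def using that(3,4,6) by blast
    then show False using tri tri_iff_big [OF nt par] that(1) by blast
  qed
  have noq: "\<not> quad H s" for s using not_quad [OF par] quad by blast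
  have q: "((adj H x y \<longleftrightarrow> adj H x' y) \<longleftrightarrow> (adj H x y' \<longleftrightarrow> adj H x' y'))"
    if V: "x \<in> color_class H Red" "x' \<in> color_class H Red" "y \<in> color_class H Blue" "y' \<in> color_class H Blue"
      and e: "adj H x x'" "adj H y y'" for x x' y y'
  proof -
    have e': "adj H x' x" "adj H y' y" using e Hsym by blast+
    have Q: "\<not> (adj H u v = s \<and> adj H u v' = s \<and> adj H u' v = s \<and> adj H u' v' = (\<not> s))"
      if "u \<in> color_class H Red" "u' \<in> color_class H Red" "v \<in> color_class H Blue" "v' \<in> color_class H Blue"
        "adj H u u'" "adj H v v'" for u u' v v' s
      using noq [of s] that unfolding quad_def by blast
    \<comment> \<open>An odd pattern has one exceptional cross pair; the four orderings bring it
      into the last position.\<close>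
    show ?thesis
      using Q [OF V e, of True] Q [OF V e, of False]
        Q [OF V(1,2,4,3) e(1) e'(2), of True] Q [OF V(1,2,4,3) e(1) e'(2), of False]
        Q [OF V(2,1,3,4) e'(1) e(2), of True] Q [OF V(2,1,3,4) e'(1) e(2), of False]
        Q [OF V(2,1,4,3) e', of True] Q [OF V(2,1,4,3) e', of False]
      by auto
  qed
  have main: ?thesis if cd: "c \<noteq> d" and d: "nontriv d" "big c \<longrightarrow> big d" for c d
  proof (cases "big d")
    case bd: True
    show ?thesis
    proof (cases "big c")
      case True
      have "(adj H y x \<longleftrightarrow> adj H y x') \<longleftrightarrow> (adj H y' x \<longleftrightarrow> adj H y' x')"
        if "x \<in> color_class H c" "x' \<in> color_class H c" "y \<in> color_class H d" "y' \<in> color_class H d"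
          "adj H x x'" "adj H y y'" for x x' y y'
        using q [of x x' y y'] q [of y y' x x'] that cd Hsym by (cases c; cases d) auto
      then show ?thesis
        using realized_large_large [OF H cd inj img adj inj img adj True bd par'] cd d(1)
          big_imp_nontriv [OF True] by blast
    next
      case False
      then show ?thesis
        using realized_large_small [OF H cd inj img adj inj img adj bd False par'] cd d(1) Hp by blast
    qed
  next
    case False
    then have nb: "\<not> big c" using d(2) by blast
    show ?thesis
    proof (rule realized_small_small [OF H cd inj img adj inj img adj d(1) nb False])
      show "adj H y x \<longleftrightarrow> \<not> adj H y x'" if "x \<in> color_class H c" "x' \<in> color_class H c"
        "y \<in> color_class H d" "adj H x x'" for x x' y
        using Hp [OF nb cd that] .
      show "adj H x y \<longleftrightarrow> \<not> adj H x y'" if "y \<in> color_class H d" "y' \<in> color_class H d"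
        "x \<in> color_class H c" "adj H y y'" for y y' x
        using Hp [OF False cd [symmetric] that] .
    qed
  qed
  show ?thesis
  proof (cases "big Red \<or> nontriv Red \<and> \<not> big Blue")
    case True
    then show ?thesis using main [of Blue Red] big_imp_nontriv by auto
  next
    case False
    then show ?thesis using main [of Red Blue] nt big_imp_nontriv by auto
  qed
qed

end

section \<open>The six graphs\<close>

lemma realized_triangles:
  assumes G: "two_colored_graph G"
  shows "realized G T_r \<longleftrightarrow> tri G Red True" "realized G Tt_r \<longleftrightarrow> tri G Red False"
    "realized G T_b \<longleftrightarrow> tri G Blue True" "realized G Tt_b \<longleftrightarrow> tri G Blue False"
proof -
  have col: "col G z \<noteq> Red \<longleftrightarrow> col G z = Blue" "col G z \<noteq> Blue \<longleftrightarrow> col G z = Red" for z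
    by (cases "col G z"; simp)+
  have sym: "adj G x y \<longleftrightarrow> adj G y x" and irr: "\<not> adj G x x" for x y
    using G by (auto simp: two_colored_graph_def)
  have r: "realized G F \<longleftrightarrow> tri G Red s"
    if F: "F = mk_cgraph {0, 1} {2} (if s then {(0, 1), (0, 2), (1, 2)} else {(0, 1)})" for F s
  proof
    assume "realized G F"
    then obtain f where f: "embedding f F G" by (auto simp: realized_iff_embedding)
    show "tri G Red s"
      unfolding tri_def
      by (rule bexI [of _ "f 0"], rule bexI [of _ "f 1"], rule bexI [of _ "f 2"])
        (use f in \<open>auto simp: embedding_def F mk_cgraph_def color_class_def\<close>)
  next
    assume "tri G Red s"
    then obtain x y z where x: "x \<in> verts G" "y \<in> verts G" "z \<in> verts G" "col G x = Red" "col G y = Red"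
      "col G z = Blue" "adj G x y" "adj G z x = s" "adj G z y = s"
      unfolding tri_def col by (auto simp: color_class_def)
    have x': "adj G y x" "adj G x z = s" "adj G y z = s" "x \<noteq> y" "y \<noteq> x" "x \<noteq> z" "y \<noteq> z" "z \<noteq> x" "z \<noteq> y"
      using x sym [of x y] sym [of x z] sym [of y z] irr by auto
    have "embedding (\<lambda>n. if n = 0 then x else if n = 1 then y else z) F G"
      using x x' irr by (auto simp: embedding_def F mk_cgraph_def inj_on_def)
    then show "realized G F" by (auto simp: realized_iff_embedding)
  qed
  have b: "realized G F \<longleftrightarrow> tri G Blue s"
    if F: "F = mk_cgraph {0} {2, 3} (if s then {(2, 3), (0, 2), (0, 3)} else {(2, 3)})" for F s
  proof
    assume "realized G F"
    then obtain f where f: "embedding f F G" by (auto simp: realized_iff_embedding)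
    show "tri G Blue s"
      unfolding tri_def
      by (rule bexI [of _ "f 2"], rule bexI [of _ "f 3"], rule bexI [of _ "f 0"])
        (use f in \<open>auto simp: embedding_def F mk_cgraph_def color_class_def\<close>)
  next
    assume "tri G Blue s"
    then obtain x y z where x: "x \<in> verts G" "y \<in> verts G" "z \<in> verts G" "col G x = Blue" "col G y = Blue"
      "col G z = Red" "adj G x y" "adj G z x = s" "adj G z y = s"
      unfolding tri_def col by (auto simp: color_class_def)
    have x': "adj G y x" "adj G x z = s" "adj G y z = s" "x \<noteq> y" "y \<noteq> x" "x \<noteq> z" "y \<noteq> z" "z \<noteq> x" "z \<noteq> y"
      using x sym [of x y] sym [of x z] sym [of y z] irr by auto
    have "embedding (\<lambda>n. if n = 0 then z else if n = 2 then x else y) F G"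
      using x x' irr by (auto simp: embedding_def F mk_cgraph_def inj_on_def)
    then show "realized G F" by (auto simp: realized_iff_embedding)
  qed
  show "realized G T_r \<longleftrightarrow> tri G Red True" "realized G Tt_r \<longleftrightarrow> tri G Red False"
    using r [of T_r True] r [of Tt_r False] by (simp_all add: T_r_def Tt_r_def)
  show "realized G T_b \<longleftrightarrow> tri G Blue True" "realized G Tt_b \<longleftrightarrow> tri G Blue False"
    using b [of T_b True] b [of Tt_b False] by (simp_all add: T_b_def Tt_b_def)
qed

lemma realized_quads:
  assumes G: "two_colored_graph G"
  shows "realized G D \<longleftrightarrow> quad G True" "realized G Dt \<longleftrightarrow> quad G False"
proof -
  have sym: "adj G x y \<longleftrightarrow> adj G y x" and irr: "\<not> adj G x x" for x y
    using G by (auto simp: two_colored_graph_def)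
  have r: "realized G F \<longleftrightarrow> quad G s"
    if F: "F = mk_cgraph {0, 1} {2, 3}
      (if s then {(0, 1), (2, 3), (0, 2), (0, 3), (1, 2)} else {(0, 1), (2, 3), (1, 3)})" for F s
  proof
    assume "realized G F"
    then obtain f where f: "embedding f F G" by (auto simp: realized_iff_embedding)
    show "quad G s"
      unfolding quad_def
      by (rule bexI [of _ "f 0"], rule bexI [of _ "f 1"], rule bexI [of _ "f 2"], rule bexI [of _ "f 3"])
        (use f in \<open>auto simp: embedding_def F mk_cgraph_def color_class_def\<close>)
  next
    assume "quad G s"
    then obtain x x' y y' where x: "x \<in> verts G" "x' \<in> verts G" "y \<in> verts G" "y' \<in> verts G"
      "col G x = Red" "col G x' = Red" "col G y = Blue" "col G y' = Blue" "adj G x x'" "adj G y y'"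
      "adj G x y = s" "adj G x y' = s" "adj G x' y = s" "adj G x' y' = (\<not> s)"
      unfolding quad_def by (auto simp: color_class_def)
    have x': "adj G x' x" "adj G y' y" "adj G y x = s" "adj G y' x = s" "adj G y x' = s"
      "adj G y' x' = (\<not> s)" "x \<noteq> x'" "x' \<noteq> x" "y \<noteq> y'" "y' \<noteq> y"
      "x \<noteq> y" "x \<noteq> y'" "x' \<noteq> y" "x' \<noteq> y'" "y \<noteq> x" "y' \<noteq> x" "y \<noteq> x'" "y' \<noteq> x'"
      using x sym [of x x'] sym [of y y'] sym [of x y] sym [of x y'] sym [of x' y] sym [of x' y'] irr
      by auto
    have "embedding (\<lambda>n. if n = 0 then x else if n = 1 then x' else if n = 2 then y else y') F G"
      using x x' irr by (cases s) (auto simp: embedding_def F mk_cgraph_def inj_on_def)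
    then show "realized G F" by (auto simp: realized_iff_embedding)
  qed
  show "realized G D \<longleftrightarrow> quad G True" "realized G Dt \<longleftrightarrow> quad G False"
    using r [of D True] r [of Dt False] by (simp_all add: D_def Dt_def)
qed

section \<open>Basic CUH graphs split their cliques\<close>

lemma cliques_transitive:
  assumes "disjoint_union_of_cliques (induced G (color_class G c))" "two_colored_graph G"
    and "adj G x y" "adj G y z" "x \<noteq> z" "col G x = c" "col G y = c" "col G z = c"
  shows "adj G x z"
proof -
  let ?K = "induced G (color_class G c)"
  obtain P where P: "partition_on (verts ?K) P" and
    adj: "\<forall>x \<in> verts ?K. \<forall>y \<in> verts ?K. adj ?K x y \<longleftrightarrow> x \<noteq> y \<and> (\<exists>C \<in> P. x \<in> C \<and> y \<in> C)"
    using assms(1) unfolding disjoint_union_of_cliques_def by blast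
  have V: "x \<in> verts ?K" "y \<in> verts ?K" "z \<in> verts ?K"
    using assms(2-) by (auto simp: two_colored_graph_def color_class_def)
  have "adj ?K x y" "adj ?K y z" using V assms(3,4) by auto
  then obtain C C' where C: "C \<in> P" "x \<in> C" "y \<in> C" and C': "C' \<in> P" "y \<in> C'" "z \<in> C'"
    using adj V by meson
  have "C = C'" using C C' partition_onD2 [OF P] by (meson disjnt_iff pairwiseD)
  then have "adj ?K x z" using adj V C C' assms(5) by meson
  then show ?thesis by simp
qed

lemma alpha_ge_2:
  assumes "2 \<le> alpha G c"
  obtains x y where "x \<in> color_class G c" "y \<in> color_class G c" "x \<noteq> y" "\<not> adj G x y"
proof -
  have "\<exists>S. finite S \<and> independent_set (induced G (color_class G c)) S \<and> \<not> card S \<le> 1"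
  proof (rule ccontr)
    assume no: "\<not> ?thesis"
    have "alpha G c \<le> 1"
      unfolding alpha_def independence_number_def
    proof (rule Sup_least)
      fix e assume "e \<in> {enat (card S) |S. finite S \<and> independent_set (induced G (color_class G c)) S}"
      then obtain S where "e = enat (card S)" "finite S" "independent_set (induced G (color_class G c)) S"
        by blast
      then show "e \<le> 1" using no by (auto simp: one_enat_def)
    qed
    moreover have "\<not> (2 :: enat) \<le> 1" by (simp add: one_enat_def numeral_eq_enat)
    ultimately show False using assms order_trans by blast
  qed
  then obtain S where S: "finite S" "independent_set (induced G (color_class G c)) S" "\<not> card S \<le> Suc 0"
    by auto
  then obtain x y where xy: "x \<in> S" "y \<in> S" "x \<noteq> y" using card_le_Suc0_iff_eq [OF S(1)] by blast
  have "x \<in> color_class G c" "y \<in> color_class G c" using S(2) xy by (auto simp: independent_set_def)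
  moreover then have "\<not> adj G x y" using S(2) xy unfolding independent_set_def induced_simps by blast
  ultimately show ?thesis using that xy(3) by blast
qed

lemma bij_betw_initial_segment:
  assumes "countable Q" "i = (if finite Q then enat (card Q) else \<infinity>)"
  shows "\<exists>e. bij_betw e Q {k. enat k < i}"
proof (cases "finite Q")
  case True
  then have "{k. enat k < i} = {0..<card Q}" using assms(2) by auto
  then show ?thesis using ex_bij_betw_finite_nat [OF True] by simp
next
  case False
  then have "{k. enat k < i} = UNIV" using assms(2) by auto
  then show ?thesis using countableE_infinite [OF assms(1) False] by metis
qed

text \<open>Adjacent vertices of colour \<open>c\<close> have the same neighbours outside
  \<open>c\<close>, so contracting each clique to a representative loses only its size, which is
  constant by ultrahomogeneity.\<close>

lemma unseparated_imp_blow_up: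
  fixes G :: "'a cgraph"
  assumes G: "two_colored_graph G" "countable (verts G)" "ultrahomogeneous G"
    and trans: "\<And>x y z. adj G x y \<Longrightarrow> adj G y z \<Longrightarrow> x \<noteq> z \<Longrightarrow> col G x = c \<Longrightarrow> col G y = c \<Longrightarrow>
      col G z = c \<Longrightarrow> adj G x z"
    and xy: "adj G x y" "col G x = c" "col G y = c"
    and unsep: "\<And>u v z. adj G u v \<Longrightarrow> col G u = c \<Longrightarrow> col G v = c \<Longrightarrow> z \<in> verts G \<Longrightarrow>
      col G z \<noteq> c \<Longrightarrow> adj G z u \<Longrightarrow> adj G z v"
  shows "is_blow_up G"
proof -
  let ?V = "color_class G c"
  have sym: "adj G u v \<longleftrightarrow> adj G v u" and irr: "\<not> adj G u u"
    and ver: "adj G u v \<Longrightarrow> u \<in> verts G \<and> v \<in> verts G" for u v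
    using G(1) by (auto simp: two_colored_graph_def)
  define cl where "cl u = {v \<in> ?V. v = u \<or> adj G u v}" for u
  have V: "u \<in> ?V \<longleftrightarrow> u \<in> verts G \<and> col G u = c" for u by (simp add: color_class_def)
  have cl_self: "u \<in> cl u" if "u \<in> ?V" for u using that by (simp add: cl_def)
  have cl_V: "v \<in> ?V" if "v \<in> cl u" for u v using that by (simp add: cl_def)
  have cl_sub: "cl v \<subseteq> cl u" if "v \<in> cl u" "u \<in> ?V" for u v
    using that trans [of u v] V by (auto simp: cl_def)
  have cl_eq: "cl v = cl u" if "v \<in> cl u" "u \<in> ?V" for u v
  proof -
    have "u \<in> cl v" using that sym by (auto simp: cl_def)
    then show ?thesis using cl_sub [OF that] cl_sub [of u v] cl_V [OF that(1)] by blast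
  qed
  \<comment> \<open>The choice depends on \<open>u\<close> only through the set \<open>cl u\<close>,
    so a whole clique shares its representative.\<close>
  define rp where "rp u = (SOME v. v \<in> cl u)" for u
  have rp: "rp u \<in> cl u" if "u \<in> ?V" for u using cl_self [OF that] unfolding rp_def by (rule someI)
  have rp_V: "rp u \<in> ?V" if "u \<in> ?V" for u using rp [OF that] cl_V by blast
  have rp_eq: "rp u = rp v \<longleftrightarrow> cl u = cl v" if "u \<in> ?V" "v \<in> ?V" for u v
    using cl_eq [OF rp [OF that(1)] that(1)] cl_eq [OF rp [OF that(2)] that(2)] by (metis rp_def)
  have cl_iff: "cl u = cl v \<longleftrightarrow> u = v \<or> adj G u v" if "u \<in> ?V" "v \<in> ?V" for u v
  proof
    assume "cl u = cl v"
    then have "v \<in> cl u" using cl_self [OF that(2)] by simp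
    then show "u = v \<or> adj G u v" by (auto simp: cl_def)
  next
    assume "u = v \<or> adj G u v"
    then have "v \<in> cl u" using that by (auto simp: cl_def)
    then show "cl u = cl v" using cl_eq [OF _ that(1)] by blast
  qed
  have xV: "x \<in> ?V" and yV: "y \<in> ?V" using xy ver [OF xy(1)] V by auto
  define i where "i = (if finite (cl x) then enat (card (cl x)) else \<infinity>)"
  have size: "\<exists>e. bij_betw e (cl u) {k. enat k < i}" if u: "u \<in> ?V" for u
  proof -
    have "partial_iso G G {(x, u)}"
      using xV u irr V by (simp add: partial_iso_def)
    then obtain g where g: "is_iso g G G" "g x = u"
      using ultrahomogeneous_partial_iso [OF G(3)] by (metis insertI1)
    have bg: "bij_betw g (verts G) (verts G)" and
      gc: "\<And>v. v \<in> verts G \<Longrightarrow> col G (g v) = col G v" and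
      ga: "\<And>v w. v \<in> verts G \<Longrightarrow> w \<in> verts G \<Longrightarrow> adj G (g v) (g w) \<longleftrightarrow> adj G v w"
      using g(1) by (auto simp: is_iso_def)
    have gi: "g v = g w \<longleftrightarrow> v = w" and gv: "g v \<in> verts G" if "v \<in> verts G" "w \<in> verts G" for v w
      using that bg by (auto simp: bij_betw_def inj_on_def)
    have in_iff: "g v \<in> cl u \<longleftrightarrow> v \<in> cl x" if "v \<in> verts G" for v
      using that gc [OF that] ga [of x v] gi [of v x] gv [OF that that] g(2) xV
      by (auto simp: cl_def V)
    have clx: "cl x \<subseteq> verts G" "cl u \<subseteq> verts G" by (auto simp: cl_def V)
    have "g ` cl x = cl u"
    proof (intro subset_antisym subsetI)
      fix w assume w: "w \<in> cl u"
      then have "w \<in> g ` verts G" using bg clx(2) by (auto simp: bij_betw_def)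
      then show "w \<in> g ` cl x" using in_iff w by blast
    qed (use in_iff clx(1) in blast)
    moreover have "inj_on g (cl x)" using bg clx(1) inj_on_subset by (metis bij_betw_def)
    ultimately have b: "bij_betw g (cl x) (cl u)" by (simp add: bij_betw_def)
    have "i = (if finite (cl u) then enat (card (cl u)) else \<infinity>)"
      using bij_betw_finite [OF b] bij_betw_same_card [OF b] by (simp add: i_def)
    moreover have "countable (cl u)" using G(2) clx(2) countable_subset by blast
    ultimately show ?thesis using bij_betw_initial_segment by blast
  qed
  \<comment> \<open>Attached to the clique as a set, so that its vertices share one numbering; it
    yields the second coordinate in the blow-up.\<close>
  define \<epsilon> :: "'a set \<Rightarrow> 'a \<Rightarrow> nat" where "\<epsilon> Q = (SOME e. bij_betw e Q {k. enat k < i})" for Q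
  have \<epsilon>: "bij_betw (\<epsilon> (cl u)) (cl u) {k. enat k < i}" if "u \<in> ?V" for u
    using size [OF that] unfolding \<epsilon>_def by (rule someI_ex)
  define H where "H = induced G ({u. col G u \<noteq> c} \<union> rp ` ?V)"
  define B where "B = blow_up H c i"
  define f where "f v = (if col G v = c then (rp v, \<epsilon> (cl v) v) else (v, 0))" for v
  have Hv: "u \<in> verts H \<longleftrightarrow> u \<in> verts G \<and> (col G u = c \<longrightarrow> u \<in> rp ` ?V)" for u
    by (auto simp: H_def V rp_V)
  have Hc: "col H = col G" by (simp add: H_def)
  have Ha: "adj H u v \<longleftrightarrow> u \<in> verts H \<and> v \<in> verts H \<and> adj G u v" for u v
    using ver [of u v] by (auto simp: H_def)
  have Bv: "(u, k) \<in> verts B \<longleftrightarrow> u \<in> verts H \<and> (if col G u = c then enat k < i else k = 0)" for u k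
    by (simp add: B_def blow_up_def blow_up_verts_def Hc)
  have Bc: "col B p = col G (fst p)" for p by (simp add: B_def blow_up_def Hc)
  have Ba: "adj B p q \<longleftrightarrow> p \<in> verts B \<and> q \<in> verts B \<and>
      (adj H (fst p) (fst q) \<or> fst p = fst q \<and> snd p \<noteq> snd q)" for p q
    by (simp add: B_def blow_up_def)
  have rp_adj: "\<not> adj G (rp u) (rp v)" if "u \<in> ?V" "v \<in> ?V" for u v
  proof
    assume a: "adj G (rp u) (rp v)"
    then have "cl (rp u) = cl (rp v)" using cl_iff rp_V that by blast
    then have "cl u = cl v" using cl_eq rp that by metis
    then have "rp u = rp v" using rp_eq that by blast
    then show False using a irr by simp
  qed
  have fB: "f v \<in> verts B" if v: "v \<in> verts G" for v
  proof (cases "col G v = c")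
    case True
    then have vV: "v \<in> ?V" using v V by blast
    then have "\<epsilon> (cl v) v \<in> {k. enat k < i}" using \<epsilon> cl_self by (metis bij_betwE)
    then show ?thesis using True rp_V [OF vV] vV V Hv by (auto simp: f_def Bv)
  next
    case False
    then show ?thesis using v by (simp add: f_def Bv Hv)
  qed
  have finj: "v = w" if "v \<in> verts G" "w \<in> verts G" "f v = f w" for v w
  proof (cases "col G v = c")
    case True
    then have vV: "v \<in> ?V" using that V by blast
    then have "col G w = c" using that(3) True rp_V [OF vV] V by (auto simp: f_def split: if_splits)
    then have wV: "w \<in> ?V" and e: "rp v = rp w" "\<epsilon> (cl v) v = \<epsilon> (cl w) w"
      using that True V by (auto simp: f_def)
    have "cl v = cl w" using e(1) rp_eq vV wV by blast
    then show ?thesis using e(2) \<epsilon> [OF vV] cl_self [OF vV] cl_self [OF wV] by (metis bij_betw_def inj_onD)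
  next
    case False
    show ?thesis
    proof (cases "col G w = c")
      case True
      then have "w \<in> ?V" using that V by blast
      then show ?thesis using that(3) False True rp_V V by (auto simp: f_def)
    next
      case False
      then show ?thesis using that(3) \<open>col G v \<noteq> c\<close> by (simp add: f_def)
    qed
  qed
  have fsurj: "\<exists>v \<in> verts G. f v = p" if p: "p \<in> verts B" for p
  proof -
    obtain u k where uk: "p = (u, k)" by force
    show ?thesis
    proof (cases "col G u = c")
      case True
      then obtain w where w: "w \<in> ?V" "u = rp w" "enat k < i" using p Hv by (auto simp: uk Bv)
      then obtain v where v: "v \<in> cl w" "\<epsilon> (cl w) v = k"
        using \<epsilon> [OF w(1)] by (metis bij_betw_imp_surj_on imageE mem_Collect_eq)
      then have vV: "v \<in> ?V" and "cl v = cl w" using cl_V cl_eq w(1) by blast+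
      then have "rp v = u" "\<epsilon> (cl v) v = k" using rp_eq w v by auto
      then show ?thesis using vV V uk by (auto simp: f_def)
    next
      case False
      then show ?thesis using p Hv uk by (auto simp: Bv f_def)
    qed
  qed
  have "bij_betw f (verts G) (verts B)"
    unfolding bij_betw_def inj_on_def using fB finj fsurj by blast
  moreover have "col B (f v) = col G v" if "v \<in> verts G" for v
  proof (cases "col G v = c")
    case True
    then have "rp v \<in> ?V" using rp_V that V by blast
    then show ?thesis using True by (simp add: f_def Bc V)
  qed (simp add: f_def Bc)
  moreover have "adj B (f v) (f w) \<longleftrightarrow> adj G v w" if v: "v \<in> verts G" and w: "w \<in> verts G" for v w
  proof -
    have mixed: "adj G z u \<longleftrightarrow> adj G z (rp u)" if "u \<in> ?V" "z \<in> verts G" "col G z \<noteq> c" for u z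
    proof -
      have "rp u = u \<or> adj G u (rp u)" using rp [OF that(1)] by (auto simp: cl_def)
      moreover have "col G u = c" "col G (rp u) = c" using that(1) rp_V [OF that(1)] by (simp_all add: V)
      ultimately show ?thesis
        using unsep [of u "rp u" z] unsep [of "rp u" u z] that(2,3) sym [of u "rp u"] by metis
    qed
    have rH: "rp u \<in> verts H" if "u \<in> ?V" for u using that rp_V V Hv by blast
    have fst: "adj B (f v) (f w) \<longleftrightarrow> adj H (fst (f v)) (fst (f w)) \<or> fst (f v) = fst (f w) \<and> snd (f v) \<noteq> snd (f w)"
      using fB [OF v] fB [OF w] by (simp add: Ba)
    consider "v \<in> ?V" "w \<in> ?V" | "v \<in> ?V" "col G w \<noteq> c" | "col G v \<noteq> c" "w \<in> ?V" | "col G v \<noteq> c" "col G w \<noteq> c"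
      using v w V by blast
    then show ?thesis
    proof cases
      case 1
      then have f: "f v = (rp v, \<epsilon> (cl v) v)" "f w = (rp w, \<epsilon> (cl w) w)" by (auto simp: f_def V)
      have "adj B (f v) (f w) \<longleftrightarrow> rp v = rp w \<and> \<epsilon> (cl v) v \<noteq> \<epsilon> (cl w) w"
        using fst f rp_adj 1 by (simp add: Ha)
      also have "\<dots> \<longleftrightarrow> cl v = cl w \<and> f v \<noteq> f w" using f rp_eq 1 by auto
      also have "\<dots> \<longleftrightarrow> cl v = cl w \<and> v \<noteq> w" using finj v w by blast
      also have "\<dots> \<longleftrightarrow> adj G v w" using cl_iff 1 irr by blast
      finally show ?thesis .
    next
      case 2
      then have "f v = (rp v, \<epsilon> (cl v) v)" "f w = (w, 0)" by (auto simp: f_def V)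
      moreover have "rp v \<noteq> w" using rp_V 2 V by auto
      moreover have "w \<in> verts H" using 2 w Hv by blast
      ultimately show ?thesis using fst rH [OF 2(1)] mixed [OF 2(1) w 2(2)] sym by (auto simp: Ha)
    next
      case 3
      then have "f w = (rp w, \<epsilon> (cl w) w)" "f v = (v, 0)" by (auto simp: f_def V)
      moreover have "rp w \<noteq> v" using rp_V 3 V by auto
      moreover have "v \<in> verts H" using 3 v Hv by blast
      ultimately show ?thesis using fst rH [OF 3(2)] mixed [OF 3(2) v 3(1)] by (auto simp: Ha)
    next
      case 4
      then show ?thesis using fst v w by (auto simp: f_def Ha Hv)
    qed
  qed
  ultimately have "isomorphic G B" unfolding isomorphic_def is_iso_def by blast
  moreover have "two_colored_graph H" using G(1) by (auto simp: two_colored_graph_def H_def)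
  moreover have "independent_set H (color_class H c)"
    using rp_adj by (auto simp: independent_set_def color_class_def Hv Hc Ha)
  moreover have "2 \<le> i"
  proof (cases "finite (cl x)")
    case True
    have "{x, y} \<subseteq> cl x" "x \<noteq> y" using xy xV yV irr by (auto simp: cl_def)
    then have "2 \<le> card (cl x)" using card_mono [OF True, of "{x, y}"] by simp
    then show ?thesis using True by (simp add: i_def numeral_eq_enat)
  qed (simp add: i_def)
  ultimately show ?thesis unfolding is_blow_up_def B_def by blast
qed

lemma basic_graphI:
  assumes "CUH G" "basic G"
  shows "basic_graph G"
proof
  have G: "two_colored_graph G" "countable (verts G)" "infinite (verts G)" "ultrahomogeneous G"
    and du: "\<And>c. disjoint_union_of_cliques (induced G (color_class G c))"
  proof -
    show "disjoint_union_of_cliques (induced G (color_class G c))" for c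
      using assms(1) by (cases c) (auto simp: CUH_def)
  qed (use assms(1) in \<open>auto simp: CUH_def\<close>)
  have nb: "\<not> is_blow_up G" and al: "\<And>c. 2 \<le> alpha G c"
  proof -
    show "2 \<le> alpha G c" for c using assms(2) by (cases c) (auto simp: basic_def)
  qed (use assms(2) in \<open>auto simp: basic_def\<close>)
  show "two_colored_graph G" "infinite (verts G)" "ultrahomogeneous G" by fact+
  show tr: "adj G x z" if "adj G x y" "adj G y z" "x \<noteq> z" "col G x = col G y" "col G y = col G z" for x y z
    using cliques_transitive [OF du G(1) that(1-3)] that(4,5) by simp
  show "\<exists>x \<in> color_class G c. \<exists>y \<in> color_class G c. x \<noteq> y \<and> \<not> adj G x y" for c
    using alpha_ge_2 [OF al] by metis
  show "\<exists>x' y' z. adj G x' y' \<and> col G x' = c \<and> col G y' = c \<and> z \<in> verts G \<and> col G z \<noteq> c \<and>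
      adj G z x' \<and> \<not> adj G z y'" if xy: "adj G x y" "col G x = c" "col G y = c" for x y c
  proof (rule ccontr)
    assume no: "\<not> ?thesis"
    have "is_blow_up G"
    proof (rule unseparated_imp_blow_up [OF G(1,2,4) _ xy])
      show "adj G u w" if "adj G u v" "adj G v w" "u \<noteq> w" "col G u = c" "col G v = c" "col G w = c" for u v w
        using tr that by metis
      show "adj G z v" if "adj G u v" "col G u = c" "col G v = c" "z \<in> verts G" "col G z \<noteq> c" "adj G z u" for u v z
        using no that by blast
    qed
    then show False using nb by blast
  qed
qed


text \<open>Complementing flips all four cross pairs of a pattern and keeps an even number of edges
  even. So omitting \<open>Dt\<close> reduces to omitting \<open>D\<close> in the cross
  complement.\<close>

lemma (in basic_graph) omits_imp_parity:
  assumes "omits G D \<or> omits G Dt" "nontriv Red" "nontriv Blue"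
  shows "parity Red Blue"
  using assms(1)
proof
  assume "omits G D"
  then have "\<not> quad G True" using realized_quads [OF graph] by blast
  then have "no_D Red Blue" unfolding no_D_def quad_def by blast
  then show ?thesis using no_D_imp_parity assms(2,3) by blast
next
  interpret K: basic_graph "cross_complement G"
    by (rule basic_graph_cross_complement) (rule basic_graph_axioms)
  have nK: "K.nontriv e \<longleftrightarrow> nontriv e" for e
    unfolding K.nontriv_def nontriv_def cross_complement_fields(3) by (metis complement_E_same)
  assume "omits G Dt"
  then have "omits (cross_complement G) D"
    using realized_cross_complement_iff [OF graph two_colored_graph_small(5)] cross_complement_simps by metis
  then have "\<not> quad (cross_complement G) True" using realized_quads [OF K.graph] by blast
  then have "K.no_D Red Blue" unfolding K.no_D_def quad_def by blast
  then have par: "K.parity Red Blue" using K.no_D_imp_parity assms(2,3) nK by blast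
  have cc: "color_class (cross_complement G) e = V e" for e by (auto simp: color_class_def)
  have cross: "adj (cross_complement G) x y \<longleftrightarrow> \<not> E x y" if "x \<in> V Red" "y \<in> V Blue" for x y
    using that by (auto simp: V_iff)
  show ?thesis
    unfolding parity_def
  proof (intro ballI impI)
    fix x x' y y' assume V: "x \<in> V Red" "x' \<in> V Red" "y \<in> V Blue" "y' \<in> V Blue" and e: "E x x'" "E y y'"
    have "adj (cross_complement G) x x'" "adj (cross_complement G) y y'"
      using V e complement_E_same by (simp_all add: V_iff)
    then have "(adj (cross_complement G) x y \<longleftrightarrow> adj (cross_complement G) x' y) \<longleftrightarrow>
        (adj (cross_complement G) x y' \<longleftrightarrow> adj (cross_complement G) x' y')"
      using par V unfolding K.parity_def cc by blast
    then show "(E x y \<longleftrightarrow> E x' y) \<longleftrightarrow> (E x y' \<longleftrightarrow> E x' y')"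
      using cross V by blast
  qed
qed

section \<open>Minimally omitted graphs, and invariance under complementing the cross edges\<close>

abbreviation (input) six :: "nat cgraph set" where
  "six \<equiv> {T_r, Tt_r, T_b, Tt_b, D, Dt}"

lemma realized_six:
  assumes "two_colored_graph G" "two_colored_graph H"
    and "\<And>F. F \<in> six \<Longrightarrow> realized H F \<Longrightarrow> realized G F"
  shows "tri H c s \<Longrightarrow> tri G c s" "quad H s \<Longrightarrow> quad G s"
proof -
  have "tri H c s \<longrightarrow> tri G c s"
    using assms(3) [of T_r] assms(3) [of Tt_r] assms(3) [of T_b] assms(3) [of Tt_b]
      realized_triangles [OF assms(1)] realized_triangles [OF assms(2)] by (cases c; cases s) simp_all
  moreover have "quad H s \<longrightarrow> quad G s"
    using assms(3) [of D] assms(3) [of Dt] realized_quads [OF assms(1)] realized_quads [OF assms(2)]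
    by (cases s) simp_all
  ultimately show "tri H c s \<Longrightarrow> tri G c s" "quad H s \<Longrightarrow> quad G s" by blast+
qed

lemma two_colored_graph_induced: "two_colored_graph G \<Longrightarrow> two_colored_graph (induced G S)"
  by (auto simp: two_colored_graph_def)

text \<open>Both colour classes of \<open>H\<close> are proper subsets, hence realized in
  \<open>G\<close>. A member of \<open>six\<close> inside \<open>H\<close> occupies a proper subset
  unless it is isomorphic to \<open>H\<close>, so by minimality it is realized in \<open>G\<close>
  as well, and \<open>ext\<close> would realize \<open>H\<close>.\<close>

lemma min_omitted_six:
  assumes H: "H \<in> min_omitted G" and nm: "\<not> monochromatic H"
    and ext: "two_colored_graph H \<Longrightarrow> finite (verts H) \<Longrightarrow>
      (\<And>c. realized G (induced H (color_class H c))) \<Longrightarrow>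
      (\<And>F. F \<in> six \<Longrightarrow> realized H F \<Longrightarrow> realized G F) \<Longrightarrow> realized G H"
  shows "\<exists>F \<in> six. isomorphic H F"
proof (rule ccontr)
  assume no: "\<not> ?thesis"
  have H': "two_colored_graph H" "finite (verts H)" "omits G H"
    and proper: "\<And>S. S \<subset> verts H \<Longrightarrow> realized G (induced H S)"
    using H by (auto simp: min_omitted_def)
  have "realized G (induced H (color_class H c))" for c
  proof (rule proper)
    show "color_class H c \<subset> verts H" using nm by (auto simp: monochromatic_def color_class_def)
  qed
  moreover have "realized G F" if F: "F \<in> six" "realized H F" for F
  proof -
    obtain S where S: "S \<subseteq> verts H" "isomorphic F (induced H S)" using F(2) by (auto simp: realized_def)
    have "S \<noteq> verts H"
    proof
      assume "S = verts H"
      moreover have "induced H (verts H) = H"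
      proof -
        have "adj (induced H (verts H)) = adj H" using H'(1) by (auto simp: fun_eq_iff two_colored_graph_def)
        then show ?thesis by (simp add: induced_def)
      qed
      ultimately have "isomorphic H F" using S(2) isomorphic_sym by metis
      then show False using no F(1) by blast
    qed
    then have "realized G (induced H S)" using proper S(1) by blast
    moreover have "realized (induced H S) F"
    proof -
      obtain f where "is_iso f F (induced H S)" using S(2) by (auto simp: isomorphic_def)
      then have "embedding f F (induced H S)" by (auto simp: is_iso_def embedding_def bij_betw_def)
      then show ?thesis using realized_iff_embedding by blast
    qed
    ultimately show ?thesis using realized_trans by blast
  qed
  ultimately show False using ext H' by blast
qed

lemma induced_cross_complement:
  assumes "S \<subseteq> verts H"
  shows "induced (cross_complement H) S = cross_complement (induced H S)"
proof -
  have "adj (induced (cross_complement H) S) = adj (cross_complement (induced H S))"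
    using assms by (auto simp: fun_eq_iff)
  then show ?thesis by (simp add: induced_def cross_complement_def)
qed

lemma induced_color_class_cross_complement:
  assumes "two_colored_graph H"
  shows "induced (cross_complement H) (color_class (cross_complement H) c) = induced H (color_class H c)"
proof -
  have "adj (induced (cross_complement H) (color_class (cross_complement H) c)) =
      adj (induced H (color_class H c))"
    using assms by (auto simp: fun_eq_iff two_colored_graph_def color_class_def)
  then show ?thesis by (simp add: induced_def cross_complement_def color_class_def)
qed

text \<open>Complementing commutes with passing to induced subgraphs, so both omission and
  minimality transfer.\<close>

lemma min_omitted_cross_complement:
  fixes H :: "'b cgraph"
  assumes H: "two_colored_graph H"
    and closed: "\<And>K :: 'b cgraph. two_colored_graph K \<Longrightarrow> finite (verts K) \<Longrightarrow>
      realized G (cross_complement K) \<longleftrightarrow> realized G K"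
  shows "cross_complement H \<in> min_omitted G \<longleftrightarrow> H \<in> min_omitted G"
proof -
  have "realized G (induced (cross_complement H) S) \<longleftrightarrow> realized G (induced H S)"
    if "S \<subset> verts H" "finite (verts H)" for S
    using that induced_cross_complement [of S H] closed [OF two_colored_graph_induced [OF H], of S] by auto
  then show ?thesis
    using H closed [OF H] two_colored_graph_cross_complement [OF H] unfolding min_omitted_def by auto
qed

context basic_graph
begin

context
  assumes nt: "nontriv Red \<or> nontriv Blue"
    and par: "nontriv Red \<Longrightarrow> nontriv Blue \<Longrightarrow> parity Red Blue"
begin

lemma realized_if_six:
  assumes "two_colored_graph H" "finite (verts H)"
    "\<And>c. realized G (induced H (color_class H c))"
    and six: "\<And>F. F \<in> six \<Longrightarrow> realized H F \<Longrightarrow> realized G F"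
  shows "realized G H"
proof (rule realizedI [OF nt par assms(1,2,3)])
  show "tri H c s \<Longrightarrow> tri G c s" "quad H s \<Longrightarrow> quad G s" for c s
    using realized_six [OF graph assms(1)] six by blast+
qed

lemma six_cross_complement:
  assumes "F \<in> six"
  shows "realized G (cross_complement F) \<longleftrightarrow> realized G F"
  using assms realized_triangles [OF graph] realized_quads [OF graph] tri_iff_big [OF nt par]
    not_quad [OF par] by (auto simp: cross_complement_simps)

text \<open>Complementing leaves the induced colour classes unchanged. A member \<open>F\<close> of
  \<open>six\<close> in the complement of \<open>K\<close> gives its own complement in
  \<open>K\<close>, hence in \<open>G\<close>, and thus \<open>F\<close> in \<open>G\<close>; so the
  criterion \<open>realized_if_six\<close> applies.\<close>

lemma realized_imp_realized_cross_complement: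
  assumes K: "two_colored_graph K" "finite (verts K)" and r: "realized G K"
  shows "realized G (cross_complement K)"
proof (rule realized_if_six)
  show "two_colored_graph (cross_complement K)" using K(1) by (rule two_colored_graph_cross_complement)
  show "finite (verts (cross_complement K))" using K(2) by simp
  show "realized G (induced (cross_complement K) (color_class (cross_complement K) c))" for c
    unfolding induced_color_class_cross_complement [OF K(1)]
    using realized_trans [OF realized_induced r] .
  fix F assume F: "F \<in> six" "realized (cross_complement K) F"
  have "two_colored_graph F" using F(1) two_colored_graph_small by auto
  then have "realized K (cross_complement F)" using F(2) realized_cross_complement_iff [OF K(1)] by blast
  then have "realized G (cross_complement F)" using r realized_trans by blast
  then show "realized G F" using six_cross_complement [OF F(1)] by blast
qed

lemma realized_cross_complement_closed:
  assumes K: "two_colored_graph K" "finite (verts K)"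
  shows "realized G (cross_complement K) \<longleftrightarrow> realized G K"
  using realized_imp_realized_cross_complement [OF K]
    realized_imp_realized_cross_complement [of "cross_complement K"] K
    two_colored_graph_cross_complement [OF K(1)] cross_complement_cross_complement [OF K(1)] by auto

lemma isomorphic_cross_complement:
  assumes "countable (verts G)"
  shows "isomorphic G (cross_complement G)"
proof (rule back_and_forth)
  interpret K: basic_graph "cross_complement G"
    by (rule basic_graph_cross_complement) (rule basic_graph_axioms)
  show "ultrahomogeneous G" "ultrahomogeneous (cross_complement G)" by (rule uh, rule K.uh)
  show "verts G \<noteq> {}" "verts (cross_complement G) \<noteq> {}" using infinite_verts by auto
  show "countable (verts G)" "countable (verts (cross_complement G))" using assms by simp_all
next
  fix A assume A: "finite A" "A \<subseteq> verts G"
  have iA: "two_colored_graph (induced G A)" "finite (verts (induced G A))"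
    using two_colored_graph_induced [OF graph] A by auto
  have c: "realized G (cross_complement (induced G A))"
    using realized_cross_complement_closed [OF iA] realized_induced by blast
  then show "realized (cross_complement G) (induced G A)"
    using realized_cross_complement_iff [OF graph iA(1)] by blast
next
  fix A assume A: "finite A" "A \<subseteq> verts (cross_complement G)"
  then have A': "A \<subseteq> verts G" by simp
  have iA: "two_colored_graph (induced G A)" "finite (verts (induced G A))"
    using two_colored_graph_induced [OF graph] A by auto
  show "realized G (induced (cross_complement G) A)"
    unfolding induced_cross_complement [OF A']
    using realized_cross_complement_closed [OF iA] realized_induced by blast
qed

end

end

theorem theorem5p1:
  fixes G :: "'a cgraph"
  assumes "CUH G" and "basic G"
    and "omits G D \<or> omits G Dt"
    and "\<not> (independent_set G (color_class G Red) \<and> independent_set G (color_class G Blue))"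
  shows "(\<forall>H :: 'b cgraph. H \<in> min_omitted G \<and> \<not> monochromatic H \<longrightarrow>
            (\<exists>F \<in> {T_r, Tt_r, T_b, Tt_b, D, Dt}. isomorphic H F)) \<and>
         (\<forall>H \<in> {T_r, Tt_r, T_b, Tt_b, D, Dt}.
            H \<in> min_omitted G \<longleftrightarrow> cross_complement H \<in> min_omitted G) \<and>
         isomorphic G (cross_complement G)"
proof -
  interpret basic_graph G using assms(1,2) by (rule basic_graphI)
  have nt: "nontriv Red \<or> nontriv Blue"
    using assms(4) unfolding independent_set_def nontriv_def color_class_def by blast
  note par = omits_imp_parity [OF assms(3)]
  show ?thesis
  proof (intro conjI allI impI ballI)
    fix H :: "'b cgraph" assume H: "H \<in> min_omitted G \<and> \<not> monochromatic H"
    show "\<exists>F \<in> six. isomorphic H F"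
    proof (rule min_omitted_six [OF conjunct1 [OF H] conjunct2 [OF H]])
      assume *: "two_colored_graph H" "finite (verts H)" "\<And>c. realized G (induced H (color_class H c))"
        "\<And>F. F \<in> six \<Longrightarrow> realized H F \<Longrightarrow> realized G F"
      show "realized G H" by (rule realized_if_six [OF nt]) (fact par *)+
    qed
  next
    fix H assume "H \<in> six"
    then have "two_colored_graph H" using two_colored_graph_small by auto
    then show "H \<in> min_omitted G \<longleftrightarrow> cross_complement H \<in> min_omitted G"
      using min_omitted_cross_complement realized_cross_complement_closed [OF nt par] by blast
  next
    show "isomorphic G (cross_complement G)"
      using isomorphic_cross_complement [OF nt par] assms(1) by (auto simp: CUH_def)
  qed
qed

end
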